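(* Let $\ell$ be a line and let $S_1,S_2,S_3$ be three distinct spheres in $\mathbb{R}^3$. Then there are infinitely many lines in $\mathbb{R}^3$ that meet $\ell$ and are tangent to each of $S_1,S_2,S_3$ in precisely the following cases (in each case the description of "the common tangent lines" describes the infinite family of such lines, disregarding possibly finitely many further ones): (i) The three spheres are tangent to each other at the same point, and either (a) $\ell$ contains that point, or (b) $\ell$ lies in the common tangent plane at that point, or both. The common tangent lines are the lines in the common tangent plane passing through the point of tangency. (ii) The spheres are tangent to a cone whose apex lies on $\ell$. The common tangent lines are the ruling of the cone. (iii) The spheres meet in a common circle and $\ell$ lies in the plane of that circle. The common tangent lines are the lines in that plane tangent to the circle. (iv) The centres of the spheres lie on a line $m$, $\ell$ is tangent to all three spheres, and the surface obtained by rotating $\ell$ about $m$ is a hyperboloid of revolution. The common tangent lines are one ruling of this hyperboloid. In cases (i)(b), (iii) and (iv), lines parallel to $\ell$ are excluded from the families of common tangent lines.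
   Context: A sphere in $\mathbb{R}^3$ has positive radius. In (ii), a cone is a (double) circular cone in $\mathbb{R}^3$, not a cylinder; the spheres being tangent to it means they are inscribed in it, i.e. every line of its ruling is tangent to each sphere. A hyperboloid of one sheet has two rulings by lines. "Lines parallel to $\ell$" are excluded because they do not meet $\ell$ in $\mathbb{R}^3$ (so this refers to parallel lines different from $\ell$). *)

theory Defs
  imports "HOL-Analysis.Analysis"
begin

type_synonym points = "(real^3) set"

definition is_line :: "points \<Rightarrow> bool"
  where "is_line L \<longleftrightarrow> affine L \<and> aff_dim L = 1"

definition is_plane :: "points \<Rightarrow> bool"
  where "is_plane P \<longleftrightarrow> affine P \<and> aff_dim P = 2"

definition lines_in :: "points \<Rightarrow> points set"
  where "lines_in X = {L. is_line L \<and> L \<subseteq> X}"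

(* Used only when X is a sphere, or a circle lying in a plane that contains L;
   in both cases, meeting X in exactly one point is tangency. *)
definition tangent_line :: "points \<Rightarrow> points \<Rightarrow> bool"
  where "tangent_line L X \<longleftrightarrow> is_line L \<and> (\<exists>p. L \<inter> X = {p})"

(* Lines parallel to l and different from l: affine_parallel also relates l to itself. *)
definition proper_parallels :: "points \<Rightarrow> points set"
  where "proper_parallels l = {L. is_line L \<and> affine_parallel l L \<and> L \<noteq> l}"

(* Throughout, three spheres are given by their centres c i and radii r i, i :: 3. *)
definition common_tangents_meeting :: "points \<Rightarrow> (3 \<Rightarrow> real^3) \<Rightarrow> (3 \<Rightarrow> real) \<Rightarrow> points set"
  where "common_tangents_meeting l c r =
    {L. is_line L \<and> L \<inter> l \<noteq> {} \<and> (\<forall>i. tangent_line L (sphere (c i) (r i)))}"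

definition infinite_family :: "'a set \<Rightarrow> 'a set \<Rightarrow> bool"
  where "infinite_family F T \<longleftrightarrow> F \<subseteq> T \<and> infinite F \<and> finite (T - F)"

(* The tangent plane at p of the sphere with centre c through p. *)
definition tangent_plane :: "real^3 \<Rightarrow> real^3 \<Rightarrow> points"
  where "tangent_plane c p = {x. (x - p) \<bullet> (p - c) = 0}"

(* Both internal and external tangency are allowed. *)
definition tangent_at :: "(3 \<Rightarrow> real^3) \<Rightarrow> (3 \<Rightarrow> real) \<Rightarrow> real^3 \<Rightarrow> points \<Rightarrow> bool"
  where "tangent_at c r p P \<longleftrightarrow> (\<forall>i. p \<in> sphere (c i) (r i) \<and> tangent_plane (c i) p = P)"

(* Double right circular cone; \<theta> is the angle between the axis and the generating lines,
   so that cylinders, planes and lines do not count as cones. *)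
definition circular_cone :: "points \<Rightarrow> real^3 \<Rightarrow> bool"
  where "circular_cone K a \<longleftrightarrow>
    (\<exists>u \<theta>. norm u = 1 \<and> 0 < \<theta> \<and> \<theta> < pi / 2 \<and>
       K = {x. \<bar>(x - a) \<bullet> u\<bar> = cos \<theta> * norm (x - a)})"

(* The ruling of a cone K consists of all lines contained in K. *)
definition inscribed_in_cone :: "(3 \<Rightarrow> real^3) \<Rightarrow> (3 \<Rightarrow> real) \<Rightarrow> points \<Rightarrow> real^3 \<Rightarrow> bool"
  where "inscribed_in_cone c r K a \<longleftrightarrow>
    circular_cone K a \<and> (\<forall>L\<in>lines_in K. \<forall>i. tangent_line L (sphere (c i) (r i)))"

definition circle_in_plane :: "points \<Rightarrow> points \<Rightarrow> bool"
  where "circle_in_plane C P \<longleftrightarrow>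
    is_plane P \<and> (\<exists>z\<in>P. \<exists>\<rho>>0. C = sphere z \<rho> \<inter> P)"

definition meet_in_circle :: "(3 \<Rightarrow> real^3) \<Rightarrow> (3 \<Rightarrow> real) \<Rightarrow> points \<Rightarrow> points \<Rightarrow> bool"
  where "meet_in_circle c r C P \<longleftrightarrow>
    circle_in_plane C P \<and> (\<Inter>i. sphere (c i) (r i)) = C"

(* An orientation-preserving isometry that fixes the line m pointwise. *)
definition rotation_about :: "points \<Rightarrow> (real^3 \<Rightarrow> real^3) \<Rightarrow> bool"
  where "rotation_about m f \<longleftrightarrow>
    (\<exists>Q b. rotation_matrix Q \<and> f = (\<lambda>x. Q *v x + b)) \<and> (\<forall>x\<in>m. f x = x)"

definition surface_of_revolution :: "points \<Rightarrow> points \<Rightarrow> points"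
  where "surface_of_revolution l m = (\<Union>f\<in>{f. rotation_about m f}. f ` l)"

(* One sheet, with centre z, axis direction u and semi-axes a, a, b. *)
definition hyperboloid_of_revolution :: "points \<Rightarrow> bool"
  where "hyperboloid_of_revolution H \<longleftrightarrow>
    (\<exists>z u a b. norm u = 1 \<and> a > 0 \<and> b > 0 \<and>
       H = {x. ((norm (x - z))\<^sup>2 - ((x - z) \<bullet> u)\<^sup>2) / a\<^sup>2 - ((x - z) \<bullet> u)\<^sup>2 / b\<^sup>2 = 1})"

(* A one-sheeted hyperboloid has exactly two rulings in this sense. *)
definition is_ruling :: "points set \<Rightarrow> points \<Rightarrow> bool"
  where "is_ruling R H \<longleftrightarrow> R \<subseteq> lines_in H \<and> (\<forall>x\<in>H. \<exists>!L. L \<in> R \<and> x \<in> L)"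

definition tangent_generator ::
    "points \<Rightarrow> (3 \<Rightarrow> real^3) \<Rightarrow> (3 \<Rightarrow> real) \<Rightarrow> points \<Rightarrow> bool"
  where "tangent_generator l c r m \<longleftrightarrow>
    is_line m \<and> range c \<subseteq> m \<and> (\<forall>i. tangent_line l (sphere (c i) (r i))) \<and>
    hyperboloid_of_revolution (surface_of_revolution l m)"

end

theory Submission
  imports Defs "HOL-Computational_Algebra.Polynomial_Factorial" "HOL-Computational_Algebra.Field_as_Ring"
begin

text \<open>
  A line through the point \<open>p\<close> with unit direction \<open>v\<close> is tangent to the sphere with centre \<open>c\<close> and
  radius \<open>r\<close> iff \<open>((p - c) \<bullet> v)\<^sup>2\<close> equals the power of \<open>p\<close> with respect to the sphere. For
  \<open>p\<close> running along \<open>l\<close> with parameter \<open>s\<close>, the powers with respect to the three spheres are monic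
  quadratics \<open>q1\<close>, \<open>q2\<close>, \<open>q3\<close> in \<open>s\<close>. Eliminating \<open>v\<close> by Cramer's rule gives one relation
  between \<open>1\<close> and the products of two of the square roots of the \<open>qi\<close>. Such a relation, holding for
  infinitely many \<open>s\<close>, splits into polynomial identities unless some \<open>qi qj\<close> is a square, that is,
  \<open>qi = qj\<close> or both are squares of linear polynomials. Comparing leading coefficients, which are sums
  of squares of real numbers, then shows in every case that the centres are collinear or that the
  tangent is \<open>l\<close> itself.

  If the centres are collinear, the squared distance from a point of their axis to a line is a quadratic
  polynomial in the position of the point, and so is determined by its values at the three centres. Hence
  all common tangents have the same distance from the axis, the same angle with it and the same foot
  point on it: they rule a cylinder, a plane pencil, the tangents of a circle, a cone or a
  hyperboloid. The line \<open>l\<close> meets this surface in at most two points unless it lies on it, and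
  every point other than the apex lies on only finitely many of the tangents.
\<close>

subsection \<open>Square roots of polynomials on an infinite set\<close>

unbundle cross3_syntax

text \<open>The scalar products of the unit direction with the vectors from the centres to the point
  of \<open>l\<close> are square roots of the powers, but their signs may jump from point to point.
  No continuity is at hand, so the argument rests on polynomial identities over infinite parameter
  sets and on the pigeonhole principle. The leading coefficients can be compared because, for
  vectors w_i = s e - g_i, the term s s (e \<times> e) of a cross product vanishes: normals and
  determinant are linear in s, so the squared Cramer identity has degree 4 on the side of the powers
  and degree at most 2 on the other. Its top coefficient is built from the vectors e \<times> (g_i -
  g_j), which vanish only for edges of the triangle of centres parallel to \<open>l\<close>.

  For collinear centres two numbers remain, the cosine \<open>\<kappa>\<close> of the angle with the
  axis and the distance \<open>h\<close> from it. Case (i) is \<open>\<kappa> = 0\<close>,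
  \<open>h = 0\<close>; (ii) is \<open>0 < \<kappa>\<close>, \<open>h = 0\<close>; (iii) is
  \<open>\<kappa> = 0\<close>, \<open>0 < h\<close>; in (iv) both are positive. Each geometric
  description is converted back into this normal form, so both directions of the equivalence use the
  same families.\<close>

lemma poly_eq_0_of_infinite:
  fixes A :: "real poly"
  assumes "infinite S" "\<And>s. s \<in> S \<Longrightarrow> poly A s = 0"
  shows "A = 0"
proof (rule ccontr)
  assume "A \<noteq> 0"
  then have "finite {s. poly A s = 0}" by (rule poly_roots_finite)
  moreover have "S \<subseteq> {s. poly A s = 0}" using assms(2) by auto
  ultimately show False using assms(1) finite_subset by blast
qed

text \<open>A nonsquare polynomial has no square root among the rational functions either: by unique
  factorization such a root E/F would be a polynomial.\<close>

lemma nonsquare_times_square: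
  fixes E F q :: "real poly"
  assumes ns: "\<nexists>G. q = G^2" and eq: "E^2 = F^2 * q"
  shows "E = 0 \<and> F = 0"
proof -
  have "F = 0"
  proof (rule ccontr)
    assume F: "F \<noteq> 0"
    have "F^2 dvd E^2" using eq by simp
    then have "F dvd E" by simp
    then obtain G where "E = F * G" by (elim dvdE)
    then have "F^2 * G^2 = F^2 * q" using eq by (simp add: power_mult_distrib)
    then have "q = G^2" using F by simp
    then show False using ns by blast
  qed
  then show ?thesis using eq by simp
qed

text \<open>Isolating the root and squaring gives an identity of polynomials. The values
  \<open>f s\<close> may be either root at each \<open>s\<close>, since only their squares
  enter.\<close>

lemma root_independent:
  fixes A B q :: "real poly"
  assumes ns: "\<nexists>G. q = G^2" and inf: "infinite S"
    and f: "\<And>s. s \<in> S \<Longrightarrow> (f s)^2 = poly q s"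
    and eq: "\<And>s. s \<in> S \<Longrightarrow> poly A s + poly B s * f s = 0"
  shows "A = 0 \<and> B = 0"
proof -
  have "A^2 - B^2 * q = 0"
  proof (rule poly_eq_0_of_infinite[OF inf])
    fix s assume s: "s \<in> S"
    have "poly A s = - (poly B s * f s)" using eq[OF s] by simp
    then have "(poly A s)^2 = (poly B s)^2 * (f s)^2" by (simp add: power_mult_distrib)
    then show "poly (A^2 - B^2 * q) s = 0" using f[OF s] by simp
  qed
  then show ?thesis using nonsquare_times_square[OF ns, of A B] by simp
qed

text \<open>
  Squaring \<open>A + B f1 f2 = - f3 (C f1 + D f2)\<close> leaves a relation between \<open>1\<close> and \<open>f1 f2\<close>; the
  three relations obtained in this way force \<open>A = 0\<close>.
\<close>

lemma three_roots_independent: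
  fixes A B C D q1 q2 q3 :: "real poly"
  assumes ns: "\<nexists>G. q1 * q2 = G^2" "\<nexists>G. q1 * q3 = G^2" "\<nexists>G. q2 * q3 = G^2" and inf: "infinite S"
    and f: "\<And>s. s \<in> S \<Longrightarrow> (f1 s)^2 = poly q1 s" "\<And>s. s \<in> S \<Longrightarrow> (f2 s)^2 = poly q2 s"
      "\<And>s. s \<in> S \<Longrightarrow> (f3 s)^2 = poly q3 s"
    and eq: "\<And>s. s \<in> S \<Longrightarrow> poly A s + poly B s * (f1 s * f2 s) + poly C s * (f1 s * f3 s)
      + poly D s * (f2 s * f3 s) = 0"
  shows "A = 0"
proof -
  \<comment> \<open>Generalized over all data, so that the relations for the other two pairs of
    roots come from permuting the indices.\<close>
  have *: "A * B = q3 * (C * D) \<and> A^2 + B^2 * (q1 * q2) = q3 * (C^2 * q1 + D^2 * q2)"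
    if ns: "\<nexists>G. q1 * q2 = G^2"
    and f: "\<And>s. s \<in> S \<Longrightarrow> (f1 s)^2 = poly q1 s" "\<And>s. s \<in> S \<Longrightarrow> (f2 s)^2 = poly q2 s"
      "\<And>s. s \<in> S \<Longrightarrow> (f3 s)^2 = poly q3 s"
    and eq: "\<And>s. s \<in> S \<Longrightarrow> poly A s + poly B s * (f1 s * f2 s) + poly C s * (f1 s * f3 s)
      + poly D s * (f2 s * f3 s) = 0"
    for A B C D q1 q2 q3 :: "real poly" and f1 f2 f3
  proof -
    let ?E = "A^2 + B^2 * (q1 * q2) - q3 * (C^2 * q1 + D^2 * q2)"
    let ?F = "A * B - q3 * (C * D)"
    have "?E = 0 \<and> 2 * ?F = 0"
    proof (rule root_independent[OF ns inf])
      fix s assume s: "s \<in> S"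
      show "(f1 s * f2 s)^2 = poly (q1 * q2) s" using f s by (simp add: power_mult_distrib)
      have "poly A s + poly B s * (f1 s * f2 s) = - (f3 s * (poly C s * f1 s + poly D s * f2 s))"
        using eq[OF s] by (simp add: algebra_simps)
      then have "(poly A s + poly B s * (f1 s * f2 s))^2
          = (f3 s)^2 * (poly C s * f1 s + poly D s * f2 s)^2"
        by (simp add: power_mult_distrib)
      then have "(poly A s)^2 + (poly B s)^2 * ((f1 s)^2 * (f2 s)^2) + 2 * (poly A s * poly B s * (f1 s * f2 s))
        = (f3 s)^2 * ((poly C s)^2 * (f1 s)^2 + (poly D s)^2 * (f2 s)^2 + 2 * (poly C s * poly D s) * (f1 s * f2 s))"
        by (simp add: power2_sum power_mult_distrib algebra_simps)
      then show "poly ?E s + poly (2 * ?F) s * (f1 s * f2 s) = 0"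
        unfolding f[OF s] by (simp add: algebra_simps)
    qed
    then show ?thesis by simp
  qed
  have 1: "A * B = q3 * (C * D)" and E: "A^2 + B^2 * (q1 * q2) = q3 * (C^2 * q1 + D^2 * q2)"
    using *[OF ns(1) f eq] by blast+
  have 2: "A * C = q2 * (B * D)"
    using *[of q1 q3 f1 f3 f2 q2 A C B D] ns(2) f eq by (simp add: algebra_simps)
  have 3: "A * D = q1 * (B * C)"
    using *[of q2 q3 f2 f3 f1 q1 A D B C] ns(3) f eq by (simp add: algebra_simps)
  have q: "q1 \<noteq> 0" "q2 \<noteq> 0" "q3 \<noteq> 0" using ns by (metis mult_zero_left mult_zero_right power_zero_numeral)+
  have BC: "B * C = 0"
  proof (rule ccontr)
    assume "B * C \<noteq> 0"
    \<comment> \<open>The product of the relations for \<open>A * B\<close> and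
      \<open>A * C\<close>, in which \<open>B * C\<close> cancels.\<close>
    moreover have "A^2 * (B * C) = (q2 * q3 * D^2) * (B * C)"
      using 1 2 by (metis (no_types, lifting) mult.assoc mult.commute power2_eq_square)
    ultimately have "A^2 = D^2 * (q2 * q3)" by (simp add: mult.commute)
    then have "A = 0 \<and> D = 0" by (rule nonsquare_times_square[OF ns(3)])
    then show False using 3 q \<open>B * C \<noteq> 0\<close> by simp
  qed
  show ?thesis
  proof (rule ccontr)
    assume A: "A \<noteq> 0"
    then have "D = 0" using 3 BC by simp
    then have "B = 0" "C = 0" using 1 2 A by auto
    then show False using E A \<open>D = 0\<close> by simp
  qed
qed

text \<open>Comparing coefficients with those of \<open>G\<close> avoids a discussion of complex
  roots. The equation \<open>4 * b1 = a1^2\<close> is the vanishing of the discriminant.\<close>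

lemma monic_quadratics_product_square:
  assumes "[:b1, a1, 1:] * [:b2, a2, 1:] = (G::real poly)^2"
  shows "a1 = a2 \<and> b1 = b2 \<or> 4 * b1 = a1^2 \<and> 4 * b2 = a2^2"
proof -
  have nz: "G \<noteq> 0" using assms by auto
  have "degree (G^2) = 4" unfolding assms[symmetric] by (simp add: degree_mult_eq)
  then have d: "degree G = 2" using nz by (simp add: degree_power_eq)
  define x y z where "x = coeff G 0" "y = coeff G 1" "z = coeff G 2"
  have G: "G = [:x, y, z:]"
  proof (rule poly_eqI)
    fix n show "coeff G n = coeff [:x, y, z:] n"
      using d by (cases "n \<le> 2") (auto simp: x_y_z_def le_Suc_eq numeral_2_eq_2 coeff_eq_0 coeff_pCons split: nat.split)
  qed
  have "z*z = 1" and 1: "2*y*z = a1 + a2" and 2: "2*x*z + y*y = b1 + b2 + a1*a2"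
    and 3: "2*x*y = a1*b2 + a2*b1" and 4: "x*x = b1*b2"
    using assms unfolding G power2_eq_square by (auto simp: algebra_simps)
  then have "z = 1 \<or> z = -1" by (simp add: square_eq_1_iff)
  \<comment> \<open>Up to sign \<open>G\<close> is monic, with lower coefficients \<open>g\<close>
    and \<open>h\<close>.\<close>
  then obtain g h where g: "a1 + a2 = 2*g" "b1 + b2 + a1*a2 = 2*h + g*g" "a1*b2 + a2*b1 = 2*(g*h)" "b1*b2 = h*h"
  proof
    assume "z = 1"
    then show ?thesis using 1 2 3 4 by (intro that[of y x]) (auto simp: mult_ac)
  next
    assume "z = -1"
    then show ?thesis using 1 2 3 4 by (intro that[of "-y" "-x"]) (auto simp: mult_ac)
  qed
  \<comment> \<open>Half the difference of the linear coefficients. The coefficient equations reduce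
    to \<open>t * (b2 - b1 + g * t) = 0\<close>, whose two factors give the two
    alternatives.\<close>
  define t where "t = a1 - g"
  have a: "a1 = g + t" "a2 = g - t" using g(1) by (auto simp: t_def)
  have h: "2*h = b1 + b2 - t^2" using g(2) a by (simp add: algebra_simps power2_eq_square)
  have "t * (b2 - b1 + g*t) = (g+t)*b2 + (g-t)*b1 - g*(2*h)" unfolding h by (simp add: algebra_simps power2_eq_square)
  then have "t * (b2 - b1 + g*t) = 0" using g(3) a by simp
  then consider "t = 0" | "t \<noteq> 0" "b2 = b1 - g*t" by (cases "t = 0") (simp_all add: eq_diff_eq)
  then show ?thesis
  proof cases
    case 1
    then have "(b1 - b2)^2 = 0" using g(4) h by (simp add: algebra_simps power2_eq_square) algebra
    then show ?thesis using a 1 by simp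
  next
    case 2
    have "4 * (b1*b2) = (2*h)^2" using g(4) by (simp add: power2_eq_square)
    then have "t^2 * (4*b1 - (g+t)^2) = 0" unfolding h 2(2) by (simp add: algebra_simps power2_eq_square)
    then have "4*b1 = (g+t)^2" using 2 by simp
    moreover have "4*b2 = (g-t)^2" using calculation 2(2) by (simp add: algebra_simps power2_eq_square)
    ultimately show ?thesis using a by simp
  qed
qed

subsection \<open>Spheres with non-collinear centres\<close>

text \<open>The expansion of \<open>v\<close> in the basis reciprocal to \<open>w1\<close>,
  \<open>w2\<close>, \<open>w3\<close>, cleared of the determinant so that it also covers dependent
  vectors.\<close>

lemma cramer_vector:
  "(w1 \<bullet> v) *\<^sub>R (w2 \<times> w3) + (w2 \<bullet> v) *\<^sub>R (w3 \<times> w1) + (w3 \<bullet> v) *\<^sub>R (w1 \<times> w2)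
    = (w1 \<bullet> (w2 \<times> w3)) *\<^sub>R v"
  by (simp add: cross3_simps forall_3)

definition inner_poly :: "real^3 \<Rightarrow> real^3 \<Rightarrow> real^3 \<Rightarrow> real^3 \<Rightarrow> real poly"
  where "inner_poly a m b k = [:a \<bullet> b, a \<bullet> k + m \<bullet> b, m \<bullet> k:]"

lemma poly_inner_poly: "poly (inner_poly a m b k) s = (a + s *\<^sub>R m) \<bullet> (b + s *\<^sub>R k)"
  by (simp add: inner_poly_def inner_add_left inner_add_right algebra_simps)

text \<open>Degree 4 is the top degree of a power times the squared length of a linear normal; only
  this coefficient is ever inspected.\<close>

lemma coeff_quadratic_inner_poly: "coeff ([:p, q, r:] * inner_poly a m b k) 4 = r * (m \<bullet> k)"
  by (simp add: inner_poly_def numeral_eq_Suc)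

lemma coeff_linear_square: "coeff ([:p, q:]\<^sup>2) 4 = (0::real)"
  by (simp add: numeral_eq_Suc)

lemma coeff_linear_linear_inner_poly: "coeff ([:p, q:] * [:p', q':] * inner_poly a m b k) 4 = q * q' * (m \<bullet> k)"
  by (simp add: inner_poly_def numeral_eq_Suc)

lemmas quartic_coeffs = coeff_add coeff_diff coeff_smult coeff_0
  coeff_quadratic_inner_poly coeff_linear_linear_inner_poly coeff_linear_square

text \<open>Squares and mixed products of the scalars are kept apart: with roots as scalars, the
  squares become polynomials and the mixed products are the terms to be separated.\<close>

lemma norm_sum3_squared:
  fixes x y z :: "real^3"
  shows "(norm (a *\<^sub>R x + b *\<^sub>R y + c *\<^sub>R z))\<^sup>2 = a\<^sup>2 * (x \<bullet> x) + b\<^sup>2 * (y \<bullet> y) + c\<^sup>2 * (z \<bullet> z)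
    + 2 * (x \<bullet> y) * (a * b) + 2 * (x \<bullet> z) * (a * c) + 2 * (y \<bullet> z) * (b * c)"
  unfolding power2_norm_eq_inner
  by (simp add: inner_add_left inner_add_right inner_commute power2_eq_square algebra_simps)

lemma unit_eq_of_inner_1:
  fixes v e :: "'a::real_inner"
  assumes "norm v = 1" "norm e = 1" "v \<bullet> e = 1"
  shows "v = e"
proof -
  have "(v - e) \<bullet> (v - e) = v \<bullet> v - 2 * (v \<bullet> e) + e \<bullet> e"
    by (simp add: inner_diff_left inner_diff_right inner_commute)
  also have "\<dots> = 0" using assms by (simp add: norm_eq_1)
  finally show ?thesis by simp
qed

lemma cross_cross_left: "(a \<times> b) \<times> v = (a \<bullet> v) *\<^sub>R b - (b \<bullet> v) *\<^sub>R a"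
  using Lagrange[of v a b] cross_skew[of "a \<times> b" v] by (simp add: inner_commute)

lemma cross_eq_0_imp_multiple:
  fixes N v :: "real^3"
  assumes "N \<noteq> 0" "N \<times> v = 0"
  shows "v = ((N \<bullet> v) / (N \<bullet> N)) *\<^sub>R N"
proof -
  have "(N \<bullet> N) *\<^sub>R v = (N \<bullet> v) *\<^sub>R N" using Lagrange[of N N v] assms(2) by simp
  then have "inverse (N \<bullet> N) *\<^sub>R (N \<bullet> N) *\<^sub>R v = inverse (N \<bullet> N) *\<^sub>R (N \<bullet> v) *\<^sub>R N" by simp
  then show ?thesis using assms(1) by (simp add: divide_inverse_commute)
qed

lemma parallel_units:
  fixes N v e :: "real^3"
  assumes "N \<noteq> 0" "N \<times> v = 0" "N \<times> e = 0" "norm v = 1" "norm e = 1"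
  shows "v = e \<or> v = - e"
proof -
  obtain a b where v: "v = a *\<^sub>R N" and e: "e = b *\<^sub>R N"
    using cross_eq_0_imp_multiple assms(1-3) by blast
  have "\<bar>a\<bar> * norm N = \<bar>b\<bar> * norm N" using assms(4,5) v e by simp
  then have "a = b \<or> a = - b" using assms(1) by auto
  then show ?thesis using v e by auto
qed

text \<open>The sign relating two roots of the same number depends on \<open>s\<close>; on an
  infinite subset it is constant.\<close>

lemma infinite_sign:
  fixes f g :: "'a \<Rightarrow> real"
  assumes "infinite S" "\<And>s. s \<in> S \<Longrightarrow> (f s)\<^sup>2 = (g s)\<^sup>2"
  obtains \<epsilon> where "\<epsilon> = 1 \<or> \<epsilon> = -1" "infinite {s\<in>S. f s = \<epsilon> * g s}"
proof -
  have "S = {s\<in>S. f s = 1 * g s} \<union> {s\<in>S. f s = -1 * g s}"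
    using assms(2) by (auto simp: power2_eq_iff)
  then have "infinite {s\<in>S. f s = 1 * g s} \<or> infinite {s\<in>S. f s = -1 * g s}"
    using assms(1) by (metis finite_Un)
  then show ?thesis using that by blast
qed

lemma power_poly:
  fixes e g :: "real^3"
  assumes "norm e = 1"
  shows "poly [:g \<bullet> g - \<rho>\<^sup>2, - 2 * (e \<bullet> g), 1:] s = (norm (s *\<^sub>R e - g))\<^sup>2 - \<rho>\<^sup>2"
proof -
  have "(norm (s *\<^sub>R e - g))\<^sup>2 = s * s * (e \<bullet> e) - 2 * s * (e \<bullet> g) + g \<bullet> g"
    unfolding power2_norm_eq_inner by (simp add: inner_diff_left inner_diff_right inner_commute algebra_simps)
  then show ?thesis using assms by (simp add: norm_eq_1 algebra_simps)
qed

lemma monic_quadratics_product_square':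
  assumes "[:b1, - 2 * x1, 1:] * [:b2, - 2 * x2, 1:] = (G::real poly)\<^sup>2"
    and "[:b1, - 2 * x1, 1:] \<noteq> [:b2, - 2 * x2, 1:]"
  shows "[:b1, - 2 * x1, 1:] = [:- x1, 1:]\<^sup>2" "[:b2, - 2 * x2, 1:] = [:- x2, 1:]\<^sup>2"
  using monic_quadratics_product_square[OF assms(1)] assms(2) by (auto simp: power2_eq_square)

text \<open>Multiplication by the square of the indeterminate reduces this to the product of two
  monic quadratics; if these are equal, the given one is that square itself.\<close>

lemma monic_quadratic_square:
  assumes "[:b, - 2 * x, 1:] = (G::real poly)\<^sup>2"
  shows "[:b, - 2 * x, 1:] = [:- x, 1:]\<^sup>2"
proof -
  have "[:b, - 2 * x, 1:] * [:0, 0, 1:] = (G * [:0, 1:])\<^sup>2" unfolding assms power_mult_distrib by (simp add: power2_eq_square)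
  from monic_quadratics_product_square[OF this] show ?thesis by (auto simp: power2_eq_square)
qed

text \<open>
  Coordinates with \<open>l\<close> through the origin in direction \<open>e\<close>: for \<open>s \<in> S\<close> the line through
  \<open>s e\<close> with direction \<open>v s\<close> differs from \<open>l\<close> and is tangent to the spheres with centres \<open>g1\<close>,
  \<open>g2\<close>, \<open>g3\<close>. The polynomials \<open>q1\<close>, \<open>q2\<close>, \<open>q3\<close> below are the powers of the point \<open>s e\<close>.
\<close>

locale tangent_curve =
  fixes e g1 g2 g3 :: "real^3" and \<rho>1 \<rho>2 \<rho>3 :: real and S :: "real set" and v :: "real \<Rightarrow> real^3"
  assumes e: "norm e = 1" and inf: "infinite S"
    and unit: "\<And>s. s \<in> S \<Longrightarrow> norm (v s) = 1"
    and ne: "\<And>s. s \<in> S \<Longrightarrow> v s \<noteq> e \<and> v s \<noteq> - e"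
    and t1: "\<And>s. s \<in> S \<Longrightarrow> ((s *\<^sub>R e - g1) \<bullet> v s)\<^sup>2 = (norm (s *\<^sub>R e - g1))\<^sup>2 - \<rho>1\<^sup>2"
    and t2: "\<And>s. s \<in> S \<Longrightarrow> ((s *\<^sub>R e - g2) \<bullet> v s)\<^sup>2 = (norm (s *\<^sub>R e - g2))\<^sup>2 - \<rho>2\<^sup>2"
    and t3: "\<And>s. s \<in> S \<Longrightarrow> ((s *\<^sub>R e - g3) \<bullet> v s)\<^sup>2 = (norm (s *\<^sub>R e - g3))\<^sup>2 - \<rho>3\<^sup>2"
    and nc: "(g2 - g1) \<times> (g3 - g1) \<noteq> 0"
begin

text \<open>The vectors \<open>n1\<close> and \<open>m1\<close> are the constant and the linear
  coefficient of the normal (s e - g2) \<times> (s e - g3); the others arise cyclically.\<close>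

definition "m1 = e \<times> (g2 - g3)"
definition "m2 = e \<times> (g3 - g1)"
definition "m3 = e \<times> (g1 - g2)"
definition "n1 = g2 \<times> g3"
definition "n2 = g3 \<times> g1"
definition "n3 = g1 \<times> g2"
definition "q1 = [:g1 \<bullet> g1 - \<rho>1\<^sup>2, - 2 * (e \<bullet> g1), 1:]"
definition "q2 = [:g2 \<bullet> g2 - \<rho>2\<^sup>2, - 2 * (e \<bullet> g2), 1:]"
definition "q3 = [:g3 \<bullet> g3 - \<rho>3\<^sup>2, - 2 * (e \<bullet> g3), 1:]"
definition "f1 s = (s *\<^sub>R e - g1) \<bullet> v s"
definition "f2 s = (s *\<^sub>R e - g2) \<bullet> v s"
definition "f3 s = (s *\<^sub>R e - g3) \<bullet> v s"
text \<open>The determinant of the three vectors s e - g_i as a polynomial in s; its quadratic term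
  vanishes because \<open>m1\<close> is orthogonal to \<open>e\<close>.\<close>

definition "d = [:- (g1 \<bullet> n1), e \<bullet> n1 - g1 \<bullet> m1:]"

lemma ee: "e \<bullet> e = 1" using e by (simp add: norm_eq_1)

lemma f_sq:
  assumes "s \<in> S"
  shows "(f1 s)\<^sup>2 = poly q1 s" "(f2 s)\<^sup>2 = poly q2 s" "(f3 s)\<^sup>2 = poly q3 s"
  using t1[OF assms] t2[OF assms] t3[OF assms] power_poly[OF e]
  by (simp_all only: f1_def f2_def f3_def q1_def q2_def q3_def)

lemma m_sum: "m1 + m2 + m3 = 0"
  by (simp add: m1_def m2_def m3_def Cross3.right_diff_distrib)

lemma normal_expand:
  "(s *\<^sub>R e - g2) \<times> (s *\<^sub>R e - g3) = n1 + s *\<^sub>R m1"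
  "(s *\<^sub>R e - g3) \<times> (s *\<^sub>R e - g1) = n2 + s *\<^sub>R m2"
  "(s *\<^sub>R e - g1) \<times> (s *\<^sub>R e - g2) = n3 + s *\<^sub>R m3"
  by (simp_all add: m1_def m2_def m3_def n1_def n2_def n3_def cross3_simps forall_3)

text \<open>Squared lengths in \<open>cramer_vector\<close> eliminate the unit vector
  \<open>v s\<close>, leaving a relation between the roots alone.\<close>

lemma main_eq:
  assumes "s \<in> S"
  shows "(norm (f1 s *\<^sub>R (n1 + s *\<^sub>R m1) + f2 s *\<^sub>R (n2 + s *\<^sub>R m2) + f3 s *\<^sub>R (n3 + s *\<^sub>R m3)))\<^sup>2
    = (poly d s)\<^sup>2"
proof -
  have "(s *\<^sub>R e - g1) \<bullet> (n1 + s *\<^sub>R m1) = poly d s"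
    by (simp add: d_def m1_def inner_diff_left inner_diff_right inner_add_right dot_cross_self algebra_simps)
  then show ?thesis
    using cramer_vector[of "s *\<^sub>R e - g1" "v s" "s *\<^sub>R e - g2" "s *\<^sub>R e - g3"] unit[OF assms]
    unfolding normal_expand f1_def f2_def f3_def by (simp add: power_mult_distrib)
qed

text \<open>The two transpositions generate all permutations of the spheres, so each case below is
  treated for one ordering only.\<close>

lemma swap12: "tangent_curve e g2 g1 g3 \<rho>2 \<rho>1 \<rho>3 S v"
proof -
  have "(g1 - g2) \<times> (g3 - g2) = - ((g2 - g1) \<times> (g3 - g1))"
    by (simp add: cross3_simps forall_3)
  then show ?thesis using tangent_curve_axioms unfolding tangent_curve_def by simp
qed

lemma swap23: "tangent_curve e g1 g3 g2 \<rho>1 \<rho>3 \<rho>2 S v"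
proof -
  have "(g3 - g1) \<times> (g2 - g1) = - ((g2 - g1) \<times> (g3 - g1))"
    by (simp add: cross3_simps forall_3)
  then show ?thesis using tangent_curve_axioms unfolding tangent_curve_def by simp
qed

text \<open>Otherwise two edges of the triangle of centres would be parallel to \<open>e\<close>,
  making the triangle degenerate.\<close>

lemma m_not_all_0: "m2 = 0 \<Longrightarrow> m3 = 0 \<Longrightarrow> False"
proof -
  assume "m2 = 0" "m3 = 0"
  then have "(e \<bullet> e) *\<^sub>R (g3 - g1) = (e \<bullet> (g3 - g1)) *\<^sub>R e" "(e \<bullet> e) *\<^sub>R (g1 - g2) = (e \<bullet> (g1 - g2)) *\<^sub>R e"
    using Lagrange[of e e "g3 - g1"] Lagrange[of e e "g1 - g2"] by (simp_all add: m2_def m3_def)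
  then have *: "g3 - g1 = (e \<bullet> (g3 - g1)) *\<^sub>R e" "g1 - g2 = (e \<bullet> (g1 - g2)) *\<^sub>R e" unfolding ee by simp_all
  have "(g1 - g2) \<times> (g3 - g1) = 0"
    by (subst *(1), subst *(2)) (simp add: cross_mult_left cross_mult_right)
  moreover have "(g2 - g1) \<times> (g3 - g1) = - ((g1 - g2) \<times> (g3 - g1))"
    by (simp add: cross3_simps forall_3)
  ultimately show False using nc by simp
qed

lemma edge_along_e: "m3 = 0 \<Longrightarrow> g2 - g1 = (e \<bullet> (g2 - g1)) *\<^sub>R e"
  using Lagrange[of e e "g1 - g2"] unfolding m3_def ee
  by (simp add: inner_diff_right algebra_simps)

lemma g1_ne_g2: "g1 \<noteq> g2" using nc by auto

lemma no_short_edge: "m3 = 0 \<Longrightarrow> e \<bullet> g1 = e \<bullet> g2 \<Longrightarrow> False"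
  using edge_along_e g1_ne_g2 by (simp add: inner_diff_right)

text \<open>The difference \<open>f1 s - f2 s\<close> is the scalar product of \<open>v s\<close>
  with the edge \<open>g2 - g1\<close>. For an edge along \<open>e\<close> and equal signs this
  forces \<open>e \<bullet> v s = \<epsilon>\<close>, so the tangent would be \<open>l\<close>
  itself.\<close>

lemma no_common_sign:
  assumes "m3 = 0" "s \<in> S" "f1 s = \<epsilon> * (s - e \<bullet> g1)" "f2 s = \<epsilon> * (s - e \<bullet> g2)" "\<epsilon> = 1 \<or> \<epsilon> = -1"
  shows False
proof -
  have k: "g2 - g1 = (e \<bullet> g2 - e \<bullet> g1) *\<^sub>R e" using edge_along_e[OF assms(1)] by (simp add: inner_diff_right)
  then have k0: "e \<bullet> g2 - e \<bullet> g1 \<noteq> 0" using g1_ne_g2 by auto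
  have "(e \<bullet> g2 - e \<bullet> g1) * (e \<bullet> v s) = (g2 - g1) \<bullet> v s" by (subst k) simp
  also have "(g2 - g1) \<bullet> v s = f1 s - f2 s" by (simp add: f1_def f2_def inner_diff_left)
  also have "\<dots> = (e \<bullet> g2 - e \<bullet> g1) * \<epsilon>" using assms(3,4) by (simp add: algebra_simps)
  finally have "(e \<bullet> g2 - e \<bullet> g1) * (e \<bullet> v s) = (e \<bullet> g2 - e \<bullet> g1) * \<epsilon>" .
  then have ev: "e \<bullet> v s = \<epsilon>" using k0 by simp
  then have "v s \<bullet> (\<epsilon> *\<^sub>R e) = 1" using assms(5) by (auto simp: inner_commute)
  moreover have "norm (\<epsilon> *\<^sub>R e) = 1" using e assms(5) by auto
  ultimately have "v s = \<epsilon> *\<^sub>R e" using unit_eq_of_inner_1 unit[OF assms(2)] by blast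
  then show False using ne[OF assms(2)] assms(5) by auto
qed

text \<open>
  In each case below, the part of \<open>main_eq\<close> that is free of square roots is a polynomial of degree 4
  whose leading coefficient is a sum of squares, since \<open>d\<close> is linear.
\<close>

lemma no_squares:
  assumes "\<nexists>G. q1 * q2 = G\<^sup>2" "\<nexists>G. q1 * q3 = G\<^sup>2" "\<nexists>G. q2 * q3 = G\<^sup>2"
  shows False
proof -
  let ?A = "q1 * inner_poly n1 m1 n1 m1 + q2 * inner_poly n2 m2 n2 m2 + q3 * inner_poly n3 m3 n3 m3 - d\<^sup>2"
  have "?A = 0"
  proof (rule three_roots_independent[OF assms inf f_sq])
    fix s assume s: "s \<in> S"
    show "poly ?A s + poly (2 * inner_poly n1 m1 n2 m2) s * (f1 s * f2 s)
      + poly (2 * inner_poly n1 m1 n3 m3) s * (f1 s * f3 s)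
      + poly (2 * inner_poly n2 m2 n3 m3) s * (f2 s * f3 s) = 0"
      using main_eq[OF s] unfolding norm_sum3_squared f_sq[OF s] by (simp add: poly_inner_poly)
  qed
  then have "coeff ?A 4 = 0" by simp
  then have "m1 \<bullet> m1 + m2 \<bullet> m2 + m3 \<bullet> m3 = 0" unfolding q1_def q2_def q3_def d_def
    by (simp only: quartic_coeffs)
  then have "m2 \<bullet> m2 = 0" "m3 \<bullet> m3 = 0"
    using inner_ge_zero[of m1] inner_ge_zero[of m2] inner_ge_zero[of m3] by linarith+
  then show False using m_not_all_0 by simp
qed

text \<open>Since \<open>f2 = \<epsilon> * f1\<close> on an infinite set, the first two normals
  merge and \<open>f1 * f3\<close> is the only root left. Its independence gives
  \<open>m3 = 0\<close>, an edge along \<open>e\<close>, while equal powers make that edge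
  orthogonal to \<open>e\<close>.\<close>

lemma two_equal:
  assumes "q1 = q2" "\<nexists>G. q1 * q3 = G\<^sup>2"
  shows False
proof -
  obtain \<epsilon> where inf': "infinite {s\<in>S. f2 s = \<epsilon> * f1 s}" and \<epsilon>: "\<epsilon> = 1 \<or> \<epsilon> = -1"
    using infinite_sign[OF inf, of f2 f1] f_sq assms(1) by metis
  let ?n = "n1 + \<epsilon> *\<^sub>R n2" and ?m = "m1 + \<epsilon> *\<^sub>R m2"
  let ?A = "q1 * inner_poly ?n ?m ?n ?m + q3 * inner_poly n3 m3 n3 m3 - d\<^sup>2"
  have "?A = 0 \<and> 2 * inner_poly ?n ?m n3 m3 = 0"
  proof (rule root_independent[OF assms(2) inf'])
    fix s assume "s \<in> {s\<in>S. f2 s = \<epsilon> * f1 s}"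
    then have s: "s \<in> S" and f: "f2 s = \<epsilon> * f1 s" by auto
    show "(f1 s * f3 s)\<^sup>2 = poly (q1 * q3) s" using f_sq[OF s] by (simp add: power_mult_distrib)
    \<comment> \<open>The zero middle summand makes \<open>norm_sum3_squared\<close> applicable to
      two terms.\<close>
    have "f1 s *\<^sub>R (n1 + s *\<^sub>R m1) + f2 s *\<^sub>R (n2 + s *\<^sub>R m2) + f3 s *\<^sub>R (n3 + s *\<^sub>R m3)
      = f1 s *\<^sub>R (?n + s *\<^sub>R ?m) + 0 *\<^sub>R 0 + f3 s *\<^sub>R (n3 + s *\<^sub>R m3)"
      unfolding f by (simp add: algebra_simps)
    then show "poly ?A s + poly (2 * inner_poly ?n ?m n3 m3) s * (f1 s * f3 s) = 0"
      using main_eq[OF s] by (simp only: norm_sum3_squared f_sq[OF s]) (simp add: poly_inner_poly)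
  qed
  then have "coeff ?A 4 = 0" by simp
  then have "?m \<bullet> ?m + m3 \<bullet> m3 = 0" unfolding q1_def q3_def d_def
    by (simp only: quartic_coeffs)
  then have "m3 = 0" using inner_ge_zero[of ?m] inner_ge_zero[of m3] inner_eq_zero_iff[of m3] by linarith
  then show False using no_short_edge assms(1) by (simp add: q1_def q2_def)
qed

text \<open>A power that is the square of a linear polynomial means that \<open>l\<close> touches
  the sphere; the root is then linear up to sign.\<close>

lemma f_linear:
  assumes "s \<in> S"
  shows "q1 = [:- (e \<bullet> g1), 1:]\<^sup>2 \<Longrightarrow> (f1 s)\<^sup>2 = (s - e \<bullet> g1)\<^sup>2"
    "q2 = [:- (e \<bullet> g2), 1:]\<^sup>2 \<Longrightarrow> (f2 s)\<^sup>2 = (s - e \<bullet> g2)\<^sup>2"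
    "q3 = [:- (e \<bullet> g3), 1:]\<^sup>2 \<Longrightarrow> (f3 s)\<^sup>2 = (s - e \<bullet> g3)\<^sup>2"
  using f_sq[OF assms] by (simp_all only: poly_power) simp_all

text \<open>Only \<open>f3\<close> is a genuine root. The leading coefficient is the sum of the
  squared lengths of \<open>\<epsilon>1 *\<^sub>R m1 + \<epsilon>2 *\<^sub>R m2\<close> and
  \<open>m3\<close>, so \<open>m3 = 0\<close> and \<open>m1 = - m2\<close>; opposite signs would
  then make all three vanish, and equal signs contradict \<open>no_common_sign\<close>.\<close>

lemma two_squares:
  assumes q: "q1 = [:- (e \<bullet> g1), 1:]\<^sup>2" "q2 = [:- (e \<bullet> g2), 1:]\<^sup>2" and ns: "\<nexists>G. q3 = G\<^sup>2"
  shows False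
proof -
  obtain \<epsilon>1 where inf1: "infinite {s\<in>S. f1 s = \<epsilon>1 * (s - e \<bullet> g1)}" and \<epsilon>1: "\<epsilon>1 = 1 \<or> \<epsilon>1 = -1"
    using infinite_sign[OF inf f_linear(1)[OF _ q(1)], of "\<lambda>s. s"] by blast
  let ?S1 = "{s\<in>S. f1 s = \<epsilon>1 * (s - e \<bullet> g1)}"
  obtain \<epsilon>2 where inf2: "infinite {s\<in>?S1. f2 s = \<epsilon>2 * (s - e \<bullet> g2)}" and \<epsilon>2: "\<epsilon>2 = 1 \<or> \<epsilon>2 = -1"
    using infinite_sign[OF inf1, of f2 "\<lambda>s. s - e \<bullet> g2"] f_linear(2)[OF _ q(2)] by blast
  define a1 where "a1 = [:- (\<epsilon>1 * (e \<bullet> g1)), \<epsilon>1:]"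
  define a2 where "a2 = [:- (\<epsilon>2 * (e \<bullet> g2)), \<epsilon>2:]"
  let ?A = "a1 * a1 * inner_poly n1 m1 n1 m1 + a2 * a2 * inner_poly n2 m2 n2 m2 + q3 * inner_poly n3 m3 n3 m3
    + smult 2 (a1 * a2 * inner_poly n1 m1 n2 m2) - d\<^sup>2"
  let ?B = "smult 2 (a1 * inner_poly n1 m1 n3 m3 + a2 * inner_poly n2 m2 n3 m3)"
  have "?A = 0 \<and> ?B = 0"
  proof (rule root_independent[OF ns inf2])
    fix s assume "s \<in> {s\<in>?S1. f2 s = \<epsilon>2 * (s - e \<bullet> g2)}"
    then have s: "s \<in> S" and f: "f1 s = poly a1 s" "f2 s = poly a2 s" by (auto simp: a1_def a2_def algebra_simps)
    show "(f3 s)\<^sup>2 = poly q3 s" using f_sq[OF s] by simp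
    show "poly ?A s + poly ?B s * f3 s = 0"
      using main_eq[OF s] unfolding norm_sum3_squared f_sq(3)[OF s] f
      by (simp add: poly_inner_poly power2_eq_square algebra_simps del: inner_add_left inner_add_right)
  qed
  then have "coeff ?A 4 = 0" by simp
  then have "\<epsilon>1 * \<epsilon>1 * (m1 \<bullet> m1) + \<epsilon>2 * \<epsilon>2 * (m2 \<bullet> m2) + m3 \<bullet> m3 + 2 * (\<epsilon>1 * \<epsilon>2 * (m1 \<bullet> m2)) = 0"
    unfolding q3_def d_def a1_def a2_def by (simp only: quartic_coeffs; simp)
  then have "(\<epsilon>1 *\<^sub>R m1 + \<epsilon>2 *\<^sub>R m2) \<bullet> (\<epsilon>1 *\<^sub>R m1 + \<epsilon>2 *\<^sub>R m2) + m3 \<bullet> m3 = 0"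
    by (simp add: inner_add_left inner_add_right inner_commute algebra_simps)
  then have m3: "m3 = 0" and m12: "\<epsilon>1 *\<^sub>R m1 + \<epsilon>2 *\<^sub>R m2 = 0"
    using inner_ge_zero[of "\<epsilon>1 *\<^sub>R m1 + \<epsilon>2 *\<^sub>R m2"] inner_ge_zero[of m3]
      inner_eq_zero_iff[of m3] inner_eq_zero_iff[of "\<epsilon>1 *\<^sub>R m1 + \<epsilon>2 *\<^sub>R m2"] by linarith+
  have "\<epsilon>1 = \<epsilon>2"
  proof (rule ccontr)
    assume "\<epsilon>1 \<noteq> \<epsilon>2"
    then have "m1 = m2" using m12 \<epsilon>1 \<epsilon>2 by auto
    then have "2 *\<^sub>R m2 = 0" using m_sum m3 by (simp add: scaleR_2)
    then show False using m3 m_not_all_0 by simp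
  qed
  moreover obtain s where "s \<in> {s\<in>?S1. f2 s = \<epsilon>2 * (s - e \<bullet> g2)}" using inf2 infinite_imp_nonempty by blast
  ultimately show False using no_common_sign[OF m3, of s \<epsilon>1] \<epsilon>1 by auto
qed

text \<open>All roots agree up to sign, and the leading coefficient yields a signed relation between
  \<open>m1\<close>, \<open>m2\<close>, \<open>m3\<close>. Unless all signs agree, it combines with
  \<open>m_sum\<close> to give an edge along \<open>e\<close>, impossible for equal
  projections.\<close>

lemma all_equal:
  assumes q: "q1 = q2" "q1 = q3"
  shows False
proof -
  have e12: "e \<bullet> g1 = e \<bullet> g2" and e13: "e \<bullet> g1 = e \<bullet> g3" using q by (simp_all add: q1_def q2_def q3_def)
  obtain \<epsilon>2 where inf1: "infinite {s\<in>S. f2 s = \<epsilon>2 * f1 s}" and \<epsilon>2: "\<epsilon>2 = 1 \<or> \<epsilon>2 = -1"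
    using infinite_sign[OF inf, of f2 f1] f_sq q by metis
  let ?S1 = "{s\<in>S. f2 s = \<epsilon>2 * f1 s}"
  obtain \<epsilon>3 where inf2: "infinite {s\<in>?S1. f3 s = \<epsilon>3 * f1 s}" and \<epsilon>3: "\<epsilon>3 = 1 \<or> \<epsilon>3 = -1"
  proof (rule infinite_sign[OF inf1, of f3 f1])
    show "(f3 s)\<^sup>2 = (f1 s)\<^sup>2" if "s \<in> ?S1" for s using that f_sq[of s] q by simp
  qed
  let ?S2 = "{s\<in>?S1. f3 s = \<epsilon>3 * f1 s}"
  let ?n = "n1 + \<epsilon>2 *\<^sub>R n2 + \<epsilon>3 *\<^sub>R n3" and ?m = "m1 + \<epsilon>2 *\<^sub>R m2 + \<epsilon>3 *\<^sub>R m3"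
  let ?A = "q1 * inner_poly ?n ?m ?n ?m - d\<^sup>2"
  have "?A = 0"
  proof (rule poly_eq_0_of_infinite[OF inf2])
    fix s assume "s \<in> ?S2"
    then have s: "s \<in> S" and f: "f2 s = \<epsilon>2 * f1 s" "f3 s = \<epsilon>3 * f1 s" by auto
    have "f1 s *\<^sub>R (n1 + s *\<^sub>R m1) + f2 s *\<^sub>R (n2 + s *\<^sub>R m2) + f3 s *\<^sub>R (n3 + s *\<^sub>R m3)
      = f1 s *\<^sub>R (?n + s *\<^sub>R ?m) + 0 *\<^sub>R 0 + 0 *\<^sub>R 0"
      unfolding f by (simp add: algebra_simps)
    then show "poly ?A s = 0"
      using main_eq[OF s] by (simp only: norm_sum3_squared f_sq[OF s]) (simp add: poly_inner_poly)
  qed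
  then have "coeff ?A 4 = 0" by simp
  then have "?m \<bullet> ?m = 0" unfolding q1_def d_def by (simp only: quartic_coeffs)
  then have m: "?m = 0" by (simp only: inner_eq_zero_iff)
  obtain s where "s \<in> ?S2" using inf2 infinite_imp_nonempty by blast
  then have s: "s \<in> S" and f: "f2 s = \<epsilon>2 * f1 s" "f3 s = \<epsilon>3 * f1 s" by auto
  \<comment> \<open>For equal signs the relation is merely \<open>m_sum\<close>. But then
    \<open>v s\<close> and \<open>e\<close> are both orthogonal to the plane of the centres, hence
    parallel.\<close>
  have all_signs_equal: False if "\<epsilon>2 = 1" "\<epsilon>3 = 1"
  proof -
    have "(g2 - g1) \<bullet> v s = 0" "(g3 - g1) \<bullet> v s = 0"
      using f that by (simp_all add: f1_def f2_def f3_def inner_diff_left)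
    then have v: "((g2 - g1) \<times> (g3 - g1)) \<times> v s = 0"
      by (simp add: cross_cross_left)
    have "(g2 - g1) \<bullet> e = 0" "(g3 - g1) \<bullet> e = 0" using e12 e13 by (simp_all add: inner_diff_left inner_diff_right inner_commute)
    then have w: "((g2 - g1) \<times> (g3 - g1)) \<times> e = 0"
      by (simp add: cross_cross_left)
    show False using parallel_units[OF nc v w unit[OF s] e] ne[OF s] by blast
  qed
  interpret p23: tangent_curve e g1 g3 g2 \<rho>1 \<rho>3 \<rho>2 S v by (rule swap23)
  interpret p13: tangent_curve e g3 g1 g2 \<rho>3 \<rho>1 \<rho>2 S v
    by (rule tangent_curve.swap12[OF swap23])
  interpret p231: tangent_curve e g2 g3 g1 \<rho>2 \<rho>3 \<rho>1 S v
    by (rule tangent_curve.swap23[OF swap12])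
  \<comment> \<open>Adding or subtracting \<open>m_sum\<close> isolates the vector with the
    exceptional sign.\<close>
  have "2 *\<^sub>R m1 = 0 \<or> 2 *\<^sub>R m2 = 0 \<or> 2 *\<^sub>R m3 = 0"
  proof -
    have "2 *\<^sub>R m1 = (m1 + m2 + m3) + (m1 - m2 - m3)" "2 *\<^sub>R m2 = (m1 + m2 + m3) - (m1 - m2 + m3)"
      "2 *\<^sub>R m3 = (m1 + m2 + m3) - (m1 + m2 - m3)" by (simp_all add: scaleR_2)
    moreover have "m1 - m2 - m3 = 0 \<or> m1 - m2 + m3 = 0 \<or> m1 + m2 - m3 = 0"
      using m \<epsilon>2 \<epsilon>3 all_signs_equal by auto
    ultimately show ?thesis unfolding m_sum by (elim disjE) (simp_all only: add_0_left diff_zero simp_thms)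
  qed
  then consider "m1 = 0" | "m2 = 0" | "m3 = 0" by auto
  then show False
  proof cases
    case 1 then show ?thesis using p231.no_short_edge e12 e13 by (simp add: p231.m3_def m1_def)
  next
    case 2 then show ?thesis using p13.no_short_edge e12 e13 by (simp add: p13.m3_def m2_def)
  next
    case 3 then show ?thesis using no_short_edge e12 by simp
  qed
qed

text \<open>Here \<open>l\<close> touches all three spheres. If one sign differs, the other two
  spheres have an edge along \<open>e\<close> and equal signs. If all signs agree, leading
  coefficients say nothing and the difference of the two tangent directions is examined
  instead.\<close>

lemma all_squares:
  assumes q: "q1 = [:- (e \<bullet> g1), 1:]\<^sup>2" "q2 = [:- (e \<bullet> g2), 1:]\<^sup>2" "q3 = [:- (e \<bullet> g3), 1:]\<^sup>2"
  shows False
proof -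
  obtain \<epsilon>1 where inf1: "infinite {s\<in>S. f1 s = \<epsilon>1 * (s - e \<bullet> g1)}" and \<epsilon>1: "\<epsilon>1 = 1 \<or> \<epsilon>1 = -1"
    using infinite_sign[OF inf f_linear(1)[OF _ q(1)], of "\<lambda>s. s"] by blast
  let ?S1 = "{s\<in>S. f1 s = \<epsilon>1 * (s - e \<bullet> g1)}"
  obtain \<epsilon>2 where inf2: "infinite {s\<in>?S1. f2 s = \<epsilon>2 * (s - e \<bullet> g2)}" and \<epsilon>2: "\<epsilon>2 = 1 \<or> \<epsilon>2 = -1"
    using infinite_sign[OF inf1, of f2 "\<lambda>s. s - e \<bullet> g2"] f_linear(2)[OF _ q(2)] by blast
  let ?S2 = "{s\<in>?S1. f2 s = \<epsilon>2 * (s - e \<bullet> g2)}"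
  obtain \<epsilon>3 where inf3: "infinite {s\<in>?S2. f3 s = \<epsilon>3 * (s - e \<bullet> g3)}" and \<epsilon>3: "\<epsilon>3 = 1 \<or> \<epsilon>3 = -1"
    using infinite_sign[OF inf2, of f3 "\<lambda>s. s - e \<bullet> g3"] f_linear(3)[OF _ q(3)] by blast
  let ?S3 = "{s\<in>?S2. f3 s = \<epsilon>3 * (s - e \<bullet> g3)}"
  have S3: "s \<in> S" "f1 s = \<epsilon>1 * (s - e \<bullet> g1)" "f2 s = \<epsilon>2 * (s - e \<bullet> g2)" "f3 s = \<epsilon>3 * (s - e \<bullet> g3)"
    if "s \<in> ?S3" for s using that by auto
  define a1 where "a1 = [:- (\<epsilon>1 * (e \<bullet> g1)), \<epsilon>1:]"
  define a2 where "a2 = [:- (\<epsilon>2 * (e \<bullet> g2)), \<epsilon>2:]"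
  define a3 where "a3 = [:- (\<epsilon>3 * (e \<bullet> g3)), \<epsilon>3:]"
  let ?A = "a1 * a1 * inner_poly n1 m1 n1 m1 + a2 * a2 * inner_poly n2 m2 n2 m2 + a3 * a3 * inner_poly n3 m3 n3 m3
    + smult 2 (a1 * a2 * inner_poly n1 m1 n2 m2) + smult 2 (a1 * a3 * inner_poly n1 m1 n3 m3)
    + smult 2 (a2 * a3 * inner_poly n2 m2 n3 m3) - d\<^sup>2"
  have "?A = 0"
  proof (rule poly_eq_0_of_infinite[OF inf3])
    fix s assume "s \<in> ?S3"
    then have s: "s \<in> S" and f: "f1 s = poly a1 s" "f2 s = poly a2 s" "f3 s = poly a3 s"
      by (auto simp: a1_def a2_def a3_def algebra_simps)
    show "poly ?A s = 0"
      using main_eq[OF s] unfolding norm_sum3_squared f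
      by (simp add: poly_inner_poly power2_eq_square algebra_simps del: inner_add_left inner_add_right)
  qed
  then have "coeff ?A 4 = 0" by simp
  then have "\<epsilon>1 * \<epsilon>1 * (m1 \<bullet> m1) + \<epsilon>2 * \<epsilon>2 * (m2 \<bullet> m2) + \<epsilon>3 * \<epsilon>3 * (m3 \<bullet> m3)
      + 2 * (\<epsilon>1 * \<epsilon>2 * (m1 \<bullet> m2)) + 2 * (\<epsilon>1 * \<epsilon>3 * (m1 \<bullet> m3)) + 2 * (\<epsilon>2 * \<epsilon>3 * (m2 \<bullet> m3)) = 0"
    unfolding d_def a1_def a2_def a3_def by (simp only: quartic_coeffs; simp)
  then have "(norm (\<epsilon>1 *\<^sub>R m1 + \<epsilon>2 *\<^sub>R m2 + \<epsilon>3 *\<^sub>R m3))\<^sup>2 = 0"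
    unfolding norm_sum3_squared by (simp add: power2_eq_square algebra_simps)
  then have m: "\<epsilon>1 *\<^sub>R m1 + \<epsilon>2 *\<^sub>R m2 + \<epsilon>3 *\<^sub>R m3 = 0" by simp
  interpret p23: tangent_curve e g1 g3 g2 \<rho>1 \<rho>3 \<rho>2 S v by (rule swap23)
  interpret p13: tangent_curve e g3 g1 g2 \<rho>3 \<rho>1 \<rho>2 S v
    by (rule tangent_curve.swap12[OF swap23])
  interpret p231: tangent_curve e g2 g3 g1 \<rho>2 \<rho>3 \<rho>1 S v
    by (rule tangent_curve.swap23[OF swap12])
  have m1: "m1 = - m2 - m3" using m_sum by (simp add: algebra_simps eq_neg_iff_add_eq_0)
  obtain s where s: "s \<in> ?S3" using inf3 infinite_imp_nonempty by blast
  have "\<epsilon>2 = \<epsilon>1 \<and> \<epsilon>3 = \<epsilon>1"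
  proof (rule ccontr)
    assume "\<not> ?thesis"
    then consider "\<epsilon>2 = \<epsilon>1" "\<epsilon>3 = - \<epsilon>1" | "\<epsilon>3 = \<epsilon>1" "\<epsilon>2 = - \<epsilon>1" | "\<epsilon>2 = \<epsilon>3" "\<epsilon>1 = - \<epsilon>3"
      using \<epsilon>1 \<epsilon>2 \<epsilon>3 by force
    then show False
    proof cases
      case 1
      then have "2 *\<^sub>R m3 = 0" using m m1 \<epsilon>1 by (auto simp: scaleR_2 algebra_simps)
      then show ?thesis using no_common_sign[of s \<epsilon>1] S3[OF s] \<epsilon>1 1 by auto
    next
      case 2
      then have "2 *\<^sub>R m2 = 0" using m m1 \<epsilon>1 by (auto simp: scaleR_2 algebra_simps)
      then show ?thesis using p13.no_common_sign[of s \<epsilon>1] S3[OF s] \<epsilon>1 2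
        by (auto simp: p13.m3_def m2_def p13.f1_def p13.f2_def f1_def f3_def)
    next
      case 3
      have "\<epsilon>3 *\<^sub>R (- m1 + m2 + m3) = 0" using m 3 by (simp add: algebra_simps)
      then have "- m1 + m2 + m3 = 0" using \<epsilon>3 by (metis scaleR_eq_0_iff zero_neq_one zero_neq_neg_one)
      then have "2 *\<^sub>R m1 = 0" using m_sum by (simp add: scaleR_2 algebra_simps eq_neg_iff_add_eq_0)
      then show ?thesis using p231.no_common_sign[of s \<epsilon>3] S3[OF s] \<epsilon>3 3
        by (auto simp: p231.m3_def m1_def p231.f1_def p231.f2_def f2_def f3_def)
    qed
  qed
  then have \<epsilon>23: "\<epsilon>2 = \<epsilon>1" "\<epsilon>3 = \<epsilon>1" by auto
  define N where "N = (g2 - g1) \<times> (g3 - g1)"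
  have NN: "N \<bullet> N \<noteq> 0" using nc by (simp add: N_def)
  \<comment> \<open>Equal signs mean that \<open>v s\<close> and
    \<open>\<epsilon>1 *\<^sub>R e\<close> have the same scalar products with all three vectors to
    the centres, so their difference is orthogonal to these and normal to the plane of the
    centres.\<close>
  define x where "x s = v s - \<epsilon>1 *\<^sub>R e" for s
  have x: "N \<bullet> x s \<noteq> 0 \<and> x s = ((N \<bullet> x s) / (N \<bullet> N)) *\<^sub>R N \<and> N \<bullet> (s *\<^sub>R e - g1) = 0" if "s \<in> ?S3" for s
  proof -
    note S = S3[OF that, unfolded \<epsilon>23]
    have x0: "(s *\<^sub>R e - g1) \<bullet> x s = 0" "(s *\<^sub>R e - g2) \<bullet> x s = 0" "(s *\<^sub>R e - g3) \<bullet> x s = 0"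
      using S(2-4) ee by (simp_all add: f1_def f2_def f3_def x_def inner_diff_left inner_diff_right inner_commute algebra_simps)
    then have "(g2 - g1) \<bullet> x s = 0" "(g3 - g1) \<bullet> x s = 0" by (simp_all add: inner_diff_left)
    then have "N \<times> x s = 0"
      by (simp add: N_def cross_cross_left)
    then have *: "x s = ((N \<bullet> x s) / (N \<bullet> N)) *\<^sub>R N" using NN by (intro cross_eq_0_imp_multiple) auto
    have xs: "x s \<noteq> 0" using ne[OF S(1)] \<epsilon>1 by (auto simp: x_def)
    then have "N \<bullet> x s \<noteq> 0" using * by auto
    moreover have "(N \<bullet> x s) / (N \<bullet> N) * (N \<bullet> (s *\<^sub>R e - g1)) = 0"
      using x0(1) by (subst (asm) *) (simp add: inner_commute)
    ultimately show ?thesis using * NN by auto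
  qed
  \<comment> \<open>Infinitely many points of \<open>l\<close> lie in the plane of the centres, so
    all of \<open>l\<close> does.\<close>
  have "N \<bullet> e = 0"
  proof (rule ccontr)
    assume Ne: "N \<bullet> e \<noteq> 0"
    have "?S3 \<subseteq> {(N \<bullet> g1) / (N \<bullet> e)}"
    proof
      fix s assume "s \<in> ?S3"
      then have "N \<bullet> (s *\<^sub>R e - g1) = 0" using x by blast
      then show "s \<in> {(N \<bullet> g1) / (N \<bullet> e)}" using Ne by (simp add: inner_diff_right field_simps)
    qed
    then show False using inf3 finite_subset by blast
  qed
  then have "e \<bullet> x s = 0" using x[OF s] by (metis inner_commute inner_scaleR_right mult_zero_right)
  then have "v s \<bullet> (\<epsilon>1 *\<^sub>R e) = 1" using ee \<epsilon>1 by (auto simp: x_def inner_diff_right inner_commute)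
  moreover have "norm (\<epsilon>1 *\<^sub>R e) = 1" using e \<epsilon>1 by auto
  ultimately have "v s = \<epsilon>1 *\<^sub>R e" using unit_eq_of_inner_1 unit[OF S3(1)[OF s]] by blast
  then show False using ne[OF S3(1)[OF s]] \<epsilon>1 by auto
qed

text \<open>Equal or both square: in either alternative, asking the same of the third power leads to
  one of the four cases above.\<close>

lemma contradiction_of_product_square:
  assumes "q1 * q2 = G\<^sup>2"
  shows False
proof -
  have lin: "q1 = [:- (e \<bullet> g1), 1:]\<^sup>2 \<and> q2 = [:- (e \<bullet> g2), 1:]\<^sup>2" if "q1 \<noteq> q2"
    using monic_quadratics_product_square'[OF assms[unfolded q1_def q2_def]] that
    unfolding q1_def q2_def by blast
  show False
  proof (cases "q1 = q2")
    case True
    show False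
    proof (cases "\<exists>H. q1 * q3 = H\<^sup>2")
      case False then show False using two_equal True by blast
    next
      case H: True
      show False
      proof (cases "q1 = q3")
        case True then show False using all_equal \<open>q1 = q2\<close> by blast
      next
        case False
        then have "q1 = [:- (e \<bullet> g1), 1:]\<^sup>2" "q3 = [:- (e \<bullet> g3), 1:]\<^sup>2"
          using H monic_quadratics_product_square' unfolding q1_def q3_def by blast+
        moreover have "e \<bullet> g1 = e \<bullet> g2" using True by (simp add: q1_def q2_def)
        ultimately show False using all_squares True by simp
      qed
    qed
  next
    case False
    then show False using lin two_squares all_squares monic_quadratic_square
      by (metis q3_def)
  qed
qed

end

lemma no_tangent_curve: "\<not> tangent_curve e g1 g2 g3 \<rho>1 \<rho>2 \<rho>3 S v"
proof
  assume a: "tangent_curve e g1 g2 g3 \<rho>1 \<rho>2 \<rho>3 S v"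
  interpret tangent_curve e g1 g2 g3 \<rho>1 \<rho>2 \<rho>3 S v by (rule a)
  interpret p23: tangent_curve e g1 g3 g2 \<rho>1 \<rho>3 \<rho>2 S v by (rule swap23)
  interpret p231: tangent_curve e g2 g3 g1 \<rho>2 \<rho>3 \<rho>1 S v
    by (rule tangent_curve.swap23[OF swap12])
  show False
    using no_squares contradiction_of_product_square p23.contradiction_of_product_square
      p231.contradiction_of_product_square
    by (metis q1_def q2_def q3_def p23.q1_def p23.q2_def p231.q1_def p231.q2_def)
qed

subsection \<open>Lines and tangency\<close>

definition dline :: "real^3 \<Rightarrow> real^3 \<Rightarrow> points"
  where "dline p v = range (\<lambda>t. p + t *\<^sub>R v)"

lemma mem_dline: "y \<in> dline p v \<longleftrightarrow> (\<exists>t. y = p + t *\<^sub>R v)"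
  by (auto simp: dline_def)

lemma dline_base [simp]: "p \<in> dline p v"
  by (auto simp: mem_dline intro: exI[of _ 0])

lemma dline_point [simp]: "p + t *\<^sub>R v \<in> dline p v"
  by (auto simp: mem_dline)

lemma dline_rebase: "q \<in> dline p v \<Longrightarrow> dline p v = dline q v"
proof -
  assume "q \<in> dline p v"
  then obtain t where t: "q = p + t *\<^sub>R v" by (auto simp: mem_dline)
  show ?thesis
  proof (intro set_eqI iffI)
    fix y assume "y \<in> dline p v"
    then obtain s where "y = p + s *\<^sub>R v" by (auto simp: mem_dline)
    then have "y = q + (s - t) *\<^sub>R v" by (simp add: t algebra_simps)
    then show "y \<in> dline q v" by simp
  next
    fix y assume "y \<in> dline q v"
    then obtain s where "y = q + s *\<^sub>R v" by (auto simp: mem_dline)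
    then have "y = p + (t + s) *\<^sub>R v" by (simp add: t algebra_simps)
    then show "y \<in> dline p v" by simp
  qed
qed

lemma dline_uminus: "dline p (- v) = dline p v"
proof -
  have "y \<in> dline p v" if "y \<in> dline p (- v)" for y v
    using that by (auto simp: mem_dline) (metis scaleR_minus_left diff_conv_add_uminus)
  from this[of _ v] this[of _ "- v"] show ?thesis by auto
qed

lemma dline_affine_hull: "dline p v = affine hull {p, p + v}"
  by (simp add: affine_hull_2_alt dline_def)

lemma is_line_dline: "v \<noteq> 0 \<Longrightarrow> is_line (dline p v)"
  by (simp add: is_line_def dline_affine_hull aff_dim_2)

lemma is_lineE:
  assumes "is_line L" "p \<in> L"
  obtains v where "norm v = 1" "L = dline p v"
proof -
  have L: "affine L" "aff_dim L = 1" using assms(1) by (auto simp: is_line_def)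
  have "L \<noteq> {p}" using L(2) by auto
  then obtain q where q: "q \<in> L" "q \<noteq> p" using assms(2) by blast
  have "affine hull {p, q} \<subseteq> L" using q assms(2) L(1) by (intro hull_minimal) auto
  then have "affine hull {p, q} = L"
    using q L by (intro affine_dim_equal) (auto simp: aff_dim_2)
  then have "L = dline p (q - p)" by (simp add: dline_affine_hull)
  moreover have "dline p (q - p) = dline p ((1 / norm (q - p)) *\<^sub>R (q - p))"
  proof (intro set_eqI iffI)
    fix y assume "y \<in> dline p (q - p)"
    then obtain t where "y = p + t *\<^sub>R (q - p)" by (auto simp: mem_dline)
    then have "y = p + (t * norm (q - p)) *\<^sub>R (1 / norm (q - p)) *\<^sub>R (q - p)" using q by simp
    then show "y \<in> dline p ((1 / norm (q - p)) *\<^sub>R (q - p))" by (metis dline_point)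
  next
    fix y assume "y \<in> dline p ((1 / norm (q - p)) *\<^sub>R (q - p))"
    then obtain t where "y = p + t *\<^sub>R ((1 / norm (q - p)) *\<^sub>R (q - p))" by (auto simp: mem_dline)
    then show "y \<in> dline p (q - p)" by (auto simp: mem_dline)
  qed
  ultimately show ?thesis using that[of "(1 / norm (q - p)) *\<^sub>R (q - p)"] q by simp
qed

lemma is_line_nonempty: "is_line L \<Longrightarrow> L \<noteq> {}"
  by (auto simp: is_line_def)

text \<open>The base point is the foot of the perpendicular from \<open>z\<close>, which removes the
  mixed terms from later distance formulas.\<close>

lemma is_line_footE:
  assumes "is_line L"
  obtains p v where "norm v = 1" "L = dline p v" "(p - z) \<bullet> v = 0"
proof -
  obtain q where "q \<in> L" using is_line_nonempty[OF assms] by blast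
  then obtain v where v: "norm v = 1" "L = dline q v" using is_lineE[OF assms] by blast
  let ?p = "q + (- ((q - z) \<bullet> v)) *\<^sub>R v"
  have "L = dline ?p v" using v(2) dline_rebase[of ?p q v] dline_point[of q _ v] by blast
  moreover have "(?p - z) \<bullet> v = 0" using v(1) by (simp add: inner_diff_left inner_add_left norm_eq_1)
  ultimately show ?thesis using that v(1) by blast
qed

lemma dline_subset_direction:
  assumes "norm v = 1" "norm w = 1" "dline p v \<subseteq> dline q w"
  shows "v = w \<or> v = - w"
proof -
  have "p \<in> dline q w" "p + 1 *\<^sub>R v \<in> dline q w" using assms(3) dline_base dline_point by blast+
  then obtain s t where "p = q + s *\<^sub>R w" "p + 1 *\<^sub>R v = q + t *\<^sub>R w" unfolding mem_dline by blast
  then have v: "v = (t - s) *\<^sub>R w" by (simp add: algebra_simps)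
  then have "\<bar>t - s\<bar> = 1" using assms by simp
  then have "t - s = 1 \<or> t - s = -1" by linarith
  then show ?thesis using v by auto
qed

lemma affine_parallel_dline:
  assumes "norm v = 1" "norm w = 1"
  shows "affine_parallel (dline p v) (dline q w) \<longleftrightarrow> v = w \<or> v = - w"
proof
  assume "affine_parallel (dline p v) (dline q w)"
  then obtain a where a: "dline q w = (+) a ` dline p v" by (auto simp: affine_parallel_def)
  have "(+) a ` dline p v = dline (a + p) v"
    unfolding dline_def image_image by (simp add: add.assoc)
  then have "dline (a + p) v \<subseteq> dline q w" using a by simp
  then show "v = w \<or> v = - w" by (rule dline_subset_direction[OF assms])
next
  have "dline q v = (+) (q - p) ` dline p v"
    unfolding dline_def image_image by (simp add: add.assoc[symmetric])
  then have "affine_parallel (dline p v) (dline q v)" by (auto simp: affine_parallel_def)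
  then show "affine_parallel (dline p v) (dline q w)" if "v = w \<or> v = - w"
    using that dline_uminus[of q w] by auto
qed

text \<open>Parallel lines with a common point coincide; so removing proper parallels never removes
  a line of the family that meets \<open>l\<close>.\<close>

lemma meeting_not_proper_parallel:
  assumes "is_line l" "L \<inter> l \<noteq> {}"
  shows "L \<notin> proper_parallels l"
proof
  assume L: "L \<in> proper_parallels l"
  obtain p where p: "p \<in> L" "p \<in> l" using assms(2) by blast
  have "is_line L" using L by (simp add: proper_parallels_def)
  then obtain v where v: "norm v = 1" "L = dline p v" by (rule is_lineE[OF _ p(1)])
  obtain w where w: "norm w = 1" "l = dline p w" by (rule is_lineE[OF assms(1) p(2)])
  have "affine_parallel (dline p w) (dline p v)" "dline p v \<noteq> dline p w"
    using L v w by (simp_all add: proper_parallels_def)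
  then show False using affine_parallel_dline[OF w(1) v(1)] dline_uminus[of p v] by auto
qed

lemma dist_along_line:
  assumes "norm v = 1"
  shows "(norm (p + t *\<^sub>R v - c))\<^sup>2 = (t + (p - c) \<bullet> v)\<^sup>2 + ((norm (p - c))\<^sup>2 - ((p - c) \<bullet> v)\<^sup>2)"
proof -
  define x where "x = p - c"
  have "p + t *\<^sub>R v - c = x + t *\<^sub>R v" by (simp add: x_def)
  moreover have "v \<bullet> v = 1" using assms by (simp add: norm_eq_1)
  ultimately show ?thesis unfolding power2_norm_eq_inner x_def[symmetric]
    by (simp add: inner_add_left inner_add_right inner_commute[of v x] power2_eq_square algebra_simps)
qed

text \<open>Along the line the squared distance from the centre is a perfect square plus the squared
  distance of the line, so a single intersection occurs exactly at the foot point.\<close>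

lemma tangent_line_sphere_iff:
  assumes v: "norm v = 1" and r: "0 < r"
  shows "tangent_line (dline p v) (sphere c r) \<longleftrightarrow> (norm (p - c))\<^sup>2 - ((p - c) \<bullet> v)\<^sup>2 = r\<^sup>2"
proof -
  let ?b = "(p - c) \<bullet> v" and ?q = "(norm (p - c))\<^sup>2 - ((p - c) \<bullet> v)\<^sup>2"
  have on: "p + t *\<^sub>R v \<in> sphere c r \<longleftrightarrow> (t + ?b)\<^sup>2 + ?q = r\<^sup>2" for t
  proof -
    have "p + t *\<^sub>R v \<in> sphere c r \<longleftrightarrow> (norm (p + t *\<^sub>R v - c))\<^sup>2 = r\<^sup>2"
      using r by (simp add: dist_norm norm_minus_commute)
    then show ?thesis using dist_along_line[OF v] by simp
  qed
  have line: "is_line (dline p v)" using v by (intro is_line_dline) auto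
  show ?thesis
  proof
    assume q: "?q = r\<^sup>2"
    have "dline p v \<inter> sphere c r = {p + (- ?b) *\<^sub>R v}"
    proof (intro equalityI subsetI)
      fix y assume y: "y \<in> dline p v \<inter> sphere c r"
      then have "y \<in> dline p v" by blast
      then obtain t where t: "y = p + t *\<^sub>R v" by (auto simp: mem_dline)
      then have "t + ?b = 0" using y on[of t] q by (simp only: Int_iff) simp
      then have "t = - ?b" by linarith
      then show "y \<in> {p + (- ?b) *\<^sub>R v}" using t by simp
    next
      fix y assume "y \<in> {p + (- ?b) *\<^sub>R v}"
      then have "y = p + (- ?b) *\<^sub>R v" by simp
      moreover have "p + (- ?b) *\<^sub>R v \<in> sphere c r" using on[of "- ?b"] q by (simp only:) simp
      ultimately show "y \<in> dline p v \<inter> sphere c r" using dline_point by blast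
    qed
    then show "tangent_line (dline p v) (sphere c r)" using line by (auto simp: tangent_line_def)
  next
    assume "tangent_line (dline p v) (sphere c r)"
    then obtain y where y: "dline p v \<inter> sphere c r = {y}" by (auto simp: tangent_line_def)
    then have "y \<in> dline p v" by blast
    then obtain t where t: "y = p + t *\<^sub>R v" by (auto simp: mem_dline)
    then have "(t + ?b)\<^sup>2 + ?q = r\<^sup>2" using on[of t] y by blast
    \<comment> \<open>Reflection in the foot point gives a second intersection, which must be the
      same point.\<close>
    then have "(- t - 2 * ?b + ?b)\<^sup>2 + ?q = r\<^sup>2" by (simp add: power2_eq_square algebra_simps)
    then have "p + (- t - 2 * ?b) *\<^sub>R v \<in> dline p v \<inter> sphere c r" using on[of "- t - 2 * ?b"] by simp
    then have "(- t - 2 * ?b) *\<^sub>R v = t *\<^sub>R v" using y t by simp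
    then have "- t - 2 * ?b = t" using v by auto
    then have "t + ?b = 0" by linarith
    then show "?q = r\<^sup>2" using \<open>(t + ?b)\<^sup>2 + ?q = r\<^sup>2\<close> by (simp only:) simp
  qed
qed

lemma finite_real_square: "finite {x::real. x\<^sup>2 = k}"
proof -
  have "{x. x\<^sup>2 = k} \<subseteq> {sqrt k, - sqrt k}"
    by (auto simp: real_sqrt_abs abs_if)
  then show ?thesis using finite_subset by blast
qed

text \<open>The remaining component of \<open>v\<close>, along \<open>a \<times> b\<close>, is
  determined up to sign by the unit length.\<close>

lemma finite_unit_two_inner:
  fixes a b :: "real^3"
  assumes ab: "a \<times> b \<noteq> 0"
  shows "finite {v. norm v = 1 \<and> a \<bullet> v = \<alpha> \<and> b \<bullet> v = \<beta>}" (is "finite ?A")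
proof -
  let ?N = "a \<times> b"
  have "inj_on (\<lambda>v. ?N \<bullet> v) ?A"
  proof (rule inj_onI)
    fix v w assume "v \<in> ?A" "w \<in> ?A" and N: "?N \<bullet> v = ?N \<bullet> w"
    then have "a \<bullet> (v - w) = 0" "b \<bullet> (v - w) = 0" by (auto simp: inner_diff_right)
    then have "?N \<times> (v - w) = 0"
      by (simp add: cross_cross_left)
    moreover have "?N \<bullet> (v - w) = 0" using N by (simp add: inner_diff_right)
    ultimately show "v = w" using norm_and_cross_eq_0[of ?N "v - w"] ab by auto
  qed
  moreover have "(\<lambda>v. ?N \<bullet> v) ` ?A \<subseteq> {x. x\<^sup>2 = (norm ?N)\<^sup>2 - (norm (\<beta> *\<^sub>R a - \<alpha> *\<^sub>R b))\<^sup>2}"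
  proof clarsimp
    fix v :: "real^3" assume v: "norm v = 1"
    have "?N \<times> v = - (((b \<bullet> v) *\<^sub>R a - (a \<bullet> v) *\<^sub>R b))" by (simp add: cross_cross_left)
    then have "norm (?N \<times> v) = norm ((b \<bullet> v) *\<^sub>R a - (a \<bullet> v) *\<^sub>R b)" by (simp only: norm_minus_cancel)
    then show "(?N \<bullet> v)\<^sup>2 = (norm ?N)\<^sup>2 - (norm ((b \<bullet> v) *\<^sub>R a - (a \<bullet> v) *\<^sub>R b))\<^sup>2"
      using norm_cross_dot[of ?N v] v by simp
  qed
  ultimately show ?thesis by (rule inj_on_finite[OF _ _ finite_real_square])
qed

lemma finite_unit_two_inner_squares:
  fixes a b :: "real^3"
  assumes "a \<times> b \<noteq> 0"
  shows "finite {v. norm v = 1 \<and> (a \<bullet> v)\<^sup>2 = \<alpha> \<and> (b \<bullet> v)\<^sup>2 = \<beta>}"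
proof -
  have "{v. norm v = 1 \<and> (a \<bullet> v)\<^sup>2 = \<alpha> \<and> (b \<bullet> v)\<^sup>2 = \<beta>}
    \<subseteq> (\<Union>x\<in>{x. x\<^sup>2 = \<alpha>}. \<Union>y\<in>{y. y\<^sup>2 = \<beta>}. {v. norm v = 1 \<and> a \<bullet> v = x \<and> b \<bullet> v = y})" by auto
  then show ?thesis
    by (rule finite_subset) (simp add: finite_unit_two_inner[OF assms] finite_real_square)
qed

definition common_tangents :: "(3 \<Rightarrow> real^3) \<Rightarrow> (3 \<Rightarrow> real) \<Rightarrow> points set"
  where "common_tangents c r = {L. is_line L \<and> (\<forall>i. tangent_line L (sphere (c i) (r i)))}"

lemma common_tangents_meeting_eq:
  "common_tangents_meeting l c r = {L \<in> common_tangents c r. L \<inter> l \<noteq> {}}"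
  by (auto simp: common_tangents_def common_tangents_meeting_def)

lemma dline_common_tangent_iff:
  assumes "norm v = 1" "\<And>i. 0 < r i"
  shows "dline p v \<in> common_tangents c r \<longleftrightarrow> (\<forall>i. (norm (p - c i))\<^sup>2 - ((p - c i) \<bullet> v)\<^sup>2 = (r i)\<^sup>2)"
proof -
  have "is_line (dline p v)" using assms(1) by (intro is_line_dline) auto
  then show ?thesis using tangent_line_sphere_iff assms by (simp add: common_tangents_def)
qed

text \<open>Tangents other than \<open>l\<close> correspond to pairs of a parameter on
  \<open>l\<close> and a direction. Each parameter admits finitely many directions, so infinitely
  many tangents meet \<open>l\<close> at infinitely many parameters.\<close>

lemma noncollinear_finite:
  assumes l: "is_line l" and r: "\<And>i. 0 < r i" and nc: "(c 2 - c 1) \<times> (c 3 - c 1) \<noteq> 0"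
  shows "finite (common_tangents_meeting l c r)"
proof (rule ccontr)
  let ?T = "common_tangents_meeting l c r"
  assume inf: "infinite ?T"
  obtain p where "p \<in> l" using is_line_nonempty[OF l] by blast
  then obtain e where e: "norm e = 1" "l = dline p e" using is_lineE[OF l] by blast
  define w where "w s i = s *\<^sub>R e - (c i - p)" for s i
  define W where "W = {(s, v). norm v = 1 \<and> v \<noteq> e \<and> v \<noteq> - e \<and> (\<forall>i. (w s i \<bullet> v)\<^sup>2 = (norm (w s i))\<^sup>2 - (r i)\<^sup>2)}"
  have "?T - {l} \<subseteq> (\<lambda>(s, v). dline (p + s *\<^sub>R e) v) ` W"
  proof
    fix L assume L: "L \<in> ?T - {l}"
    then obtain y where y: "y \<in> L" "y \<in> l" by (auto simp: common_tangents_meeting_eq)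
    then obtain s where s: "y = p + s *\<^sub>R e" using e by (auto simp: mem_dline)
    obtain v where v: "norm v = 1" "L = dline y v"
      using is_lineE[OF _ y(1)] L by (auto simp: common_tangents_meeting_def)
    have "l = dline y e" using e y dline_rebase by blast
    then have vne: "v \<noteq> e \<and> v \<noteq> - e" using L v dline_uminus by auto
    have "\<forall>i. (norm (y - c i))\<^sup>2 - ((y - c i) \<bullet> v)\<^sup>2 = (r i)\<^sup>2"
      using L v dline_common_tangent_iff[OF v(1) r] by (auto simp: common_tangents_meeting_eq)
    then have "\<forall>i. ((y - c i) \<bullet> v)\<^sup>2 = (norm (y - c i))\<^sup>2 - (r i)\<^sup>2"
      by (metis diff_diff_eq2 add_diff_cancel_left')
    moreover have "w s = (\<lambda>i. y - c i)" by (simp add: fun_eq_iff w_def s)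
    ultimately have "(s, v) \<in> W" using v vne by (simp add: W_def)
    then show "L \<in> (\<lambda>(s, v). dline (p + s *\<^sub>R e) v) ` W" using v s by force
  qed
  moreover have "infinite (?T - {l})" using inf by simp
  ultimately have infW: "infinite W" using finite_surj by blast
  have fib: "finite {v. (s, v) \<in> W}" for s
  proof -
    \<comment> \<open>The normal of the triangle of centres expressed at a point of
      \<open>l\<close>: two of the vectors to the centres are independent even if the point lies in
      the plane of the triangle.\<close>
    have "(c 2 - c 1) \<times> (c 3 - c 1) = w s 2 \<times> w s 3 - w s 2 \<times> w s 1 - w s 1 \<times> w s 3"
      by (simp add: w_def cross3_simps forall_3)
    then have "w s 2 \<times> w s 3 \<noteq> 0 \<or> w s 2 \<times> w s 1 \<noteq> 0 \<or> w s 1 \<times> w s 3 \<noteq> 0" using nc by auto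
    then obtain i j where ij: "w s i \<times> w s j \<noteq> 0" by blast
    have "{v. (s, v) \<in> W} \<subseteq> {v. norm v = 1 \<and> (w s i \<bullet> v)\<^sup>2 = (norm (w s i))\<^sup>2 - (r i)\<^sup>2
      \<and> (w s j \<bullet> v)\<^sup>2 = (norm (w s j))\<^sup>2 - (r j)\<^sup>2}" by (auto simp: W_def)
    then show ?thesis using finite_unit_two_inner_squares[OF ij] finite_subset by blast
  qed
  have infS: "infinite (fst ` W)"
  proof
    assume "finite (fst ` W)"
    then have "finite (Sigma (fst ` W) (\<lambda>s. {v. (s, v) \<in> W}))" using fib by blast
    moreover have "W \<subseteq> Sigma (fst ` W) (\<lambda>s. {v. (s, v) \<in> W})" by force
    ultimately show False using infW finite_subset by blast
  qed
  \<comment> \<open>One direction for each parameter suffices for \<open>tangent_curve\<close>,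
    which demands no regularity of the choice.\<close>
  define v where "v s = (SOME v. (s, v) \<in> W)" for s
  have v: "(s, v s) \<in> W" if "s \<in> fst ` W" for s
  proof -
    have "\<exists>v. (s, v) \<in> W" using that by force
    then show ?thesis unfolding v_def by (rule someI_ex)
  qed
  have "tangent_curve e (c 1 - p) (c 2 - p) (c 3 - p) (r 1) (r 2) (r 3) (fst ` W) v"
    by unfold_locales (use v e infS nc in \<open>auto simp: W_def w_def\<close>)
  then show False using no_tangent_curve by blast
qed

subsection \<open>Coaxial spheres\<close>

lemma quadratic_three_roots:
  fixes A B C :: real
  assumes "A * x^2 + B * x + C = 0" "A * y^2 + B * y + C = 0" "A * z^2 + B * z + C = 0"
    and "x \<noteq> y" "x \<noteq> z" "y \<noteq> z"
  shows "A = 0 \<and> B = 0 \<and> C = 0"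
proof -
  have "(x - y) * (A * (x + y) + B) = (A * x^2 + B * x + C) - (A * y^2 + B * y + C)"
    "(x - z) * (A * (x + z) + B) = (A * x^2 + B * x + C) - (A * z^2 + B * z + C)"
    by (simp_all add: algebra_simps power2_eq_square)
  then have "A * (x + y) + B = 0" "A * (x + z) + B = 0" using assms by simp_all
  moreover from this have "A * (y - z) = 0" unfolding distrib_left right_diff_distrib by linarith
  ultimately show ?thesis using assms by auto
qed

text \<open>This is where the number of spheres matters: three centres are just enough to determine
  a quadratic.\<close>

lemma quadratic_three_parameters:
  fixes d :: "3 \<Rightarrow> real"
  assumes "inj d" "\<And>i. A * (d i)\<^sup>2 + B * d i + C = 0"
  shows "A = 0 \<and> B = 0 \<and> C = 0"
proof (rule quadratic_three_roots)
  show "A * (d 1)\<^sup>2 + B * d 1 + C = 0" "A * (d 2)\<^sup>2 + B * d 2 + C = 0" "A * (d 3)\<^sup>2 + B * d 3 + C = 0"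
    using assms(2) by auto
  show "d 1 \<noteq> d 2" "d 1 \<noteq> d 3" "d 2 \<noteq> d 3" using assms(1) by (auto simp: inj_eq)
qed

lemma quadratic_infinite_roots:
  fixes A B C :: real
  assumes "infinite {s. A * s^2 + B * s + C = 0}"
  shows "A = 0 \<and> B = 0 \<and> C = 0"
proof -
  have "[:C, B, A:] = 0"
    using assms by (rule poly_eq_0_of_infinite) (simp add: algebra_simps power2_eq_square)
  then show ?thesis by simp
qed

lemma orthogonal_to_cross_product_args:
  fixes u v x :: "real^3"
  assumes "u \<bullet> x = 0" "v \<bullet> x = 0" "u \<times> v \<noteq> 0"
  shows "x = ((u \<times> v) \<bullet> x / ((u \<times> v) \<bullet> (u \<times> v))) *\<^sub>R (u \<times> v)"
  using assms by (intro cross_eq_0_imp_multiple) (simp_all add: cross_cross_left)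

lemma tangency_coaxial:
  assumes u: "norm u = 1" and c: "\<And>i. c i = a + d i *\<^sub>R u" and r: "\<And>i. 0 < r i"
    and v: "norm v = 1" and p: "(p - a) \<bullet> v = 0"
  shows "dline p v \<in> common_tangents c r \<longleftrightarrow>
    (\<forall>i. (r i)\<^sup>2 = (1 - (u \<bullet> v)\<^sup>2) * (d i)\<^sup>2 + (- 2 * ((p - a) \<bullet> u)) * d i + (norm (p - a))\<^sup>2)"
proof -
  have uu: "u \<bullet> u = 1" using u by (simp add: norm_eq_1)
  have ci: "p - c i = (p - a) - d i *\<^sub>R u" for i by (simp add: c)
  have "(norm (p - c i))\<^sup>2 - ((p - c i) \<bullet> v)\<^sup>2
    = (1 - (u \<bullet> v)\<^sup>2) * (d i)\<^sup>2 + (- 2 * ((p - a) \<bullet> u)) * d i + (norm (p - a))\<^sup>2" for i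
    unfolding ci power2_norm_eq_inner using p uu
    by (simp add: inner_diff_left[of "p - a"] inner_diff_right[of _ "p - a"] inner_commute[of u "p - a"]
        power2_eq_square left_diff_distrib right_diff_distrib)
  then show ?thesis using dline_common_tangent_iff[OF v r, of p c] by (simp only:) metis
qed

text \<open>
  The squared radius is the squared distance from the centre to a line at distance \<open>h\<close> from the axis
  whose angle with the axis has cosine \<open>\<kappa>\<close>, the foot of the common perpendicular being \<open>a\<close>.
\<close>

locale coaxial_spheres =
  fixes c :: "3 \<Rightarrow> real^3" and r :: "3 \<Rightarrow> real" and a u :: "real^3" and d :: "3 \<Rightarrow> real" and \<kappa> h :: real
  assumes u: "norm u = 1" and centre: "\<And>i. c i = a + d i *\<^sub>R u"
    and radius: "\<And>i. (r i)\<^sup>2 = (1 - \<kappa>\<^sup>2) * (d i)\<^sup>2 + h\<^sup>2"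
    and \<kappa>: "0 \<le> \<kappa>" "\<kappa> < 1" and h: "0 \<le> h"
    and r_pos: "\<And>i. 0 < r i" and inj: "inj (\<lambda>i. sphere (c i) (r i))"
begin

definition "\<beta> = sqrt (1 - \<kappa>\<^sup>2)"

definition "V = {v. norm v = 1 \<and> u \<bullet> v = \<kappa>}"

text \<open>The foot on a tangent is orthogonal to \<open>u\<close> and \<open>v\<close> and at
  distance \<open>h\<close> from \<open>a\<close>; since \<open>u \<times> v\<close> has length
  \<open>\<beta>\<close>, two positions remain, and \<open>\<sigma>\<close> selects one of the two
  rulings.\<close>

definition "gen \<sigma> v = dline (a + (\<sigma> * h / \<beta>) *\<^sub>R (u \<times> v)) v"

text \<open>
  One equation for the plane (\<open>\<kappa> = 0\<close>, where \<open>h\<close> plays no role), the cone (\<open>h = 0\<close>) and the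
  hyperboloid.
\<close>

definition "quadric = {y. \<kappa>\<^sup>2 * ((norm (y - a))\<^sup>2 - h\<^sup>2) = ((y - a) \<bullet> u)\<^sup>2}"

lemma \<kappa>_sq: "\<kappa>\<^sup>2 < 1"
  using \<kappa> by (simp add: power_less_one_iff abs_square_less_1)

lemma \<beta>_pos: "0 < \<beta>" and \<beta>_sq: "\<beta>\<^sup>2 = 1 - \<kappa>\<^sup>2"
  using \<kappa>_sq by (simp_all add: \<beta>_def)

lemma uu: "u \<bullet> u = 1"
  using u by (simp add: norm_eq_1)

lemma inj_d: "inj d"
proof (rule injI)
  fix i j assume d: "d i = d j"
  then have "(r i)\<^sup>2 = (r j)\<^sup>2" using radius by simp
  then have "r i = r j" using r_pos[of i] r_pos[of j] by (simp add: power2_eq_iff)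
  then have "sphere (c i) (r i) = sphere (c j) (r j)" using d centre by simp
  then show "i = j" using injD[OF inj] by blast
qed

lemma V_unit: "v \<in> V \<Longrightarrow> norm v = 1" "v \<in> V \<Longrightarrow> v \<bullet> v = 1" "v \<in> V \<Longrightarrow> u \<bullet> v = \<kappa>" "v \<in> V \<Longrightarrow> v \<bullet> u = \<kappa>"
  by (auto simp: V_def norm_eq_1 inner_commute)

lemma cross_norm: "v \<in> V \<Longrightarrow> (u \<times> v) \<bullet> (u \<times> v) = \<beta>\<^sup>2"
  unfolding \<beta>_sq by (simp add: dot_cross uu V_unit power2_eq_square)

lemma cross_nonzero: "v \<in> V \<Longrightarrow> u \<times> v \<noteq> 0"
  using cross_norm[of v] \<beta>_pos by auto

text \<open>The squared distance to the line and the squared radius are quadratics in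
  \<open>d i\<close> agreeing at three values. The absent linear coefficient in the normal form puts
  the foot in the plane through \<open>a\<close> orthogonal to the axis.\<close>

lemma tangency_at_foot:
  assumes v: "norm v = 1" and p: "(p - a) \<bullet> v = 0"
  shows "dline p v \<in> common_tangents c r \<longleftrightarrow>
    (u \<bullet> v)\<^sup>2 = \<kappa>\<^sup>2 \<and> (p - a) \<bullet> u = 0 \<and> norm (p - a) = h"
proof -
  have eq: "dline p v \<in> common_tangents c r \<longleftrightarrow> (\<forall>i. (1 - \<kappa>\<^sup>2) * (d i)\<^sup>2 + h\<^sup>2
      = (1 - (u \<bullet> v)\<^sup>2) * (d i)\<^sup>2 + (- 2 * ((p - a) \<bullet> u)) * d i + (norm (p - a))\<^sup>2)"
    unfolding radius[symmetric] by (rule tangency_coaxial[OF u centre r_pos v p])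
  show ?thesis
  proof
    assume "dline p v \<in> common_tangents c r"
    then have "(\<kappa>\<^sup>2 - (u \<bullet> v)\<^sup>2) * (d i)\<^sup>2 + (- 2 * ((p - a) \<bullet> u)) * d i + ((norm (p - a))\<^sup>2 - h\<^sup>2) = 0" for i
      unfolding eq by (simp add: algebra_simps)
    from quadratic_three_parameters[OF inj_d this] show "(u \<bullet> v)\<^sup>2 = \<kappa>\<^sup>2 \<and> (p - a) \<bullet> u = 0 \<and> norm (p - a) = h"
      using h by auto
  qed (simp add: eq)
qed

lemma gen_common_tangent:
  assumes "v \<in> V" "\<sigma> = 1 \<or> \<sigma> = -1"
  shows "gen \<sigma> v \<in> common_tangents c r"
proof -
  have "norm (u \<times> v) = \<beta>" using cross_norm[OF assms(1)] \<beta>_pos by (simp add: norm_eq_sqrt_inner)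
  then have "norm ((\<sigma> * h / \<beta>) *\<^sub>R (u \<times> v)) = h" using assms(2) \<beta>_pos h by auto
  then show ?thesis unfolding gen_def
    by (subst tangency_at_foot) (use assms in \<open>auto simp: V_unit dot_cross_self inner_commute[of _ u]\<close>)
qed

lemma common_tangentE:
  assumes "L \<in> common_tangents c r"
  obtains \<sigma> v where "\<sigma> = 1 \<or> \<sigma> = -1" "v \<in> V" "L = gen \<sigma> v"
proof -
  have "is_line L" using assms by (simp add: common_tangents_def)
  then obtain p w where w: "norm w = 1" "L = dline p w" "(p - a) \<bullet> w = 0" by (rule is_line_footE)
  have foot: "(u \<bullet> w)\<^sup>2 = \<kappa>\<^sup>2" "(p - a) \<bullet> u = 0" "norm (p - a) = h"
    using assms w tangency_at_foot by auto
  \<comment> \<open>Of the two unit directions of the line, one with cosine \<open>+\<kappa>\<close>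
    is selected.\<close>
  obtain v where v: "v \<in> V" "L = dline p v" "(p - a) \<bullet> v = 0"
  proof (cases "u \<bullet> w = \<kappa>")
    case True then show ?thesis using that[of w] w by (simp add: V_def)
  next
    case False
    then have "u \<bullet> (- w) = \<kappa>" using foot(1) by (auto simp: power2_eq_iff)
    then show ?thesis using that[of "- w"] w dline_uminus by (simp add: V_def)
  qed
  define k where "k = (u \<times> v) \<bullet> (p - a) / ((u \<times> v) \<bullet> (u \<times> v))"
  have k: "p - a = k *\<^sub>R (u \<times> v)" unfolding k_def
    by (rule orthogonal_to_cross_product_args[OF _ _ cross_nonzero[OF v(1)]])
      (use v(3) foot(2) in \<open>simp_all add: inner_commute\<close>)
  have "norm (u \<times> v) = \<beta>" using cross_norm[OF v(1)] \<beta>_pos by (simp add: norm_eq_sqrt_inner)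
  then have "\<bar>k\<bar> * \<beta> = h" using foot(3) unfolding k by simp
  then have "k = 1 * h / \<beta> \<or> k = -1 * h / \<beta>" using \<beta>_pos by (auto simp: field_simps abs_if split: if_splits)
  moreover have "p = a + k *\<^sub>R (u \<times> v)" using k by (simp add: algebra_simps)
  ultimately show ?thesis using v that unfolding gen_def by metis
qed

lemma gen_point:
  assumes "v \<in> V" "\<sigma> = 1 \<or> \<sigma> = -1" "y = a + (\<sigma> * h / \<beta>) *\<^sub>R (u \<times> v) + t *\<^sub>R v"
  shows "(y - a) \<bullet> u = t * \<kappa>" "(norm (y - a))\<^sup>2 = h\<^sup>2 + t\<^sup>2" "(y - a) \<bullet> v = t"
proof -
  have y: "y - a = (\<sigma> * h / \<beta>) *\<^sub>R (u \<times> v) + t *\<^sub>R v" using assms(3) by simp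
  show "(y - a) \<bullet> u = t * \<kappa>" "(y - a) \<bullet> v = t"
    unfolding y using assms(1) by (simp_all add: inner_add_left dot_cross_self V_unit)
  have "(norm (y - a))\<^sup>2 = (\<sigma> * h / \<beta>)\<^sup>2 * \<beta>\<^sup>2 + t\<^sup>2"
    unfolding y power2_norm_eq_inner using assms(1) cross_norm[OF assms(1)]
    by (simp add: inner_add_left inner_add_right dot_cross_self V_unit power2_eq_square)
  then show "(norm (y - a))\<^sup>2 = h\<^sup>2 + t\<^sup>2"
    using assms(2) \<beta>_pos by (auto simp: power_divide)
qed

lemma common_tangent_subset_quadric:
  assumes "L \<in> common_tangents c r"
  shows "L \<subseteq> quadric"
proof
  fix y assume y: "y \<in> L"
  obtain \<sigma> v where \<sigma>: "\<sigma> = 1 \<or> \<sigma> = -1" and v: "v \<in> V" "L = gen \<sigma> v" using assms by (rule common_tangentE)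
  obtain t where "y = a + (\<sigma> * h / \<beta>) *\<^sub>R (u \<times> v) + t *\<^sub>R v" using y v by (auto simp: gen_def mem_dline)
  from gen_point[OF v(1) \<sigma> this] show "y \<in> quadric" by (simp add: quadric_def power_mult_distrib)
qed

text \<open>Off the axis, \<open>u\<close> and \<open>y - a\<close> are independent and the squares
  of their scalar products with the direction are prescribed. On the axis,
  \<open>\<kappa> < 1\<close> lets a tangent pass only through \<open>a\<close>, and only if
  \<open>h = 0\<close>.\<close>

lemma finite_tangents_through:
  assumes "y \<noteq> a \<or> h \<noteq> 0"
  shows "finite {L \<in> common_tangents c r. y \<in> L}"
proof (cases "u \<times> (y - a) = 0")
  case False
  have "{L \<in> common_tangents c r. y \<in> L} \<subseteq> dline y ` {v. norm v = 1 \<and> (u \<bullet> v)\<^sup>2 = \<kappa>\<^sup>2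
    \<and> ((y - a) \<bullet> v)\<^sup>2 = (norm (y - a))\<^sup>2 - h\<^sup>2}"
  proof
    fix L assume L: "L \<in> {L \<in> common_tangents c r. y \<in> L}"
    then obtain \<sigma> v where \<sigma>: "\<sigma> = 1 \<or> \<sigma> = -1" and v: "v \<in> V" "L = gen \<sigma> v" using common_tangentE by blast
    obtain t where t: "y = a + (\<sigma> * h / \<beta>) *\<^sub>R (u \<times> v) + t *\<^sub>R v" using L v by (auto simp: gen_def mem_dline)
    have "L = dline y v" using L v dline_rebase unfolding gen_def by blast
    then show "L \<in> dline y ` {v. norm v = 1 \<and> (u \<bullet> v)\<^sup>2 = \<kappa>\<^sup>2
      \<and> ((y - a) \<bullet> v)\<^sup>2 = (norm (y - a))\<^sup>2 - h\<^sup>2}"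
      using gen_point[OF v(1) \<sigma> t] v(1) by (auto simp: V_unit)
  qed
  then show ?thesis using finite_unit_two_inner_squares[OF False] by (rule finite_subset[OF _ finite_imageI])
next
  case True
  have "u \<noteq> 0" using u by auto
  define k where "k = u \<bullet> (y - a)"
  have y: "y - a = k *\<^sub>R u" using cross_eq_0_imp_multiple[OF \<open>u \<noteq> 0\<close> True] uu by (simp add: k_def)
  have "L \<notin> common_tangents c r" if yL: "y \<in> L" for L
  proof
    assume "L \<in> common_tangents c r"
    then obtain \<sigma> v where \<sigma>: "\<sigma> = 1 \<or> \<sigma> = -1" and v: "v \<in> V" "L = gen \<sigma> v" by (rule common_tangentE)
    obtain t where t: "y = a + (\<sigma> * h / \<beta>) *\<^sub>R (u \<times> v) + t *\<^sub>R v" using yL v by (auto simp: gen_def mem_dline)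
    note g = gen_point[OF v(1) \<sigma> t]
    have "k = t * \<kappa>" using g(1) uu unfolding y by simp
    moreover have "k\<^sup>2 = h\<^sup>2 + t\<^sup>2" using g(2) u unfolding y by (simp add: power_mult_distrib)
    ultimately have "h\<^sup>2 + t\<^sup>2 * \<beta>\<^sup>2 = 0" unfolding \<beta>_sq by (simp add: power_mult_distrib algebra_simps)
    then have "h = 0" "t = 0" using \<beta>_pos by (auto simp: add_nonneg_eq_0_iff)
    then show False using assms t by simp
  qed
  then have "{L \<in> common_tangents c r. y \<in> L} = {}" by blast
  then show ?thesis by (simp only: finite.emptyI)
qed

lemma quadric_on_line:
  assumes "norm e = 1" "(p - a) \<bullet> e = 0"
  shows "p + s *\<^sub>R e \<in> quadric \<longleftrightarrow> (\<kappa>\<^sup>2 - (e \<bullet> u)\<^sup>2) * s\<^sup>2 + (- 2 * ((p - a) \<bullet> u) * (e \<bullet> u)) * s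
    + (\<kappa>\<^sup>2 * ((norm (p - a))\<^sup>2 - h\<^sup>2) - ((p - a) \<bullet> u)\<^sup>2) = 0"
proof -
  have 1: "(norm (p + s *\<^sub>R e - a))\<^sup>2 = s\<^sup>2 + (norm (p - a))\<^sup>2"
    using dist_along_line[OF assms(1), of p s a] assms(2) by simp
  have 2: "(p + s *\<^sub>R e - a) \<bullet> u = (p - a) \<bullet> u + s * (e \<bullet> u)" by (simp add: inner_add_left inner_diff_left)
  show ?thesis unfolding quadric_def mem_Collect_eq 1 2 by (simp add: power2_eq_square algebra_simps)
qed

text \<open>The quadric restricted to the line is a quadratic in the parameter. If all its
  coefficients vanish and \<open>\<kappa>\<close> is positive, they are the three conditions of
  \<open>tangency_at_foot\<close>.\<close>

lemma line_subset_quadric: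
  assumes "is_line l" "infinite (l \<inter> quadric)"
  shows "l \<subseteq> quadric" "0 < \<kappa> \<Longrightarrow> l \<in> common_tangents c r"
proof -
  obtain p e where e: "norm e = 1" "l = dline p e" "(p - a) \<bullet> e = 0" using assms(1) by (rule is_line_footE)
  note q = quadric_on_line[OF e(1,3)]
  have "l \<inter> quadric \<subseteq> (\<lambda>s. p + s *\<^sub>R e) ` {s. p + s *\<^sub>R e \<in> quadric}" unfolding e by (auto simp: mem_dline)
  then have "infinite {s. p + s *\<^sub>R e \<in> quadric}" using assms(2) finite_surj by blast
  from quadratic_infinite_roots[OF this[unfolded q]]
  have *: "(e \<bullet> u)\<^sup>2 = \<kappa>\<^sup>2" "((p - a) \<bullet> u) * (e \<bullet> u) = 0" "\<kappa>\<^sup>2 * ((norm (p - a))\<^sup>2 - h\<^sup>2) = ((p - a) \<bullet> u)\<^sup>2"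
    by auto
  then show "l \<subseteq> quadric" unfolding e using q by (auto simp: mem_dline)
  assume "0 < \<kappa>"
  then have "e \<bullet> u \<noteq> 0" using *(1) by auto
  then have "(p - a) \<bullet> u = 0" using *(2) by simp
  moreover from this have "norm (p - a) = h" using *(3) \<open>0 < \<kappa>\<close> h by simp
  ultimately show "l \<in> common_tangents c r" using tangency_at_foot[OF e(1,3)] *(1) e(2) by (simp add: inner_commute)
qed

lemma infinite_meeting_cases:
  assumes "is_line l" "infinite (common_tangents_meeting l c r)"
  shows "h = 0 \<and> a \<in> l \<or> l \<subseteq> quadric"
proof (rule ccontr)
  assume neg: "\<not> ?thesis"
  then have fin: "finite (l \<inter> quadric)" using line_subset_quadric assms(1) by blast
  have "common_tangents_meeting l c r \<subseteq> (\<Union>y\<in>l \<inter> quadric. {L \<in> common_tangents c r. y \<in> L})"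
    using common_tangent_subset_quadric by (auto simp: common_tangents_meeting_eq)
  moreover have "finite (\<Union>y\<in>l \<inter> quadric. {L \<in> common_tangents c r. y \<in> L})"
  proof (rule finite_UN_I[OF fin])
    fix y assume "y \<in> l \<inter> quadric"
    then have "y \<noteq> a \<or> h \<noteq> 0" using neg by auto
    then show "finite {L \<in> common_tangents c r. y \<in> L}" by (rule finite_tangents_through)
  qed
  ultimately show False using assms(2) finite_subset by blast
qed

end

section \<open>Normal form for collinear centres\<close>

lemma common_tangent_imp_inj_centres:
  assumes r: "\<And>i. 0 < r i" and inj: "inj (\<lambda>i. sphere (c i) (r i))" and L: "L \<in> common_tangents c r"
  shows "inj c"
proof (rule injI)
  fix i j assume cc: "c i = c j"
  have "is_line L" using L by (simp add: common_tangents_def)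
  then obtain p v where v: "norm v = 1" "L = dline p v" by (rule is_line_footE)
  have "\<forall>i. (norm (p - c i))\<^sup>2 - ((p - c i) \<bullet> v)\<^sup>2 = (r i)\<^sup>2"
    using L v dline_common_tangent_iff[where r=r, OF v(1) r] by simp
  \<comment> \<open>Concentric spheres touching the same line have its distance from the centre as
    common radius.\<close>
  then have "(r i)\<^sup>2 = (r j)\<^sup>2" using cc by metis
  then have "r i = r j" using r[of i] r[of j] by (simp add: power2_eq_iff)
  then have "sphere (c i) (r i) = sphere (c j) (r j)" using cc by simp
  then show "i = j" using injD[OF inj] by blast
qed

text \<open>Completing the square in the formula of \<open>tangency_coaxial\<close>: the vertex
  \<open>s = b / \<alpha>\<close> becomes the new origin on the axis, and the minimal value is the
  square of \<open>h\<close>.\<close>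

lemma coaxial_normal_form:
  assumes u: "norm u = 1" and c: "\<And>i. c i = a + d i *\<^sub>R u" and r: "\<And>i. 0 < r i"
    and inj: "inj (\<lambda>i. sphere (c i) (r i))"
    and v: "norm v = 1" and p: "(p - a) \<bullet> v = 0" and L: "dline p v \<in> common_tangents c r"
    and not_parallel: "(u \<bullet> v)\<^sup>2 \<noteq> 1"
  shows "\<exists>s d' h. coaxial_spheres c r (a + s *\<^sub>R u) u d' \<bar>u \<bullet> v\<bar> h"
proof -
  define \<alpha> where "\<alpha> = 1 - (u \<bullet> v)\<^sup>2"
  define b where "b = (p - a) \<bullet> u"
  have uv: "u \<bullet> u = 1" "v \<bullet> v = 1" using u v by (simp_all add: norm_eq_1)
  have "\<bar>u \<bullet> v\<bar> \<le> 1" using Cauchy_Schwarz_ineq2[of u v] u v by simp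
  then have lt: "\<bar>u \<bullet> v\<bar> < 1" using not_parallel by (metis abs_square_eq_1 order_le_less power2_abs)
  then have \<alpha>: "0 < \<alpha>" unfolding \<alpha>_def by (simp add: abs_square_less_1)
  \<comment> \<open>As \<open>p - a\<close> is orthogonal to \<open>v\<close>, only the part of
    \<open>u\<close> orthogonal to \<open>v\<close> counts; its squared length is
    \<open>\<alpha>\<close>, and Cauchy-Schwarz makes the minimum nonnegative.\<close>
  have "b = (p - a) \<bullet> (u - (u \<bullet> v) *\<^sub>R v)" using p by (simp add: b_def inner_diff_right)
  then have "b\<^sup>2 \<le> ((p - a) \<bullet> (p - a)) * ((u - (u \<bullet> v) *\<^sub>R v) \<bullet> (u - (u \<bullet> v) *\<^sub>R v))"
    using Cauchy_Schwarz_ineq by metis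
  also have "(u - (u \<bullet> v) *\<^sub>R v) \<bullet> (u - (u \<bullet> v) *\<^sub>R v) = \<alpha>"
    using uv by (simp add: \<alpha>_def inner_diff_left inner_diff_right inner_commute[of v u] power2_eq_square)
  finally have "b\<^sup>2 \<le> (norm (p - a))\<^sup>2 * \<alpha>" by (simp add: power2_norm_eq_inner)
  then have nonneg: "0 \<le> (norm (p - a))\<^sup>2 - b\<^sup>2 / \<alpha>" using \<alpha> by (simp add: field_simps)
  define s where "s = b / \<alpha>"
  define h where "h = sqrt ((norm (p - a))\<^sup>2 - b\<^sup>2 / \<alpha>)"
  have tan: "(r i)\<^sup>2 = \<alpha> * (d i)\<^sup>2 + (- 2 * b) * d i + (norm (p - a))\<^sup>2" for i
    using L tangency_coaxial[where c=c and d=d and r=r, OF u c r v p] unfolding \<alpha>_def b_def by blast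
  have "coaxial_spheres c r (a + s *\<^sub>R u) u (\<lambda>i. d i - s) \<bar>u \<bullet> v\<bar> h"
  proof
    show "c i = a + s *\<^sub>R u + (d i - s) *\<^sub>R u" for i by (simp add: c algebra_simps)
    have b: "b = \<alpha> * s" using \<alpha> by (simp add: s_def)
    then have bb: "b\<^sup>2 / \<alpha> = \<alpha> * s\<^sup>2" using \<alpha> by (simp add: power2_eq_square)
    have hh: "h\<^sup>2 = (norm (p - a))\<^sup>2 - \<alpha> * s\<^sup>2" using nonneg unfolding h_def bb by simp
    have aa: "1 - \<bar>u \<bullet> v\<bar>\<^sup>2 = \<alpha>" by (simp add: \<alpha>_def)
    show "(r i)\<^sup>2 = (1 - \<bar>u \<bullet> v\<bar>\<^sup>2) * (d i - s)\<^sup>2 + h\<^sup>2" for i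
      unfolding tan b hh aa by (simp add: power2_eq_square algebra_simps)
    show "0 \<le> h" using nonneg by (simp add: h_def)
  qed (use u lt r inj in auto)
  then show ?thesis by blast
qed

lemma unit_parallel:
  fixes u v :: "'a::real_inner"
  assumes "norm u = 1" "norm v = 1" "(u \<bullet> v)\<^sup>2 = 1"
  shows "u = v \<or> u = - v"
proof -
  have "u \<bullet> v = 1 \<or> u \<bullet> (- v) = 1" using assms(3) by (auto simp: power2_eq_1_iff)
  then show ?thesis using unit_eq_of_inner_1[OF assms(1)] assms(2) by (metis norm_minus_cancel)
qed

text \<open>Here \<open>\<beta>\<close> would be zero, outside the normal form. All common tangents
  are parallel to the axis, so each is fixed by its point on \<open>l\<close>, a root of a
  quadratic; that quadratic can degenerate only if \<open>l\<close> has the same direction, and then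
  \<open>l\<close> is the only candidate.\<close>

lemma cylinder_finite:
  assumes u: "norm u = 1" and c: "\<And>i. c i = a + d i *\<^sub>R u" and r: "\<And>i. 0 < r i"
    and inj: "inj (\<lambda>i. sphere (c i) (r i))" and l: "is_line l"
    and v: "norm v = 1" and p: "(p - a) \<bullet> v = 0" and L: "dline p v \<in> common_tangents c r"
    and parallel: "(u \<bullet> v)\<^sup>2 = 1"
  shows "finite (common_tangents_meeting l c r)"
proof -
  have "inj c" using r inj L by (rule common_tangent_imp_inj_centres)
  then have injd: "inj d" using c by (metis injD injI)
  have uu: "u \<bullet> u = 1" using u by (simp add: norm_eq_1)
  define R where "R = norm (p - a)"
  have "(p - a) \<bullet> u = 0" using unit_parallel[OF u v parallel] p by auto
  then have ri: "(r i)\<^sup>2 = R\<^sup>2" for i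
    using L tangency_coaxial[where c=c and d=d and r=r, OF u c r v p] parallel by (simp add: R_def)
  have direction: "\<exists>q. M = dline q u" if M: "M \<in> common_tangents c r" for M
  proof -
    have "is_line M" using M by (simp add: common_tangents_def)
    then obtain q w where w: "norm w = 1" "M = dline q w" "(q - a) \<bullet> w = 0" by (rule is_line_footE)
    have "(1 - (u \<bullet> w)\<^sup>2) * (d i)\<^sup>2 + (- 2 * ((q - a) \<bullet> u)) * d i + ((norm (q - a))\<^sup>2 - R\<^sup>2) = 0" for i
      using M tangency_coaxial[where c=c and d=d and r=r, OF u c r w(1,3)] unfolding w(2) ri by (simp add: algebra_simps)
    from quadratic_three_parameters[OF injd this] have "1 - (u \<bullet> w)\<^sup>2 = 0" by blast
    then have "u = w \<or> u = - w" using unit_parallel[OF u w(1)] by simp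
    then show ?thesis using w(2) dline_uminus[of q w] by auto
  qed
  obtain q e where e: "norm e = 1" "l = dline q e" "(q - a) \<bullet> e = 0" using l by (rule is_line_footE)
  have meet: "\<exists>s. M = dline (q + s *\<^sub>R e) u \<and>
      (1 - (e \<bullet> u)\<^sup>2) * s\<^sup>2 + (- 2 * ((q - a) \<bullet> u) * (e \<bullet> u)) * s + ((norm (q - a))\<^sup>2 - ((q - a) \<bullet> u)\<^sup>2 - R\<^sup>2) = 0"
    if MT: "M \<in> common_tangents_meeting l c r" for M
  proof -
    have M: "M \<in> common_tangents c r" using MT by (simp add: common_tangents_meeting_eq)
    obtain y where y: "y \<in> M" "y \<in> l" using MT by (auto simp: common_tangents_meeting_eq)
    obtain s where s: "y = q + s *\<^sub>R e" using y e by (auto simp: mem_dline)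
    have My: "M = dline y u" using direction[OF M] y dline_rebase by blast
    have "(norm (y - c 1))\<^sup>2 - ((y - c 1) \<bullet> u)\<^sup>2 = R\<^sup>2"
      using M dline_common_tangent_iff[where r=r, OF u r] ri unfolding My by simp
    moreover have "(norm (y - c 1))\<^sup>2 - ((y - c 1) \<bullet> u)\<^sup>2 = (norm (y - a))\<^sup>2 - ((y - a) \<bullet> u)\<^sup>2"
    proof -
      define x where "x = y - a"
      have yc: "y - c 1 = x + (- d 1) *\<^sub>R u" unfolding x_def c[of 1] by simp
      show ?thesis unfolding yc x_def[symmetric] power2_norm_eq_inner using uu
        by (simp add: inner_add_left inner_add_right inner_diff_left inner_diff_right inner_commute[of u x]
            power2_eq_square algebra_simps)
    qed
    moreover have "(norm (y - a))\<^sup>2 = s\<^sup>2 + (norm (q - a))\<^sup>2"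
      using dist_along_line[OF e(1), of q s a] e(3) s by simp
    moreover have "(y - a) \<bullet> u = (q - a) \<bullet> u + s * (e \<bullet> u)" by (simp add: s inner_add_left inner_diff_left)
    ultimately have "s\<^sup>2 + (norm (q - a))\<^sup>2 - ((q - a) \<bullet> u + s * (e \<bullet> u))\<^sup>2 = R\<^sup>2" by simp
    then show ?thesis using My s by (intro exI[of _ s]) (simp add: power2_eq_square algebra_simps)
  qed
  show ?thesis
  proof (cases "(e \<bullet> u)\<^sup>2 = 1")
    case True
    then have "e = u \<or> e = - u" using unit_parallel[OF e(1) u] by simp
    then have "dline (q + s *\<^sub>R e) u = l" for s
      using dline_rebase[OF dline_point[of q s e]] dline_uminus[of "q + s *\<^sub>R e" u] e(2) by auto
    then have "common_tangents_meeting l c r \<subseteq> {l}" using meet by blast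
    then show ?thesis using finite_subset by blast
  next
    case False
    let ?S = "{s. (1 - (e \<bullet> u)\<^sup>2) * s\<^sup>2 + (- 2 * ((q - a) \<bullet> u) * (e \<bullet> u)) * s
      + ((norm (q - a))\<^sup>2 - ((q - a) \<bullet> u)\<^sup>2 - R\<^sup>2) = 0}"
    have "finite ?S"
    proof (rule ccontr)
      assume "infinite ?S"
      from quadratic_infinite_roots[OF this] show False using False by simp
    qed
    moreover have "common_tangents_meeting l c r \<subseteq> (\<lambda>s. dline (q + s *\<^sub>R e) u) ` ?S" using meet by blast
    ultimately show ?thesis using finite_surj by blast
  qed
qed

lemma infinite_imp_coaxial:
  assumes l: "is_line l" and r: "\<And>i. 0 < r i" and inj: "inj (\<lambda>i. sphere (c i) (r i))"
    and inf: "infinite (common_tangents_meeting l c r)"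
  shows "\<exists>a u d \<kappa> h. coaxial_spheres c r a u d \<kappa> h"
proof -
  have col: "(c 2 - c 1) \<times> (c 3 - c 1) = 0" using noncollinear_finite[where c=c and r=r, OF l r] inf by blast
  obtain L where L: "L \<in> common_tangents c r"
    using infinite_imp_nonempty[OF inf] by (auto simp: common_tangents_meeting_eq)
  have ne: "c 2 - c 1 \<noteq> 0"
  proof
    assume "c 2 - c 1 = 0"
    then have "c 1 = c 2" by simp
    moreover have "inj c" using r inj L by (rule common_tangent_imp_inj_centres)
    ultimately have "(1::3) = 2" by (blast dest: injD)
    then show False by simp
  qed
  define n where "n = norm (c 2 - c 1)"
  define u where "u = (1 / n) *\<^sub>R (c 2 - c 1)"
  have n: "n \<noteq> 0" using ne by (simp add: n_def)
  have u: "norm u = 1" using ne by (simp add: u_def n_def)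
  obtain k where "c 3 - c 1 = k *\<^sub>R (c 2 - c 1)" using cross_eq_0_imp_multiple[OF ne col] by blast
  moreover have "c 2 - c 1 = n *\<^sub>R u" using n by (simp add: u_def)
  ultimately have k: "c 3 - c 1 = (k * n) *\<^sub>R u" "c 2 - c 1 = n *\<^sub>R u" by simp_all
  define d where "d i = (if i = 1 then 0 else if i = 2 then n else k * n)" for i :: 3
  have "\<forall>i. c i = c 1 + d i *\<^sub>R u" using k by (auto simp: forall_3 d_def algebra_simps)
  then have c: "c i = c 1 + d i *\<^sub>R u" for i by blast
  have "is_line L" using L by (simp add: common_tangents_def)
  then obtain p v where v: "norm v = 1" "L = dline p v" "(p - c 1) \<bullet> v = 0" by (rule is_line_footE)
  have "(u \<bullet> v)\<^sup>2 \<noteq> 1"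
    using cylinder_finite[where c=c and d=d and r=r, OF u c r inj l v(1,3)] L inf unfolding v(2) by blast
  then show ?thesis using coaxial_normal_form[where c=c and d=d and r=r, OF u c r inj v(1,3)] L unfolding v(2) by blast
qed

section \<open>Tangent families in a plane and on a cone\<close>

lemma infinite_line: "is_line L \<Longrightarrow> infinite L"
proof -
  assume "is_line L"
  then obtain p v where v: "norm v = 1" "L = dline p v" by (rule is_line_footE)
  have "inj (\<lambda>t. p + t *\<^sub>R v)" using v(1) by (auto intro!: injI)
  then show ?thesis unfolding v dline_def by (simp add: finite_image_iff infinite_UNIV_char_0)
qed

lemma unit_orthogonalE:
  fixes u :: "real^3"
  obtains f where "norm f = 1" "u \<bullet> f = 0"
proof -
  obtain y where y: "y \<noteq> 0" "orthogonal u y" using orthogonal_to_vector_exists[of u] by auto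
  show ?thesis using that[of "(1 / norm y) *\<^sub>R y"] y by (simp add: orthogonal_def)
qed

text \<open>A line has only two unit directions, so base points may depend on the direction in any
  way.\<close>

lemma infinite_direction_family:
  assumes inf: "infinite W" and unit: "\<And>v. v \<in> W \<Longrightarrow> norm v = 1"
  shows "infinite ((\<lambda>v. dline (p v) v) ` W)"
proof
  assume "finite ((\<lambda>v. dline (p v) v) ` W)"
  then obtain v where v: "v \<in> W" "infinite {w \<in> W. dline (p w) w = dline (p v) v}"
    using pigeonhole_infinite[OF inf] by blast
  have "{w \<in> W. dline (p w) w = dline (p v) v} \<subseteq> {v, - v}"
    using dline_subset_direction unit v(1) by blast
  then show False using v(2) finite_subset by blast
qed

lemma plane_vector_parallel:
  fixes u e x :: "real^3"
  assumes "norm u = 1" "e \<bullet> u = 0" "e \<noteq> 0" "x \<bullet> u = 0" "x \<bullet> (u \<times> e) = 0"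
  shows "\<exists>k. x = k *\<^sub>R e"
proof -
  have uu: "u \<bullet> u = 1" using assms(1) by (simp add: norm_eq_1)
  have e: "u \<times> (u \<times> e) = - e" using assms(2) uu by (simp add: Lagrange inner_commute)
  have "x = ((u \<times> (u \<times> e)) \<bullet> x / ((u \<times> (u \<times> e)) \<bullet> (u \<times> (u \<times> e)))) *\<^sub>R (u \<times> (u \<times> e))"
    by (rule orthogonal_to_cross_product_args) (use assms e in \<open>simp_all add: inner_commute\<close>)
  then show ?thesis unfolding e by (metis scaleR_minus_left scaleR_minus_right)
qed

lemma coplanar_lines_meet:
  assumes u: "norm u = 1" and v: "norm v = 1" "v \<bullet> u = 0" and e: "norm e = 1" "e \<bullet> u = 0"
    and pq: "(p - q) \<bullet> u = 0" and np: "v \<noteq> e" "v \<noteq> - e"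
  shows "dline q v \<inter> dline p e \<noteq> {}"
proof -
  let ?w = "u \<times> e"
  have e0: "e \<noteq> 0" using e by auto
  have vw: "v \<bullet> ?w \<noteq> 0"
  proof
    assume "v \<bullet> ?w = 0"
    then obtain k where k: "v = k *\<^sub>R e" using plane_vector_parallel[OF u e(2) e0 v(2)] by blast
    then have "\<bar>k\<bar> = 1" using v(1) e(1) by simp
    then have "k = 1 \<or> k = -1" by linarith
    then show False using k np by auto
  qed
  \<comment> \<open>Chosen to make the component along the normal \<open>?w\<close> of the second
    line vanish.\<close>
  define t where "t = ((p - q) \<bullet> ?w) / (v \<bullet> ?w)"
  have "(q + t *\<^sub>R v - p) \<bullet> u = 0" using v(2) pq by (simp add: inner_diff_left inner_add_left)
  moreover have "(q + t *\<^sub>R v - p) \<bullet> ?w = 0" using vw by (simp add: t_def inner_diff_left inner_add_left)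
  ultimately obtain k where "q + t *\<^sub>R v - p = k *\<^sub>R e" using plane_vector_parallel[OF u e(2) e0] by blast
  then have "q + t *\<^sub>R v = p + k *\<^sub>R e" by (simp add: algebra_simps)
  then have "q + t *\<^sub>R v \<in> dline p e" by simp
  then show ?thesis using dline_point by blast
qed

context coaxial_spheres
begin

lemma mem_quadric_plane: "\<kappa> = 0 \<Longrightarrow> y \<in> quadric \<longleftrightarrow> (y - a) \<bullet> u = 0"
  unfolding quadric_def by simp

lemma quadric_plane: "\<kappa> = 0 \<Longrightarrow> quadric = {y. (y - a) \<bullet> u = 0}"
  unfolding quadric_def by simp

lemma gen_apex: "h = 0 \<Longrightarrow> gen \<sigma> v = dline a v"
  unfolding gen_def by simp

lemma infinite_V: "infinite V"
proof -
  obtain f where f: "norm f = 1" "u \<bullet> f = 0" by (rule unit_orthogonalE)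
  let ?g = "u \<times> f"
  have ff: "f \<bullet> f = 1" using f(1) by (simp add: norm_eq_1)
  have gg: "?g \<bullet> ?g = 1" using f(2) uu ff by (simp add: dot_cross)
  \<comment> \<open>A quarter of the circle \<open>V\<close> for \<open>x\<close> between 0 and 1;
    the component along \<open>f\<close> recovers \<open>x\<close>.\<close>
  define v where "v x = \<kappa> *\<^sub>R u + \<beta> *\<^sub>R (x *\<^sub>R f + sqrt (1 - x\<^sup>2) *\<^sub>R ?g)" for x
  have vf: "v x \<bullet> f = \<beta> * x" for x
    using f(2) ff by (simp add: v_def inner_add_left dot_cross_self)
  have vV: "v x \<in> V" if "x \<in> {0..1}" for x
  proof -
    have x: "0 \<le> 1 - x\<^sup>2" using that by (simp add: power_le_one)
    have "u \<bullet> v x = \<kappa>" using f(2) uu by (simp add: v_def inner_add_right dot_cross_self)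
    moreover have "v x \<bullet> v x = \<kappa>\<^sup>2 + \<beta>\<^sup>2 * (x\<^sup>2 + (sqrt (1 - x\<^sup>2))\<^sup>2)"
      using f(2) uu ff gg
      by (simp add: v_def inner_add_left inner_add_right dot_cross_self inner_commute[of f u] power2_eq_square algebra_simps)
    then have "v x \<bullet> v x = 1" using x by (simp add: \<beta>_sq)
    ultimately show ?thesis by (simp add: V_def norm_eq_1)
  qed
  have "inj v"
  proof (rule injI)
    fix x y assume "v x = v y"
    then have "\<beta> * x = \<beta> * y" using vf by metis
    then show "x = y" using \<beta>_pos by simp
  qed
  then have "infinite (v ` {0..1})"
    by (metis finite_imageD infinite_Icc inj_on_subset top_greatest zero_less_one)
  moreover have "v ` {0..1} \<subseteq> V" using vV by blast
  ultimately show ?thesis using finite_subset by blast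
qed

lemma infinite_nonparallel_generators:
  assumes "is_line l"
  shows "infinite (gen \<sigma> ` V - proper_parallels l)"
proof -
  obtain q e where e: "norm e = 1" "l = dline q e" using assms by (rule is_line_footE)
  have "gen \<sigma> ` (V - {e, - e}) \<subseteq> gen \<sigma> ` V - proper_parallels l"
  proof (intro subsetI DiffI notI)
    fix L assume "L \<in> gen \<sigma> ` (V - {e, - e})"
    then show "L \<in> gen \<sigma> ` V" by blast
  next
    fix L assume "L \<in> gen \<sigma> ` (V - {e, - e})" "L \<in> proper_parallels l"
    then obtain v where v: "v \<in> V" "v \<noteq> e" "v \<noteq> - e" and "gen \<sigma> v \<in> proper_parallels l" by blast
    then have "affine_parallel (dline q e) (gen \<sigma> v)" using e by (simp add: proper_parallels_def)
    then show False using v affine_parallel_dline[OF e(1) V_unit(1)[OF v(1)]] unfolding gen_def by auto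
  qed
  moreover have "infinite (gen \<sigma> ` (V - {e, - e}))"
    unfolding gen_def by (rule infinite_direction_family) (use infinite_V V_unit in auto)
  ultimately show ?thesis using finite_subset by blast
qed

lemma infinite_common_tangents: "is_line l \<Longrightarrow> infinite (common_tangents c r - proper_parallels l)"
proof -
  assume "is_line l"
  then have "infinite (gen 1 ` V - proper_parallels l)" by (rule infinite_nonparallel_generators)
  moreover have "gen 1 ` V \<subseteq> common_tangents c r" using gen_common_tangent by blast
  ultimately show ?thesis by (meson Diff_mono finite_subset order_refl)
qed

lemma line_in_quadric_common_tangent:
  "0 < \<kappa> \<Longrightarrow> is_line L \<Longrightarrow> L \<subseteq> quadric \<Longrightarrow> L \<in> common_tangents c r"
  using line_subset_quadric(2)[of L] infinite_line[of L] by (simp add: Int_absorb2)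

text \<open>For \<open>h = 0\<close> every common tangent passes through \<open>a\<close>, hence
  meets \<open>l\<close>. This serves the pencil and the cone alike.\<close>

lemma apex_family:
  assumes "h = 0" "a \<in> l" "is_line l"
  shows "infinite_family (common_tangents c r) (common_tangents_meeting l c r)"
proof -
  have "L \<inter> l \<noteq> {}" if L: "L \<in> common_tangents c r" for L
  proof -
    obtain \<sigma> v where "L = gen \<sigma> v" by (rule common_tangentE[OF L])
    then have "a \<in> L" unfolding gen_apex[OF assms(1)] by simp
    then show ?thesis using assms by auto
  qed
  then have "common_tangents_meeting l c r = common_tangents c r" by (auto simp: common_tangents_meeting_eq)
  moreover have "infinite (common_tangents c r)" using infinite_common_tangents[OF assms(3)] by auto
  ultimately show ?thesis by (simp add: infinite_family_def)
qed

text \<open>In a plane, failing to meet \<open>l\<close> is being a proper parallel. Leaving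
  \<open>h\<close> free covers both the pencil and the tangents of a circle.\<close>

lemma plane_family:
  assumes k: "\<kappa> = 0" and lq: "l \<subseteq> quadric" and l: "is_line l"
  shows "infinite_family (common_tangents c r - proper_parallels l) (common_tangents_meeting l c r)"
proof -
  obtain p e where e: "norm e = 1" "l = dline p e" using l by (rule is_line_footE)
  have plane: "(y - a) \<bullet> u = 0" if "y \<in> quadric" for y using that mem_quadric_plane[OF k] by simp
  have p: "(p - a) \<bullet> u = 0" using plane lq e dline_base by blast
  moreover have "(p + 1 *\<^sub>R e - a) \<bullet> u = 0" using plane lq e dline_point by blast
  ultimately have eu: "e \<bullet> u = 0" by (simp add: inner_diff_left inner_add_left)
  have "L \<inter> l \<noteq> {} \<longleftrightarrow> L \<notin> proper_parallels l" if L: "L \<in> common_tangents c r" for L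
  proof
    assume "L \<inter> l \<noteq> {}"
    then show "L \<notin> proper_parallels l" using meeting_not_proper_parallel l by blast
  next
    assume np: "L \<notin> proper_parallels l"
    have lineL: "is_line L" using L by (simp add: common_tangents_def)
    obtain \<sigma> v where v: "v \<in> V" "L = gen \<sigma> v" by (rule common_tangentE[OF L])
    then obtain q where q: "L = dline q v" unfolding gen_def by blast
    then have "q \<in> quadric" using common_tangent_subset_quadric[OF L] by auto
    then have "(p - q) \<bullet> u = 0" using plane[of q] p by (simp add: inner_diff_left)
    show "L \<inter> l \<noteq> {}"
    proof (cases "v = e \<or> v = - e")
      case True
      then have "affine_parallel l L" unfolding q e(2) using affine_parallel_dline[OF e(1) V_unit(1)[OF v(1)]] by auto
      then have "L = l" using np lineL by (simp add: proper_parallels_def)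
      then show ?thesis using is_line_nonempty[OF l] by simp
    next
      case False
      then show ?thesis unfolding q e(2)
        using coplanar_lines_meet[OF u V_unit(1)[OF v(1)] _ e(1) eu \<open>(p - q) \<bullet> u = 0\<close>] V_unit(4)[OF v(1)] k by auto
    qed
  qed
  then have "common_tangents_meeting l c r = common_tangents c r - proper_parallels l"
    by (auto simp: common_tangents_meeting_eq)
  then show ?thesis using infinite_common_tangents[OF l] by (simp add: infinite_family_def)
qed

lemma pencil_eq:
  assumes "\<kappa> = 0" "h = 0"
  shows "common_tangents c r = {L \<in> lines_in quadric. a \<in> L}"
proof (intro equalityI subsetI)
  fix L assume L: "L \<in> common_tangents c r"
  obtain \<sigma> v where "L = gen \<sigma> v" by (rule common_tangentE[OF L])
  then have "a \<in> L" unfolding gen_apex[OF assms(2)] by simp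
  then show "L \<in> {L \<in> lines_in quadric. a \<in> L}"
    using L common_tangent_subset_quadric[OF L] by (simp add: lines_in_def common_tangents_def)
next
  fix L assume "L \<in> {L \<in> lines_in quadric. a \<in> L}"
  then have L: "is_line L" "L \<subseteq> quadric" "a \<in> L" by (auto simp: lines_in_def)
  obtain v where v: "norm v = 1" "L = dline a v" using L by (auto elim: is_lineE)
  have "a + 1 *\<^sub>R v \<in> quadric" using L v dline_point by blast
  then have "v \<bullet> u = 0" unfolding mem_quadric_plane[OF assms(1)] by simp
  then show "L \<in> common_tangents c r" unfolding v(2)
    by (subst tangency_at_foot) (use v assms in \<open>auto simp: inner_commute\<close>)
qed

text \<open>For a line in the plane, touching the circle is touching the sphere about
  \<open>a\<close> of radius \<open>h\<close>, so the criterion for spheres applies.\<close>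

lemma circle_tangents_eq:
  assumes "\<kappa> = 0" "0 < h"
  shows "common_tangents c r = {L \<in> lines_in quadric. tangent_line L (sphere a h \<inter> quadric)}"
proof -
  have "L \<in> common_tangents c r \<longleftrightarrow> L \<in> lines_in quadric \<and> tangent_line L (sphere a h \<inter> quadric)"
    if L: "is_line L" for L
  proof (cases "L \<subseteq> quadric")
    case False
    then show ?thesis using common_tangent_subset_quadric by (auto simp: lines_in_def)
  next
    case True
    obtain p v where v: "norm v = 1" "L = dline p v" "(p - a) \<bullet> v = 0" using L by (rule is_line_footE)
    have "p \<in> quadric" "p + 1 *\<^sub>R v \<in> quadric" using True v dline_point dline_base by blast+
    then have "(p - a) \<bullet> u = 0" "(p + 1 *\<^sub>R v - a) \<bullet> u = 0" unfolding mem_quadric_plane[OF assms(1)] by blast+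
    moreover from this have "v \<bullet> u = 0" by (simp add: inner_diff_left inner_add_left)
    moreover have "L \<inter> (sphere a h \<inter> quadric) = L \<inter> sphere a h" using True by blast
    then have "tangent_line L (sphere a h \<inter> quadric) \<longleftrightarrow> tangent_line L (sphere a h)"
      by (simp add: tangent_line_def)
    ultimately show ?thesis
      using tangency_at_foot[OF v(1,3)] tangent_line_sphere_iff[OF v(1) assms(2), of p a] v True L assms
      by (simp add: lines_in_def inner_commute)
  qed
  then show ?thesis by (auto simp: lines_in_def common_tangents_def)
qed

lemma cone_ruling_eq: "0 < \<kappa> \<Longrightarrow> common_tangents c r = lines_in quadric"
  using line_in_quadric_common_tangent common_tangent_subset_quadric
  by (auto simp: lines_in_def common_tangents_def)

lemma is_plane_quadric: "\<kappa> = 0 \<Longrightarrow> is_plane quadric"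
proof -
  assume "\<kappa> = 0"
  then have "quadric = {y. u \<bullet> y = u \<bullet> a}" unfolding quadric_plane[OF \<open>\<kappa> = 0\<close>] by (auto simp: inner_diff_left inner_commute[of u])
  moreover have "u \<noteq> 0" using u by auto
  ultimately show ?thesis by (simp add: is_plane_def affine_hyperplane)
qed

text \<open>With \<open>\<kappa>\<close> and \<open>h\<close> zero the radius is the absolute value
  of \<open>d i\<close>, so each sphere passes through \<open>a\<close> with normal
  \<open>u\<close>.\<close>

lemma tangent_at_centre:
  assumes "\<kappa> = 0" "h = 0"
  shows "tangent_at c r a quadric"
  unfolding tangent_at_def
proof (intro allI conjI)
  fix i
  have "\<bar>d i\<bar> = r i" using radius[of i] assms r_pos[of i] by (metis abs_of_pos diff_zero mult_1 power2_abs power2_eq_iff_nonneg add_0_right abs_ge_zero less_imp_le zero_power2)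
  then show "a \<in> sphere (c i) (r i)" using u by (simp add: centre dist_norm)
  have "d i \<noteq> 0" using \<open>\<bar>d i\<bar> = r i\<close> r_pos[of i] by auto
  then show "tangent_plane (c i) a = quadric"
    unfolding quadric_plane[OF assms(1)] by (simp add: tangent_plane_def centre)
qed

text \<open>For \<open>h = 0\<close> the quadric is the squared equation of the cone with angle
  \<open>arccos \<kappa>\<close>, which is acute and positive because \<open>\<kappa>\<close> lies
  strictly between 0 and 1.\<close>

lemma inscribed_quadric:
  assumes "0 < \<kappa>" "h = 0"
  shows "inscribed_in_cone c r quadric a"
  unfolding inscribed_in_cone_def
proof
  have "quadric = {x. \<bar>(x - a) \<bullet> u\<bar> = cos (arccos \<kappa>) * norm (x - a)}"
  proof (intro set_eqI iffI)
    fix x assume "x \<in> quadric"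
    then have "(\<kappa> * norm (x - a))\<^sup>2 = ((x - a) \<bullet> u)\<^sup>2" unfolding quadric_def using assms by (simp add: power_mult_distrib)
    then have "\<bar>\<kappa> * norm (x - a)\<bar> = \<bar>(x - a) \<bullet> u\<bar>" by (simp only: power2_eq_iff abs_eq_iff)
    then show "x \<in> {x. \<bar>(x - a) \<bullet> u\<bar> = cos (arccos \<kappa>) * norm (x - a)}" using \<kappa> by (simp add: abs_mult)
  next
    fix x assume "x \<in> {x. \<bar>(x - a) \<bullet> u\<bar> = cos (arccos \<kappa>) * norm (x - a)}"
    then have "\<bar>(x - a) \<bullet> u\<bar>\<^sup>2 = (\<kappa> * norm (x - a))\<^sup>2" using \<kappa> by simp
    then show "x \<in> quadric" unfolding quadric_def using assms by (simp add: power_mult_distrib)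
  qed
  moreover have "0 < arccos \<kappa>" "arccos \<kappa> < pi / 2"
    using arccos_lt_bounded[of \<kappa>] arccos_less_arccos[of 0 \<kappa>] \<kappa> assms by auto
  ultimately show "circular_cone quadric a" unfolding circular_cone_def using u by blast
  show "\<forall>L\<in>lines_in quadric. \<forall>i. tangent_line L (sphere (c i) (r i))"
    using cone_ruling_eq[OF assms(1)] by (auto simp: common_tangents_def)
qed

text \<open>The equations of the spheres differ only in the term linear in \<open>d i\<close>; a
  point satisfying all three therefore satisfies the equations of the plane and of the sphere about
  \<open>a\<close> separately.\<close>

lemma meet_in_circle_quadric:
  assumes "\<kappa> = 0" "0 < h"
  shows "meet_in_circle c r (sphere a h \<inter> quadric) quadric"
  unfolding meet_in_circle_def circle_in_plane_def
proof (intro conjI)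
  show "is_plane quadric" using assms(1) by (rule is_plane_quadric)
  have "a \<in> quadric" unfolding mem_quadric_plane[OF assms(1)] by simp
  then show "\<exists>z\<in>quadric. \<exists>\<rho>>0. sphere a h \<inter> quadric = sphere z \<rho> \<inter> quadric" using assms by blast
  have on: "y \<in> sphere (c i) (r i) \<longleftrightarrow> (norm (y - a))\<^sup>2 - 2 * d i * ((y - a) \<bullet> u) = h\<^sup>2" for y i
  proof -
    define x where "x = y - a"
    have yc: "y - c i = x - d i *\<^sub>R u" by (simp add: x_def centre)
    have "y \<in> sphere (c i) (r i) \<longleftrightarrow> (norm (y - c i))\<^sup>2 = (r i)\<^sup>2"
      using r_pos[of i] by (simp add: dist_norm norm_minus_commute)
    also have "(norm (y - c i))\<^sup>2 = (norm x)\<^sup>2 - 2 * d i * (x \<bullet> u) + (d i)\<^sup>2"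
      unfolding yc power2_norm_eq_inner using uu
      by (simp add: inner_diff_left inner_diff_right inner_commute[of u x] power2_eq_square right_diff_distrib)
    finally show ?thesis using assms by (simp add: radius x_def)
  qed
  show "(\<Inter>i. sphere (c i) (r i)) = sphere a h \<inter> quadric"
  proof (intro equalityI subsetI)
    fix y assume "y \<in> (\<Inter>i. sphere (c i) (r i))"
    then have "0 * (d i)\<^sup>2 + (- 2 * ((y - a) \<bullet> u)) * d i + ((norm (y - a))\<^sup>2 - h\<^sup>2) = 0" for i
      using on[of y i] by (simp add: algebra_simps)
    from quadratic_three_parameters[OF inj_d this] have "(y - a) \<bullet> u = 0" "(norm (y - a))\<^sup>2 = h\<^sup>2" by auto
    then show "y \<in> sphere a h \<inter> quadric" using h unfolding Int_iff mem_quadric_plane[OF assms(1)]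
      by (simp add: dist_norm norm_minus_commute)
  next
    fix y assume "y \<in> sphere a h \<inter> quadric"
    then have "(y - a) \<bullet> u = 0" "norm (y - a) = h" unfolding Int_iff mem_quadric_plane[OF assms(1)]
      by (simp_all add: dist_norm norm_minus_commute)
    then show "y \<in> (\<Inter>i. sphere (c i) (r i))" using on by simp
  qed
qed

end

section \<open>From the geometric cases back to the normal form\<close>

lemma normal_direction:
  fixes w u :: "'a::real_inner"
  assumes "norm u = 1" "\<And>f. norm f = 1 \<Longrightarrow> u \<bullet> f = 0 \<Longrightarrow> w \<bullet> f = 0"
  shows "w = (w \<bullet> u) *\<^sub>R u"
proof (rule ccontr)
  define y where "y = w - (w \<bullet> u) *\<^sub>R u"
  assume "w \<noteq> (w \<bullet> u) *\<^sub>R u"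
  then have y: "y \<noteq> 0" by (simp add: y_def)
  have uy: "u \<bullet> y = 0" using assms(1) by (simp add: y_def inner_diff_right norm_eq_1 inner_commute)
  then have "w \<bullet> ((1 / norm y) *\<^sub>R y) = 0" using y by (intro assms(2)) auto
  then have "w \<bullet> y = 0" using y by simp
  moreover have "y \<bullet> y = w \<bullet> y - (w \<bullet> u) * (u \<bullet> y)" by (subst (1) y_def) (simp add: inner_diff_left)
  ultimately show False using uy y by simp
qed

lemma is_planeE:
  assumes "is_plane P" "z \<in> P"
  obtains u where "norm u = 1" "P = {y. (y - z) \<bullet> u = 0}"
proof -
  have P: "affine P" "aff_dim P = 2" using assms(1) by (auto simp: is_plane_def)
  then have "aff_dim P = int (DIM(real^3) - 1)" by simp
  then have "\<exists>n b. n \<noteq> 0 \<and> affine hull P = {x. n \<bullet> x = b}" by (simp only: aff_dim_eq_hyperplane)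
  moreover have "affine hull P = P" using P(1) by (simp only: affine_hull_eq)
  ultimately obtain n b where n: "n \<noteq> 0" and P2: "P = {x. n \<bullet> x = b}" by (simp only:) (elim exE conjE)
  then have "b = n \<bullet> z" using assms(2) by simp
  then have "P = {y. (y - z) \<bullet> ((1 / norm n) *\<^sub>R n) = 0}"
    unfolding P2 using n by (auto simp: inner_diff_left inner_commute[of n])
  then show ?thesis using that[of "(1 / norm n) *\<^sub>R n"] n by simp
qed

text \<open>All the vectors \<open>p - c i\<close> are normal to the same plane, so the centres lie
  on its normal at \<open>p\<close>, at signed distances of absolute value
  \<open>r i\<close>.\<close>

lemma tangent_at_imp_coaxial:
  assumes "tangent_at c r p P" and r: "\<And>i. 0 < r i" and inj: "inj (\<lambda>i. sphere (c i) (r i))"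
  obtains u d where "coaxial_spheres c r p u d 0 0" "P = {y. (y - p) \<bullet> u = 0}"
proof -
  have on: "norm (p - c i) = r i" and P: "P = {x. (x - p) \<bullet> (p - c i) = 0}" for i
    using assms(1) by (auto simp: tangent_at_def tangent_plane_def dist_norm norm_minus_commute)
  define u where "u = (1 / r 1) *\<^sub>R (p - c 1)"
  have u: "norm u = 1" using r[of 1] by (simp add: u_def on)
  have Pu: "P = {y. (y - p) \<bullet> u = 0}" unfolding P[of 1] u_def using r[of 1] by simp
  define d where "d i = - ((p - c i) \<bullet> u)" for i
  have dir: "p - c i = ((p - c i) \<bullet> u) *\<^sub>R u" for i
  proof (rule normal_direction[OF u])
    fix f :: "real^3" assume "u \<bullet> f = 0"
    then have "p + f \<in> P" by (simp add: Pu inner_commute)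
    then show "(p - c i) \<bullet> f = 0" unfolding P[of i] by (simp add: inner_commute)
  qed
  have ci: "c i = p + d i *\<^sub>R u" for i using dir[of i] by (simp add: d_def algebra_simps)
  have "\<bar>d i\<bar> = r i" for i using on[of i] u unfolding ci by simp
  then have "(r i)\<^sup>2 = (d i)\<^sup>2" for i by (metis power2_abs)
  then have "coaxial_spheres c r p u d 0 0"
    by unfold_locales (use u ci r inj in auto)
  then show ?thesis using that Pu by blast
qed

text \<open>The axis of the cone must be shown to contain the centres: tangency makes the squared
  scalar product of \<open>c i - a\<close> with the generator direction constant around the cone,
  which excludes an off-axis component.\<close>

lemma inscribed_imp_coaxial:
  assumes K: "inscribed_in_cone c r K a" and r: "\<And>i. 0 < r i" and inj: "inj (\<lambda>i. sphere (c i) (r i))"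
  obtains u d \<kappa> where "coaxial_spheres c r a u d \<kappa> 0" "0 < \<kappa>"
    "K = {y. \<kappa>\<^sup>2 * ((norm (y - a))\<^sup>2 - 0\<^sup>2) = ((y - a) \<bullet> u)\<^sup>2}"
proof -
  obtain u \<theta> where u: "norm u = 1" and \<theta>: "0 < \<theta>" "\<theta> < pi / 2"
    and Kdef: "K = {x. \<bar>(x - a) \<bullet> u\<bar> = cos \<theta> * norm (x - a)}"
    using K by (auto simp: inscribed_in_cone_def circular_cone_def)
  define \<kappa> \<beta> where "\<kappa> = cos \<theta>" and "\<beta> = sin \<theta>"
  have \<kappa>: "0 < \<kappa>" "\<kappa> < 1" using \<theta> cos_monotone_0_pi[of 0 \<theta>] by (auto simp: \<kappa>_def cos_gt_zero)
  have \<beta>: "0 < \<beta>" "\<kappa>\<^sup>2 + \<beta>\<^sup>2 = 1" using \<theta> by (auto simp: \<kappa>_def \<beta>_def sin_gt_zero)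
  have uu: "u \<bullet> u = 1" using u by (simp add: norm_eq_1)
  have gen: "(norm (c i - a))\<^sup>2 - ((c i - a) \<bullet> v)\<^sup>2 = (r i)\<^sup>2" if v: "norm v = 1" "u \<bullet> v = \<kappa>" for v i
  proof -
    have "dline a v \<subseteq> K" using v \<kappa> by (auto simp: Kdef mem_dline abs_mult \<kappa>_def inner_commute[of v])
    moreover have "is_line (dline a v)" using v by (intro is_line_dline) auto
    ultimately have "tangent_line (dline a v) (sphere (c i) (r i))"
      using K by (simp add: inscribed_in_cone_def lines_in_def)
    then have "(norm (a - c i))\<^sup>2 - ((a - c i) \<bullet> v)\<^sup>2 = (r i)\<^sup>2" using tangent_line_sphere_iff v(1) r by blast
    moreover have "(a - c i) \<bullet> v = - ((c i - a) \<bullet> v)" by (simp add: inner_diff_left)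
    ultimately show ?thesis by (simp add: norm_minus_commute)
  qed
  have circle: "norm (\<kappa> *\<^sub>R u + \<beta> *\<^sub>R f) = 1 \<and> u \<bullet> (\<kappa> *\<^sub>R u + \<beta> *\<^sub>R f) = \<kappa>" if "norm f = 1" "u \<bullet> f = 0" for f
    using that uu \<beta>(2)
    by (simp add: norm_eq_1 inner_add_left inner_add_right inner_commute[of f u] power2_eq_square)
  have axis: "c i - a = ((c i - a) \<bullet> u) *\<^sub>R u" for i
  proof (rule ccontr)
    define w where "w = c i - a"
    define y where "y = w - (w \<bullet> u) *\<^sub>R u"
    assume "c i - a \<noteq> ((c i - a) \<bullet> u) *\<^sub>R u"
    then have y: "y \<noteq> 0" by (simp add: y_def w_def)
    have uy: "u \<bullet> y = 0" using uu by (simp add: y_def inner_diff_right inner_commute)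
    define f where "f = (1 / norm y) *\<^sub>R y"
    have f: "norm f = 1" "u \<bullet> f = 0" using y uy by (simp_all add: f_def)
    have wf: "w = (w \<bullet> u) *\<^sub>R u + norm y *\<^sub>R f" using y by (simp add: f_def y_def)
    have g: "norm (u \<times> f) = 1" "u \<bullet> (u \<times> f) = 0"
      using f uu norm_cross[of u f] u by (simp_all add: dot_cross_self norm_eq_1 dot_cross)
    have fm: "norm (- f) = 1" "u \<bullet> (- f) = 0" using f by simp_all
    have val: "w \<bullet> (\<kappa> *\<^sub>R u + \<beta> *\<^sub>R x) = \<kappa> * (w \<bullet> u) + \<beta> * (norm y * (f \<bullet> x))" if "u \<bullet> x = 0" for x
      by (subst (1) wf) (simp add: inner_add_left inner_add_right uu that inner_commute[of f u] f(2))
    have sq: "(w \<bullet> (\<kappa> *\<^sub>R u + \<beta> *\<^sub>R x))\<^sup>2 = (norm w)\<^sup>2 - (r i)\<^sup>2" if "norm x = 1" "u \<bullet> x = 0" for x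
      using gen[of "\<kappa> *\<^sub>R u + \<beta> *\<^sub>R x" i] circle[OF that] by (simp add: w_def)
    have ff: "f \<bullet> f = 1" using f by (simp add: norm_eq_1)
    \<comment> \<open>Generators over \<open>f\<close>, \<open>- f\<close> and the orthogonal
      direction \<open>u \<times> f\<close> give equal squares of A + B, A - B and A, whence B =
      0.\<close>
    have "(\<kappa> * (w \<bullet> u) + \<beta> * norm y)\<^sup>2 = (norm w)\<^sup>2 - (r i)\<^sup>2"
      "(\<kappa> * (w \<bullet> u) - \<beta> * norm y)\<^sup>2 = (norm w)\<^sup>2 - (r i)\<^sup>2"
      "(\<kappa> * (w \<bullet> u))\<^sup>2 = (norm w)\<^sup>2 - (r i)\<^sup>2"
      using sq[OF f] sq[OF fm] sq[OF g] val[OF f(2)] val[OF fm(2)] val[OF g(2)] ff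
      by (simp_all add: dot_cross_self)
    moreover have "(\<kappa> * (w \<bullet> u) + \<beta> * norm y)\<^sup>2 + (\<kappa> * (w \<bullet> u) - \<beta> * norm y)\<^sup>2
      = 2 * (\<kappa> * (w \<bullet> u))\<^sup>2 + 2 * (\<beta> * norm y)\<^sup>2" by (simp add: power2_eq_square algebra_simps)
    ultimately have "2 * (\<beta> * norm y)\<^sup>2 = 0" by linarith
    then show False using \<beta>(1) y by simp
  qed
  define d where "d i = (c i - a) \<bullet> u" for i
  have ci: "c i = a + d i *\<^sub>R u" for i using axis[of i] by (simp add: d_def algebra_simps)
  obtain f where f: "norm f = 1" "u \<bullet> f = 0" by (rule unit_orthogonalE)
  define v where "v = \<kappa> *\<^sub>R u + \<beta> *\<^sub>R f"
  have v: "norm v = 1" "u \<bullet> v = \<kappa>" using circle[OF f] by (simp_all add: v_def)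
  have ri: "(r i)\<^sup>2 = (1 - \<kappa>\<^sup>2) * (d i)\<^sup>2" for i
    using gen[OF v, of i] u v(2) unfolding ci by (simp add: power_mult_distrib algebra_simps)
  have "coaxial_spheres c r a u d \<kappa> 0"
    by unfold_locales (use u ci ri \<kappa> r inj in auto)
  moreover have "K = {y. \<kappa>\<^sup>2 * ((norm (y - a))\<^sup>2 - 0\<^sup>2) = ((y - a) \<bullet> u)\<^sup>2}"
  proof (intro set_eqI)
    fix x
    have "x \<in> K \<longleftrightarrow> \<bar>(x - a) \<bullet> u\<bar> = \<bar>\<kappa> * norm (x - a)\<bar>" using \<kappa> by (simp add: Kdef \<kappa>_def abs_mult)
    also have "\<dots> \<longleftrightarrow> ((x - a) \<bullet> u)\<^sup>2 = (\<kappa> * norm (x - a))\<^sup>2" by (simp only: power2_eq_iff abs_eq_iff)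
    finally show "x \<in> K \<longleftrightarrow> x \<in> {y. \<kappa>\<^sup>2 * ((norm (y - a))\<^sup>2 - 0\<^sup>2) = ((y - a) \<bullet> u)\<^sup>2}"
      by (auto simp: power_mult_distrib)
  qed
  ultimately show ?thesis using that \<kappa> by blast
qed

text \<open>Opposite points of the circle are equidistant from each centre, so
  \<open>c i - z\<close> is orthogonal to every direction in the plane.\<close>

lemma meet_in_circle_imp_coaxial:
  assumes C: "meet_in_circle c r C P" and r: "\<And>i. 0 < r i" and inj: "inj (\<lambda>i. sphere (c i) (r i))"
  obtains z u d \<rho> where "coaxial_spheres c r z u d 0 \<rho>" "0 < \<rho>" "P = {y. (y - z) \<bullet> u = 0}" "C = sphere z \<rho> \<inter> P"
proof -
  obtain z \<rho> where z: "z \<in> P" and \<rho>: "0 < \<rho>" and Cdef: "C = sphere z \<rho> \<inter> P" and plane: "is_plane P"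
    using C by (auto simp: meet_in_circle_def circle_in_plane_def)
  have meet: "C \<subseteq> sphere (c i) (r i)" for i using C by (auto simp: meet_in_circle_def)
  obtain u where u: "norm u = 1" and P: "P = {y. (y - z) \<bullet> u = 0}" using plane z by (rule is_planeE)
  have on: "\<rho>\<^sup>2 - 2 * \<rho> * ((c i - z) \<bullet> f) + (norm (c i - z))\<^sup>2 = (r i)\<^sup>2" if f: "norm f = 1" "u \<bullet> f = 0" for f i
  proof -
    define w where "w = c i - z"
    have "z + \<rho> *\<^sub>R f \<in> C" using f \<rho> by (simp add: Cdef P dist_norm inner_commute)
    then have "z + \<rho> *\<^sub>R f \<in> sphere (c i) (r i)" using meet by blast
    then have "norm (\<rho> *\<^sub>R f - w) = r i" by (simp add: w_def dist_norm norm_minus_commute algebra_simps)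
    then have "(norm (\<rho> *\<^sub>R f - w))\<^sup>2 = (r i)\<^sup>2" by simp
    moreover have "f \<bullet> f = 1" using f by (simp add: norm_eq_1)
    ultimately show ?thesis unfolding w_def[symmetric] power2_norm_eq_inner
      by (simp add: inner_diff_left inner_diff_right inner_commute[of f w] power2_eq_square algebra_simps)
  qed
  define d where "d i = (c i - z) \<bullet> u" for i
  have dir: "c i - z = ((c i - z) \<bullet> u) *\<^sub>R u" for i
  proof (rule normal_direction[OF u])
    fix f :: "real^3" assume f: "norm f = 1" "u \<bullet> f = 0"
    then have "\<rho>\<^sup>2 + 2 * \<rho> * ((c i - z) \<bullet> f) + (norm (c i - z))\<^sup>2 = (r i)\<^sup>2" using on[of "- f" i] by simp
    then have "\<rho> * ((c i - z) \<bullet> f) = 0" using on[OF f, of i] by linarith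
    then show "(c i - z) \<bullet> f = 0" using \<rho> by simp
  qed
  have ci: "c i = z + d i *\<^sub>R u" for i using dir[of i] by (simp add: d_def algebra_simps)
  obtain f where f: "norm f = 1" "u \<bullet> f = 0" by (rule unit_orthogonalE)
  have ri: "(r i)\<^sup>2 = (d i)\<^sup>2 + \<rho>\<^sup>2" for i using on[OF f, of i] f u unfolding ci by simp
  have "coaxial_spheres c r z u d 0 \<rho>"
    by unfold_locales (use u ci ri \<rho> r inj in auto)
  then show ?thesis using that \<rho> P Cdef by blast
qed

subsection \<open>Hyperboloids and rotations\<close>

text \<open>The polarization of the equation of the hyperboloid, needed for the linear term along a
  line.\<close>

definition hyperboloid_form :: "real^3 \<Rightarrow> real \<Rightarrow> real \<Rightarrow> real^3 \<Rightarrow> real^3 \<Rightarrow> real"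
  where "hyperboloid_form u a b x y = (x \<bullet> y - (x \<bullet> u) * (y \<bullet> u)) / a\<^sup>2 - (x \<bullet> u) * (y \<bullet> u) / b\<^sup>2"

lemma hyperboloidE:
  assumes "hyperboloid_of_revolution H"
  obtains z u a b where "norm u = 1" "0 < a" "0 < b" "H = {x. hyperboloid_form u a b (x - z) (x - z) = 1}"
proof -
  obtain z u a b where u: "norm u = 1" "0 < a" "0 < b"
    and H: "H = {x. ((norm (x - z))\<^sup>2 - ((x - z) \<bullet> u)\<^sup>2) / a\<^sup>2 - ((x - z) \<bullet> u)\<^sup>2 / b\<^sup>2 = 1}"
    using assms unfolding hyperboloid_of_revolution_def by (elim exE conjE)
  have "H = {x. hyperboloid_form u a b (x - z) (x - z) = 1}"
    unfolding H hyperboloid_form_def power2_norm_eq_inner power2_eq_square[of "_ \<bullet> _"] ..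
  then show ?thesis using that u by blast
qed

lemma hyperboloid_form_line:
  "hyperboloid_form u a b (x + t *\<^sub>R y) (x + t *\<^sub>R y) = hyperboloid_form u a b y y * t\<^sup>2
    + 2 * hyperboloid_form u a b x y * t + hyperboloid_form u a b x x"
  unfolding hyperboloid_form_def
  by (simp add: inner_add_left inner_add_right inner_commute[of y x] power2_eq_square
      add_divide_distrib diff_divide_distrib algebra_simps)

text \<open>In suitable axes the form is diagonal with nonzero entries; \<open>W\<close> is the
  image of \<open>w\<close> under this invertible map.\<close>

lemma hyperboloid_form_nondegenerate:
  assumes "norm u = 1" "0 < a" "0 < b" "w \<noteq> 0"
  obtains W where "W \<noteq> 0" "\<And>x. hyperboloid_form u a b x w = W \<bullet> x"
proof -
  define W where "W = (1 / a\<^sup>2) *\<^sub>R (w - (w \<bullet> u) *\<^sub>R u) - ((w \<bullet> u) / b\<^sup>2) *\<^sub>R u"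
  have uu: "u \<bullet> u = 1" using assms(1) by (simp add: norm_eq_1)
  have "W \<noteq> 0"
  proof
    assume W: "W = 0"
    have "W \<bullet> u = - ((w \<bullet> u) / b\<^sup>2)" using uu by (simp add: W_def inner_diff_left)
    then have "w \<bullet> u = 0" using W assms(3) by simp
    then show False using W assms(2,4) by (simp add: W_def)
  qed
  moreover have "hyperboloid_form u a b x w = W \<bullet> x" for x
    unfolding hyperboloid_form_def W_def
    by (simp add: inner_diff_left inner_diff_right inner_commute[of x] diff_divide_distrib mult.commute)
  ultimately show ?thesis using that by blast
qed

lemma hyperboloid_not_planar:
  assumes H: "hyperboloid_of_revolution H" and plane: "\<And>y. y \<in> H \<Longrightarrow> W \<bullet> y = k"
  shows "W = 0"
proof -
  obtain z u a b where u: "norm u = 1" and ab: "0 < a" "0 < b"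
    and Hdef: "H = {x. hyperboloid_form u a b (x - z) (x - z) = 1}" using H by (rule hyperboloidE)
  have uu: "u \<bullet> u = 1" using u by (simp add: norm_eq_1)
  have on: "z + (s *\<^sub>R f + t *\<^sub>R u) \<in> H \<longleftrightarrow> s\<^sup>2 / a\<^sup>2 - t\<^sup>2 / b\<^sup>2 = 1" if "norm f = 1" "u \<bullet> f = 0" for s t f
  proof -
    have "f \<bullet> f = 1" "f \<bullet> u = 0" using that by (simp_all add: norm_eq_1 inner_commute)
    then show ?thesis using uu that
      by (simp add: Hdef hyperboloid_form_def inner_add_left inner_add_right power2_eq_square)
  qed
  have "W = (W \<bullet> u) *\<^sub>R u"
  proof (rule normal_direction[OF u])
    fix f :: "real^3" assume f: "norm f = 1" "u \<bullet> f = 0"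
    have "z + (a *\<^sub>R f + 0 *\<^sub>R u) \<in> H" "z + ((- a) *\<^sub>R f + 0 *\<^sub>R u) \<in> H"
      unfolding on[OF f] using ab by simp_all
    then have "W \<bullet> (z + (a *\<^sub>R f + 0 *\<^sub>R u)) = W \<bullet> (z + ((- a) *\<^sub>R f + 0 *\<^sub>R u))" using plane by metis
    then show "W \<bullet> f = 0" using ab by (simp add: inner_add_right inner_diff_right)
  qed
  moreover have "W \<bullet> u = 0"
  proof -
    obtain f where f: "norm f = 1" "u \<bullet> f = 0" by (rule unit_orthogonalE)
    \<comment> \<open>Points off the waist circle, as 2 - 1 = 1; their difference is along the
      axis.\<close>
    have "z + ((sqrt 2 * a) *\<^sub>R f + b *\<^sub>R u) \<in> H" "z + ((sqrt 2 * a) *\<^sub>R f + (- b) *\<^sub>R u) \<in> H"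
      unfolding on[OF f] using ab by (simp_all add: power_mult_distrib)
    then have "W \<bullet> (z + ((sqrt 2 * a) *\<^sub>R f + b *\<^sub>R u)) = W \<bullet> (z + ((sqrt 2 * a) *\<^sub>R f + (- b) *\<^sub>R u))"
      using plane by metis
    then show ?thesis using ab by (simp add: inner_add_right inner_diff_right)
  qed
  ultimately show ?thesis by simp
qed

text \<open>Invariance under translation by multiples of \<open>w\<close> kills the linear term
  along every such line, so the hyperboloid would lie in a plane.\<close>

lemma hyperboloid_not_cylindrical:
  assumes H: "hyperboloid_of_revolution H" and inv: "\<And>y t. y \<in> H \<Longrightarrow> y + t *\<^sub>R w \<in> H"
  shows "w = 0"
proof (rule ccontr)
  assume w: "w \<noteq> 0"
  obtain z u a b where u: "norm u = 1" and ab: "0 < a" "0 < b"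
    and Hdef: "H = {x. hyperboloid_form u a b (x - z) (x - z) = 1}" using H by (rule hyperboloidE)
  obtain W where W: "W \<noteq> 0" "\<And>x. hyperboloid_form u a b x w = W \<bullet> x"
    using hyperboloid_form_nondegenerate[OF u ab w] by metis
  have "W \<bullet> y = W \<bullet> z" if "y \<in> H" for y
  proof -
    have "hyperboloid_form u a b w w * t\<^sup>2 + 2 * hyperboloid_form u a b (y - z) w * t
      + (hyperboloid_form u a b (y - z) (y - z) - 1) = 0" for t
    proof -
      have eq: "y + t *\<^sub>R w - z = (y - z) + t *\<^sub>R w" by simp
      have "hyperboloid_form u a b (y + t *\<^sub>R w - z) (y + t *\<^sub>R w - z) = 1"
        using inv[OF that, of t] unfolding Hdef by blast
      then show ?thesis unfolding eq hyperboloid_form_line by simp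
    qed
    from quadratic_three_roots[OF this[of 0] this[of 1] this[of "-1"]]
    have "hyperboloid_form u a b (y - z) w = 0" by simp
    then show ?thesis unfolding W by (simp add: inner_diff_right)
  qed
  then show False using hyperboloid_not_planar[OF H] W(1) by blast
qed

text \<open>The parameter 0 puts \<open>p\<close> itself on the hyperboloid, so \<open>p\<close> is
  not its centre; the vanishing linear terms then confine the whole surface to its tangent plane at
  \<open>p\<close>.\<close>

lemma hyperboloid_not_conical:
  assumes H: "hyperboloid_of_revolution H" and inv: "\<And>y t. y \<in> H \<Longrightarrow> p + t *\<^sub>R (y - p) \<in> H"
  shows False
proof -
  obtain z u a b where u: "norm u = 1" and ab: "0 < a" "0 < b"
    and Hdef: "H = {x. hyperboloid_form u a b (x - z) (x - z) = 1}" using H by (rule hyperboloidE)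
  obtain y0 where "y0 \<in> H" using hyperboloid_not_planar[OF H, of u 0] u by fastforce
  then have "p \<in> H" using inv[of y0 0] by simp
  then have w: "p - z \<noteq> 0" by (auto simp: Hdef hyperboloid_form_def)
  obtain W where W: "W \<noteq> 0" "\<And>x. hyperboloid_form u a b x (p - z) = W \<bullet> x"
    using hyperboloid_form_nondegenerate[OF u ab w] by metis
  have sym: "hyperboloid_form u a b x y = hyperboloid_form u a b y x" for x y
    by (simp add: hyperboloid_form_def inner_commute mult.commute)
  have "W \<bullet> y = W \<bullet> p" if "y \<in> H" for y
  proof -
    have "hyperboloid_form u a b (y - p) (y - p) * t\<^sup>2 + 2 * hyperboloid_form u a b (p - z) (y - p) * t
      + (hyperboloid_form u a b (p - z) (p - z) - 1) = 0" for t
    proof -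
      have eq: "p + t *\<^sub>R (y - p) - z = (p - z) + t *\<^sub>R (y - p)" by simp
      have "hyperboloid_form u a b (p + t *\<^sub>R (y - p) - z) (p + t *\<^sub>R (y - p) - z) = 1"
        using inv[OF that, of t] unfolding Hdef by blast
      then show ?thesis unfolding eq hyperboloid_form_line by simp
    qed
    from quadratic_three_roots[OF this[of 0] this[of 1] this[of "-1"]]
    have "hyperboloid_form u a b (p - z) (y - p) = 0" by simp
    then show ?thesis using W(2)[of "y - p"] sym by (simp add: inner_diff_right)
  qed
  then show False using hyperboloid_not_planar[OF H] W(1) by blast
qed

lemma rotation_aboutE:
  assumes f: "rotation_about (dline a u) f"
  obtains Q where "rotation_matrix Q" "Q *v u = u" "\<And>z. f (a + z) = a + Q *v z"
proof -
  obtain Q b where Q: "rotation_matrix Q" "f = (\<lambda>x. Q *v x + b)" and fix_pts: "\<And>x. x \<in> dline a u \<Longrightarrow> f x = x"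
    using f unfolding rotation_about_def by blast
  have fa: "f a = a" and fau: "f (a + 1 *\<^sub>R u) = a + 1 *\<^sub>R u" using fix_pts dline_base dline_point by blast+
  have 1: "f (a + z) = a + Q *v z" for z
    using fa unfolding Q(2) by (simp add: matrix_vector_right_distrib algebra_simps)
  then have "Q *v u = u" using fau by simp
  then show ?thesis using that Q(1) 1 by blast
qed

lemma rotation_matrix_inner:
  assumes "rotation_matrix Q"
  shows "(Q *v x) \<bullet> (Q *v y) = x \<bullet> (y :: real^3)"
proof -
  have "orthogonal_transformation ((*v) Q)"
    using assms by (simp add: rotation_matrix_def orthogonal_transformation_matrix)
  then show ?thesis by (simp add: orthogonal_transformation_def)
qed

lemma orthogonal_frame:
  fixes u w z :: "real^3"
  assumes u: "norm u = 1" and w: "w \<bullet> u = 0" "w \<noteq> 0"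
  shows "(w \<bullet> w) *\<^sub>R z = ((w \<bullet> w) * (z \<bullet> u)) *\<^sub>R u + (z \<bullet> w) *\<^sub>R w + (z \<bullet> (u \<times> w)) *\<^sub>R (u \<times> w)"
proof -
  define x where "x = (w \<bullet> w) *\<^sub>R z - (((w \<bullet> w) * (z \<bullet> u)) *\<^sub>R u + (z \<bullet> w) *\<^sub>R w + (z \<bullet> (u \<times> w)) *\<^sub>R (u \<times> w))"
  have uu: "u \<bullet> u = 1" using u by (simp add: norm_eq_1)
  have cc: "(u \<times> w) \<bullet> (u \<times> w) = w \<bullet> w" using uu w(1) by (simp add: dot_cross)
  have xu: "u \<bullet> x = 0" "w \<bullet> x = 0" "(u \<times> w) \<bullet> x = 0"
    using uu w(1) cc by (simp_all add: x_def inner_diff_right inner_add_right dot_cross_self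
        inner_commute[of u w] inner_commute[of _ z])
  have "u \<times> w \<noteq> 0" using cc w(2) by auto
  then have "x = 0" using norm_and_cross_eq_0[of "u \<times> w" x] xu by (simp add: cross_cross_left)
  then show ?thesis by (simp add: x_def)
qed

text \<open>The frame \<open>u\<close>, \<open>w\<close>, \<open>u \<times> w\<close> is mapped to
  \<open>u\<close>, \<open>w'\<close>, \<open>u \<times> w'\<close>; Parseval's identity makes the
  map an isometry.\<close>

lemma rotation_exists_fixing:
  fixes u w w' :: "real^3"
  assumes u: "norm u = 1" and w: "w \<bullet> u = 0" "w \<noteq> 0" and w': "w' \<bullet> u = 0" and nw: "norm w' = norm w"
  obtains Q where "rotation_matrix Q" "Q *v u = u" "Q *v w = w'"
proof -
  define n where "n = w \<bullet> w"
  have n: "n \<noteq> 0" "w \<bullet> w = n" "w' \<bullet> w' = n" using w(2) nw by (simp_all add: n_def flip: power2_norm_eq_inner)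
  have uu: "u \<bullet> u = 1" using u by (simp add: norm_eq_1)
  have cc: "(u \<times> w) \<bullet> (u \<times> w) = n" "(u \<times> w') \<bullet> (u \<times> w') = n" using uu w(1) w' n by (simp_all add: dot_cross)
  define f where "f z = (z \<bullet> u) *\<^sub>R u + ((z \<bullet> w) / n) *\<^sub>R w' + ((z \<bullet> (u \<times> w)) / n) *\<^sub>R (u \<times> w')" for z
  have lin: "linear f"
    by (rule linearI) (simp_all add: f_def inner_add_left add_divide_distrib algebra_simps)
  have parseval: "n * (z \<bullet> y) = n * (z \<bullet> u) * (y \<bullet> u) + (z \<bullet> w) * (y \<bullet> w) + (z \<bullet> (u \<times> w)) * (y \<bullet> (u \<times> w))" for z y
    using arg_cong[OF orthogonal_frame[OF u w, of z], of "\<lambda>x. x \<bullet> y"] n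
    by (simp add: inner_add_left inner_add_right inner_commute[of _ y])
  have "f z \<bullet> f y = z \<bullet> y" for z y
  proof -
    have "f z \<bullet> f y = (z \<bullet> u) * (y \<bullet> u) + ((z \<bullet> w) / n) * ((y \<bullet> w) / n) * n + ((z \<bullet> (u \<times> w)) / n) * ((y \<bullet> (u \<times> w)) / n) * n"
      unfolding f_def using uu w' n cc
      by (simp add: inner_add_left inner_add_right dot_cross_self inner_commute[of u w'] mult.commute)
    then have "n * (f z \<bullet> f y) = n * (z \<bullet> u) * (y \<bullet> u) + (z \<bullet> w) * (y \<bullet> w) + (z \<bullet> (u \<times> w)) * (y \<bullet> (u \<times> w))"
      using n(1) by (simp add: distrib_left)
    also have "\<dots> = n * (z \<bullet> y)" by (rule parseval[symmetric])
    finally show ?thesis using n(1) by simp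
  qed
  then have orth: "orthogonal_transformation f" using lin by (simp add: orthogonal_transformation_def)
  have fu: "f u = u" "f w = w'" "f (u \<times> w) = u \<times> w'"
    using uu w(1) n cc by (simp_all add: f_def dot_cross_self inner_commute[of u w])
  \<comment> \<open>An isometry commutes with the cross product up to its determinant, which is
    therefore 1.\<close>
  have "u \<times> w' = det (matrix f) *\<^sub>R (u \<times> w')"
    using cross_orthogonal_transformation[OF orth, of u w] unfolding fu .
  moreover have "u \<times> w' \<noteq> 0" using cc n(1) by auto
  ultimately have "det (matrix f) = 1" by (metis scaleR_cancel_right scaleR_one)
  then have "rotation_matrix (matrix f)"
    using orth by (simp add: rotation_matrix_def orthogonal_transformation_matrix)
  moreover have "matrix f *v z = f z" for z using lin by (simp add: matrix_works)
  ultimately show ?thesis using that fu by metis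
qed

lemma surface_of_revolutionI:
  assumes "rotation_matrix Q" "Q *v u = u" "a + z \<in> l"
  shows "a + Q *v z \<in> surface_of_revolution l (dline a u)"
proof -
  let ?f = "\<lambda>x. Q *v x + (a - Q *v a)"
  have "rotation_about (dline a u) ?f"
    unfolding rotation_about_def using assms(1,2)
    by (auto simp: mem_dline matrix_vector_right_distrib matrix_vector_mult_scaleR)
  moreover have "?f (a + z) = a + Q *v z" by (simp add: matrix_vector_right_distrib)
  ultimately show ?thesis unfolding surface_of_revolution_def using assms(3) by (metis (mono_tags, lifting) UN_I image_eqI mem_Collect_eq)
qed

lemma surface_of_revolutionE:
  assumes "y \<in> surface_of_revolution l (dline a u)"
  obtains Q z where "rotation_matrix Q" "Q *v u = u" "a + z \<in> l" "y = a + Q *v z"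
proof -
  obtain f x where f: "rotation_about (dline a u) f" and x: "x \<in> l" "y = f x"
    using assms by (auto simp: surface_of_revolution_def)
  obtain Q where Q: "rotation_matrix Q" "Q *v u = u" "\<And>z. f (a + z) = a + Q *v z"
    using rotation_aboutE[OF f] by metis
  have "a + (x - a) \<in> l" "y = a + Q *v (x - a)" using x Q(3)[of "x - a"] by simp_all
  then show ?thesis using that Q by blast
qed

subsection \<open>Rulings\<close>

context coaxial_spheres
begin

text \<open>The axial component of \<open>y - a\<close> fixes the parameter \<open>t\<close>. In the
  plane orthogonal to \<open>u\<close>, where the cross product with \<open>u\<close> acts as the
  imaginary unit, the remaining equation is (t + i \<mu>) w = p, and the quadric ensures that
  \<open>w\<close> has length \<open>\<beta>\<close>.\<close>

lemma exists_generator: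
  assumes \<kappa>0: "0 < \<kappa>" and h0: "0 < h" and \<sigma>: "\<sigma> = 1 \<or> \<sigma> = -1" and y: "y \<in> quadric"
  shows "\<exists>v\<in>V. y \<in> gen \<sigma> v"
proof -
  define z where "z = y - a"
  define t where "t = (z \<bullet> u) / \<kappa>"
  define \<mu> where "\<mu> = \<sigma> * h / \<beta>"
  define D where "D = t\<^sup>2 + \<mu>\<^sup>2"
  define p where "p = z - (t * \<kappa>) *\<^sub>R u"
  \<comment> \<open>Division by t + i \<mu>: multiplication by its conjugate over its squared
    modulus \<open>D\<close>.\<close>
  define w where "w = (1 / D) *\<^sub>R (t *\<^sub>R p - \<mu> *\<^sub>R (u \<times> p))"
  have zu: "z \<bullet> u = t * \<kappa>" using \<kappa>0 by (simp add: t_def)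
  have \<mu>: "\<mu>\<^sup>2 * \<beta>\<^sup>2 = h\<^sup>2" "\<mu> \<noteq> 0" using \<sigma> \<beta>_pos h0 by (auto simp: \<mu>_def power_divide)
  have D: "D \<noteq> 0" using \<mu>(2) by (simp add: D_def add_nonneg_eq_0_iff)
  have pu: "p \<bullet> u = 0" "u \<bullet> p = 0" using zu uu by (simp_all add: p_def inner_diff_left inner_diff_right inner_commute[of u z])
  have "\<kappa>\<^sup>2 * (z \<bullet> z - h\<^sup>2) = \<kappa>\<^sup>2 * t\<^sup>2"
    using y zu unfolding quadric_def by (simp add: z_def power2_norm_eq_inner power_mult_distrib mult.commute)
  then have zz: "z \<bullet> z = h\<^sup>2 + t\<^sup>2" using \<kappa>0 by simp
  have "p \<bullet> p = z \<bullet> z - (t * \<kappa>)\<^sup>2"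
    using zu uu by (simp add: p_def inner_diff_left inner_diff_right inner_commute[of u z] power2_eq_square)
  also have "\<dots> = h\<^sup>2 + t\<^sup>2 * \<beta>\<^sup>2" unfolding zz \<beta>_sq by (simp add: power_mult_distrib algebra_simps)
  finally have pp: "p \<bullet> p = \<beta>\<^sup>2 * D" unfolding D_def using \<mu>(1) by (simp add: algebra_simps)
  have cross: "u \<times> (u \<times> p) = - p" using pu uu by (simp add: Lagrange)
  have "(u \<times> p) \<bullet> (u \<times> p) = p \<bullet> p" using uu pu by (simp add: dot_cross)
  then have "w \<bullet> w = (1 / D)\<^sup>2 * (t\<^sup>2 * (p \<bullet> p) + \<mu>\<^sup>2 * (p \<bullet> p))"
    by (simp add: w_def inner_diff_left inner_diff_right dot_cross_self power2_eq_square add_divide_distrib)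
  also have "\<dots> = \<beta>\<^sup>2" unfolding pp using D by (simp add: D_def[symmetric] flip: distrib_right) (simp add: power2_eq_square)
  finally have ww: "w \<bullet> w = \<beta>\<^sup>2" .
  have wu: "w \<bullet> u = 0" "u \<bullet> w = 0"
    using pu by (simp_all add: w_def inner_diff_left inner_diff_right dot_cross_self)
  define v where "v = \<kappa> *\<^sub>R u + w"
  have "v \<bullet> v = \<kappa>\<^sup>2 + \<beta>\<^sup>2" using ww wu uu by (simp add: v_def inner_add_left inner_add_right power2_eq_square)
  then have vV: "v \<in> V" using wu uu by (simp add: V_def v_def inner_add_right norm_eq_1 \<beta>_sq)
  have "u \<times> w = (1 / D) *\<^sub>R (t *\<^sub>R (u \<times> p) + \<mu> *\<^sub>R p)"
    by (simp add: w_def cross_mult_right Cross3.right_diff_distrib cross)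
  then have "\<mu> *\<^sub>R (u \<times> w) + t *\<^sub>R w = (1 / D) *\<^sub>R (D *\<^sub>R p)"
    by (simp add: w_def D_def power2_eq_square algebra_simps)
  then have "\<mu> *\<^sub>R (u \<times> v) + t *\<^sub>R v = z"
    using D by (simp add: v_def cross_add_right cross_mult_right p_def algebra_simps)
  then have "y = a + \<mu> *\<^sub>R (u \<times> v) + t *\<^sub>R v" by (simp add: z_def algebra_simps)
  then have "y \<in> gen \<sigma> v" unfolding gen_def \<mu>_def[symmetric] by simp
  then show ?thesis using vV by blast
qed

text \<open>Equal heights give equal parameters. The difference of the directions is then
  annihilated by the map t + i \<mu> on the plane orthogonal to \<open>u\<close>, which is injective
  since \<open>\<mu>\<close> is nonzero.\<close>

lemma unique_generator:
  assumes \<kappa>0: "0 < \<kappa>" and h0: "0 < h" and \<sigma>: "\<sigma> = 1 \<or> \<sigma> = -1" and v: "v \<in> V" "v' \<in> V"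
    and y: "y \<in> gen \<sigma> v" "y \<in> gen \<sigma> v'"
  shows "v = v'"
proof -
  define \<mu> where "\<mu> = \<sigma> * h / \<beta>"
  have \<mu>: "\<mu> \<noteq> 0" using \<sigma> \<beta>_pos h0 by (auto simp: \<mu>_def)
  obtain t where t: "y = a + (\<sigma> * h / \<beta>) *\<^sub>R (u \<times> v) + t *\<^sub>R v" using y(1) unfolding gen_def mem_dline by blast
  obtain t' where t': "y = a + (\<sigma> * h / \<beta>) *\<^sub>R (u \<times> v') + t' *\<^sub>R v'" using y(2) unfolding gen_def mem_dline by blast
  have "t = t'" using gen_point(1)[OF v(1) \<sigma> t] gen_point(1)[OF v(2) \<sigma> t'] \<kappa>0 by simp
  then have "\<mu> *\<^sub>R (u \<times> (v - v')) + t *\<^sub>R (v - v') = 0"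
    using t t' unfolding \<mu>_def[symmetric] by (simp add: Cross3.right_diff_distrib algebra_simps)
  then have "(\<mu> *\<^sub>R (u \<times> (v - v')) + t *\<^sub>R (v - v')) \<bullet> (u \<times> (v - v')) = 0" by simp
  then have "(u \<times> (v - v')) \<bullet> (u \<times> (v - v')) = 0" using \<mu> by (simp add: inner_add_left dot_cross_self)
  moreover have "u \<bullet> (v - v') = 0" using V_unit v by (simp add: inner_diff_right)
  ultimately have "(v - v') \<bullet> (v - v') = 0" using uu by (simp add: dot_cross)
  then show ?thesis by simp
qed

lemma is_ruling_generators:
  assumes "0 < \<kappa>" "0 < h" "\<sigma> = 1 \<or> \<sigma> = -1"
  shows "is_ruling (gen \<sigma> ` V) quadric"
  unfolding is_ruling_def
proof (intro conjI ballI)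
  show "gen \<sigma> ` V \<subseteq> lines_in quadric"
  proof
    fix L assume "L \<in> gen \<sigma> ` V"
    then have L: "L \<in> common_tangents c r" using gen_common_tangent[OF _ assms(3)] by blast
    then show "L \<in> lines_in quadric"
      using common_tangent_subset_quadric[OF L] by (simp add: lines_in_def common_tangents_def)
  qed
  fix y assume "y \<in> quadric"
  then obtain v where v: "v \<in> V" "y \<in> gen \<sigma> v" using exists_generator assms by blast
  show "\<exists>!L. L \<in> gen \<sigma> ` V \<and> y \<in> L"
  proof (rule ex1I)
    show "gen \<sigma> v \<in> gen \<sigma> ` V \<and> y \<in> gen \<sigma> v" using v by blast
  next
    fix L assume "L \<in> gen \<sigma> ` V \<and> y \<in> L"
    then obtain v' where v': "v' \<in> V" "L = gen \<sigma> v'" "y \<in> gen \<sigma> v'" by blast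
    then show "L = gen \<sigma> v" using unique_generator[OF assms v'(1) v(1) v'(3) v(2)] by simp
  qed
qed

text \<open>The vector \<open>v' - v\<close> is orthogonal to \<open>u\<close> and, the lengths
  being equal, to \<open>v + v'\<close>; so it is parallel to \<open>u \<times> (v + v')\<close>.
  The factor \<open>k\<close> yields the same parameter \<open>\<mu> * k\<close> on both
  lines.\<close>

lemma opposite_generators_meet:
  assumes "0 < h" and \<sigma>: "\<sigma> = 1 \<or> \<sigma> = -1" and v: "v \<in> V" "v' \<in> V" "v \<noteq> v'"
  shows "gen \<sigma> v \<inter> gen (- \<sigma>) v' \<noteq> {}"
proof -
  define \<mu> where "\<mu> = \<sigma> * h / \<beta>"
  let ?N = "v' - v"
  have "?N \<bullet> (v + v') = 0" using V_unit v by (simp add: inner_diff_left inner_add_right inner_commute[of v' v])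
  moreover have "?N \<bullet> u = 0" using V_unit v by (simp add: inner_diff_left)
  ultimately have "?N \<times> (u \<times> (v + v')) = 0" by (simp add: Lagrange)
  then obtain k where k: "u \<times> (v + v') = k *\<^sub>R ?N" using cross_eq_0_imp_multiple[of ?N] v(3) by auto
  have "a + \<mu> *\<^sub>R (u \<times> v) + (\<mu> * k) *\<^sub>R v = a + (- \<mu>) *\<^sub>R (u \<times> v') + (\<mu> * k) *\<^sub>R v'"
  proof -
    have "\<mu> *\<^sub>R (u \<times> v) + \<mu> *\<^sub>R (u \<times> v') = (\<mu> * k) *\<^sub>R v' - (\<mu> * k) *\<^sub>R v"
      using arg_cong[OF k, of "\<lambda>x. \<mu> *\<^sub>R x"] by (simp add: cross_add_right algebra_simps)
    then show ?thesis by (simp add: algebra_simps)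
  qed
  moreover have "a + \<mu> *\<^sub>R (u \<times> v) + (\<mu> * k) *\<^sub>R v \<in> gen \<sigma> v" unfolding gen_def \<mu>_def[symmetric] by simp
  moreover have "a + (- \<mu>) *\<^sub>R (u \<times> v') + (\<mu> * k) *\<^sub>R v' \<in> gen (- \<sigma>) v'"
  proof -
    have "- \<sigma> * h / \<beta> = - \<mu>" by (simp add: \<mu>_def)
    then show ?thesis unfolding gen_def by simp
  qed
  ultimately show ?thesis by (metis disjoint_iff)
qed

text \<open>Within its own ruling \<open>l\<close> meets only itself, the single exceptional line.
  In the opposite ruling it meets every line except the one with its own direction, which is a
  proper parallel.\<close>

lemma hyperboloid_family:
  assumes \<kappa>0: "0 < \<kappa>" and h0: "0 < h" and l: "l \<in> common_tangents c r"
  shows "\<exists>R. is_ruling R quadric \<and> infinite_family (R - proper_parallels l) (common_tangents_meeting l c r)"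
proof -
  obtain \<sigma> v0 where \<sigma>: "\<sigma> = 1 \<or> \<sigma> = -1" and v0: "v0 \<in> V" and lg: "l = gen \<sigma> v0" using l by (rule common_tangentE)
  have m\<sigma>: "- \<sigma> = 1 \<or> - \<sigma> = -1" using \<sigma> by auto
  have line: "is_line l" using l by (simp add: common_tangents_def)
  let ?R = "gen (- \<sigma>) ` V"
  let ?T = "common_tangents_meeting l c r"
  have sub: "?R - proper_parallels l \<subseteq> ?T"
  proof
    fix L assume L: "L \<in> ?R - proper_parallels l"
    then obtain v where v: "v \<in> V" "L = gen (- \<sigma>) v" by blast
    have CT: "L \<in> common_tangents c r" using gen_common_tangent[OF v(1) m\<sigma>] v(2) by simp
    have "L \<inter> l \<noteq> {}"
    proof (cases "v = v0")
      case True
      have "affine_parallel l L" unfolding lg v(2) gen_def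
        using affine_parallel_dline[OF V_unit(1)[OF v0] V_unit(1)[OF v(1)]] True by blast
      then have "L = l" using L CT by (simp add: proper_parallels_def common_tangents_def)
      then show ?thesis using is_line_nonempty[OF line] by simp
    next
      case False
      then show ?thesis using opposite_generators_meet[OF h0 \<sigma> v0 v(1)] unfolding lg v(2) by blast
    qed
    then show "L \<in> ?T" using CT by (simp add: common_tangents_meeting_eq)
  qed
  have "?T - (?R - proper_parallels l) \<subseteq> {l}"
  proof
    fix L assume L: "L \<in> ?T - (?R - proper_parallels l)"
    then have CT: "L \<in> common_tangents c r" and meet: "L \<inter> l \<noteq> {}" by (auto simp: common_tangents_meeting_eq)
    have "L \<notin> ?R" using L meeting_not_proper_parallel[OF line meet] by blast
    obtain \<tau> v where \<tau>: "\<tau> = 1 \<or> \<tau> = -1" and v: "v \<in> V" "L = gen \<tau> v" using CT by (rule common_tangentE)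
    have "\<tau> = \<sigma>" using \<open>L \<notin> ?R\<close> v \<tau> \<sigma> by auto
    then have "v = v0" using meet unique_generator[OF \<kappa>0 h0 \<sigma> v(1) v0] unfolding lg v(2) by blast
    then show "L \<in> {l}" using lg v(2) \<open>\<tau> = \<sigma>\<close> by simp
  qed
  then have "finite (?T - (?R - proper_parallels l))" using finite_subset by blast
  then have "infinite_family (?R - proper_parallels l) ?T"
    using sub infinite_nonparallel_generators[OF line] by (simp add: infinite_family_def)
  then show ?thesis using is_ruling_generators[OF \<kappa>0 h0 m\<sigma>] by blast
qed

text \<open>The quadric depends only on the distance from \<open>a\<close> and the height along
  \<open>u\<close>, both invariant under rotation.\<close>

lemma surface_subset_quadric:
  assumes "l \<subseteq> quadric"
  shows "surface_of_revolution l (dline a u) \<subseteq> quadric"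
proof
  fix y assume "y \<in> surface_of_revolution l (dline a u)"
  then obtain Q z where Q: "rotation_matrix Q" "Q *v u = u" and z: "a + z \<in> l" "y = a + Q *v z"
    by (rule surface_of_revolutionE)
  have "(Q *v z) \<bullet> u = z \<bullet> u" using rotation_matrix_inner[OF Q(1), of z u] Q(2) by simp
  moreover have "norm (Q *v z) = norm z" using rotation_matrix_inner[OF Q(1), of z z] by (simp add: norm_eq_sqrt_inner)
  moreover have "a + z \<in> quadric" using z assms by blast
  ultimately show "y \<in> quadric" unfolding quadric_def z(2) by simp
qed

text \<open>Every point of the quadric lies on a generator of the same ruling as \<open>l\<close>. A
  rotation carrying the direction of \<open>l\<close> to that of the generator also carries the
  cross products with \<open>u\<close>, hence the foot points.\<close>

lemma surface_eq_quadric: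
  assumes \<kappa>0: "0 < \<kappa>" and h0: "0 < h" and l: "l \<in> common_tangents c r"
  shows "surface_of_revolution l (dline a u) = quadric"
proof
  show "surface_of_revolution l (dline a u) \<subseteq> quadric"
    using surface_subset_quadric common_tangent_subset_quadric[OF l] by blast
  show "quadric \<subseteq> surface_of_revolution l (dline a u)"
  proof
    fix y assume "y \<in> quadric"
    obtain \<sigma> v0 where \<sigma>: "\<sigma> = 1 \<or> \<sigma> = -1" and v0: "v0 \<in> V" and lg: "l = gen \<sigma> v0" using l by (rule common_tangentE)
    obtain v where v: "v \<in> V" "y \<in> gen \<sigma> v" using exists_generator[OF \<kappa>0 h0 \<sigma> \<open>y \<in> quadric\<close>] by blast
    obtain t where t: "y = a + (\<sigma> * h / \<beta>) *\<^sub>R (u \<times> v) + t *\<^sub>R v" using v(2) unfolding gen_def mem_dline by blast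
    have ww: "(x - \<kappa> *\<^sub>R u) \<bullet> u = 0 \<and> (x - \<kappa> *\<^sub>R u) \<bullet> (x - \<kappa> *\<^sub>R u) = \<beta>\<^sup>2" if "x \<in> V" for x
      unfolding \<beta>_sq using V_unit[OF that] uu by (simp add: inner_diff_left inner_diff_right power2_eq_square)
    have "v0 - \<kappa> *\<^sub>R u \<noteq> 0" using ww[OF v0] \<beta>_pos by auto
    moreover have "norm (v - \<kappa> *\<^sub>R u) = norm (v0 - \<kappa> *\<^sub>R u)" using ww[OF v0] ww[OF v(1)] by (simp add: norm_eq_sqrt_inner)
    ultimately obtain Q where Q: "rotation_matrix Q" "Q *v u = u" "Q *v (v0 - \<kappa> *\<^sub>R u) = v - \<kappa> *\<^sub>R u"
      using rotation_exists_fixing[OF u] ww[OF v0] ww[OF v(1)] by metis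
    have Qv: "Q *v v0 = v" using Q(2,3) by (simp add: matrix_vector_mult_diff_distrib matrix_vector_mult_scaleR)
    have "Q *v (u \<times> v0) = u \<times> v" using cross_rotation_matrix[OF Q(1), of u v0] Q(2) Qv by simp
    then have "y = a + Q *v ((\<sigma> * h / \<beta>) *\<^sub>R (u \<times> v0) + t *\<^sub>R v0)"
      using Qv t by (simp add: matrix_vector_right_distrib matrix_vector_mult_scaleR)
    moreover have "a + ((\<sigma> * h / \<beta>) *\<^sub>R (u \<times> v0) + t *\<^sub>R v0) \<in> l"
      unfolding lg gen_def add.assoc[symmetric] by simp
    ultimately show "y \<in> surface_of_revolution l (dline a u)" using surface_of_revolutionI[OF Q(1,2)] by metis
  qed
qed

lemma hyperboloid_quadric:
  assumes \<kappa>0: "0 < \<kappa>" and h0: "0 < h"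
  shows "hyperboloid_of_revolution quadric"
proof -
  \<comment> \<open>From the quadric rewritten with squared distance from the axis: dividing by the
    squares of \<open>\<kappa>\<close> and \<open>h\<close> leaves this semi-axis along
    \<open>u\<close>.\<close>
  define b where "b = h * \<kappa> / \<beta>"
  have b: "0 < b" using assms \<beta>_pos by (simp add: b_def)
  have "(x \<in> quadric) \<longleftrightarrow> ((norm (x - a))\<^sup>2 - ((x - a) \<bullet> u)\<^sup>2) / h\<^sup>2 - ((x - a) \<bullet> u)\<^sup>2 / b\<^sup>2 = 1" for x
  proof -
    define n q where "n = (norm (x - a))\<^sup>2" and "q = ((x - a) \<bullet> u)\<^sup>2"
    have "(n - q) / h\<^sup>2 - q / b\<^sup>2 = 1 \<longleftrightarrow> \<kappa>\<^sup>2 * (n - q) - \<beta>\<^sup>2 * q = \<kappa>\<^sup>2 * h\<^sup>2"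
      using assms \<beta>_pos by (auto simp: b_def power_divide power_mult_distrib field_simps)
    also have "\<dots> \<longleftrightarrow> \<kappa>\<^sup>2 * (n - h\<^sup>2) = q" unfolding \<beta>_sq by (auto simp: algebra_simps)
    finally show ?thesis unfolding quadric_def by (simp add: n_def q_def)
  qed
  then have "quadric = {x. ((norm (x - a))\<^sup>2 - ((x - a) \<bullet> u)\<^sup>2) / h\<^sup>2 - ((x - a) \<bullet> u)\<^sup>2 / b\<^sup>2 = 1}" by blast
  then show ?thesis unfolding hyperboloid_of_revolution_def using u b h0 by blast
qed

lemma tangent_generator_quadric:
  assumes "0 < \<kappa>" "0 < h" "l \<in> common_tangents c r"
  shows "tangent_generator l c r (dline a u)"
proof -
  have "is_line (dline a u)" using u by (intro is_line_dline) auto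
  moreover have "range c \<subseteq> dline a u" using centre by (auto simp: mem_dline)
  ultimately show ?thesis unfolding tangent_generator_def surface_eq_quadric[OF assms]
    using hyperboloid_quadric[OF assms(1,2)] assms(3) by (simp add: common_tangents_def)
qed

end

text \<open>The centre and axis in \<open>hyperboloid_of_revolution\<close> are not assumed to be
  related to \<open>m\<close>, so the degenerate positions of \<open>l\<close> are excluded by
  intrinsic properties: a generator parallel to \<open>m\<close> gives a translation-invariant
  surface, \<open>\<kappa> = 0\<close> a planar one, \<open>h = 0\<close> a conical one.\<close>

lemma tangent_generator_imp_coaxial:
  assumes m: "tangent_generator l c r m" and l: "is_line l" and r: "\<And>i. 0 < r i"
    and inj: "inj (\<lambda>i. sphere (c i) (r i))"
  obtains a u d \<kappa> h where "coaxial_spheres c r a u d \<kappa> h" "0 < \<kappa>" "0 < h" "m = dline a u"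
    "l \<in> common_tangents c r"
proof -
  have m': "is_line m" "range c \<subseteq> m" and CT: "l \<in> common_tangents c r"
    and hyp: "hyperboloid_of_revolution (surface_of_revolution l m)"
    using m l by (auto simp: tangent_generator_def common_tangents_def)
  obtain b u where bu: "norm u = 1" "m = dline b u" using is_line_footE[OF m'(1)] by metis
  have "\<forall>i. \<exists>t. c i = b + t *\<^sub>R u" 
  proof
    fix i
    have "c i \<in> dline b u" using m'(2) unfolding bu(2) by blast
    then show "\<exists>t. c i = b + t *\<^sub>R u" unfolding mem_dline .
  qed
  then obtain d where c: "\<And>i. c i = b + d i *\<^sub>R u" by metis
  obtain p v where v: "norm v = 1" "l = dline p v" "(p - b) \<bullet> v = 0" using l by (rule is_line_footE)
  have "(u \<bullet> v)\<^sup>2 \<noteq> 1"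
  proof
    assume "(u \<bullet> v)\<^sup>2 = 1"
    then have uv: "u = v \<or> u = - v" using unit_parallel[OF bu(1) v(1)] by blast
    have "y + t *\<^sub>R u \<in> surface_of_revolution l m" if y: "y \<in> surface_of_revolution l m" for y t
    proof -
      obtain Q z where Q: "rotation_matrix Q" "Q *v u = u" and z: "b + z \<in> l" "y = b + Q *v z"
        using y unfolding bu(2) by (rule surface_of_revolutionE)
      have "l = dline (b + z) v" using dline_rebase z(1) v(2) by blast
      then have "l = dline (b + z) u" using uv dline_uminus[of "b + z" v] by auto
      then have "b + (z + t *\<^sub>R u) \<in> l" using dline_point[of "b + z" t u] by (simp add: add.assoc)
      then have "b + Q *v (z + t *\<^sub>R u) \<in> surface_of_revolution l m"
        unfolding bu(2) by (rule surface_of_revolutionI[OF Q])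
      moreover have "b + Q *v (z + t *\<^sub>R u) = y + t *\<^sub>R u"
        using z(2) Q(2) by (simp add: matrix_vector_right_distrib matrix_vector_mult_scaleR)
      ultimately show ?thesis by simp
    qed
    then have "u = 0" by (rule hyperboloid_not_cylindrical[OF hyp])
    then show False using bu by simp
  qed
  then obtain s d' h where coax: "coaxial_spheres c r (b + s *\<^sub>R u) u d' \<bar>u \<bullet> v\<bar> h"
    using coaxial_normal_form[where c=c and d=d and r=r, OF bu(1) c r inj v(1,3)] CT v(2) by blast
  define a \<kappa> where "a = b + s *\<^sub>R u" and "\<kappa> = \<bar>u \<bullet> v\<bar>"
  interpret coaxial_spheres c r a u d' \<kappa> h using coax by (simp add: a_def \<kappa>_def)
  have ma: "m = dline a u" unfolding bu(2) a_def using dline_rebase dline_point by blast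
  have surf: "surface_of_revolution l m \<subseteq> quadric"
    unfolding ma using surface_subset_quadric common_tangent_subset_quadric[OF CT] by blast
  have "\<kappa> \<noteq> 0"
  proof
    assume k: "\<kappa> = 0"
    have "u \<bullet> y = u \<bullet> a" if "y \<in> surface_of_revolution l m" for y
    proof -
      have "(y - a) \<bullet> u = 0" using that surf mem_quadric_plane[OF k] by blast
      then show ?thesis by (simp add: inner_diff_left inner_commute[of u])
    qed
    then have "u = 0" by (rule hyperboloid_not_planar[OF hyp])
    then show False using u by simp
  qed
  moreover have "h \<noteq> 0"
  proof
    assume h: "h = 0"
    obtain \<sigma> w where lg: "l = gen \<sigma> w" using CT by (rule common_tangentE)
    then have lw: "l = dline a w" unfolding gen_apex[OF h] by simp
    have "a + t *\<^sub>R (y - a) \<in> surface_of_revolution l m" if y: "y \<in> surface_of_revolution l m" for y t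
    proof -
      obtain Q z where Q: "rotation_matrix Q" "Q *v u = u" and z: "a + z \<in> l" "y = a + Q *v z"
        using y unfolding ma by (rule surface_of_revolutionE)
      obtain k where "z = k *\<^sub>R w" using z(1) unfolding lw mem_dline by auto
      then have "a + t *\<^sub>R z \<in> l" unfolding lw using dline_point[of a "t * k" w] by simp
      then have "a + Q *v (t *\<^sub>R z) \<in> surface_of_revolution l m"
        unfolding ma by (rule surface_of_revolutionI[OF Q])
      then show ?thesis using z(2) by (simp add: matrix_vector_mult_scaleR)
    qed
    then show False by (rule hyperboloid_not_conical[OF hyp])
  qed
  ultimately have "0 < \<kappa>" "0 < h" using \<kappa> h by auto
  then show ?thesis using that coaxial_spheres_axioms ma CT by blast
qed

section \<open>Classification by the vanishing of \<open>\<kappa>\<close> and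
  \<open>h\<close>\<close>

theorem theorem1:
  fixes l :: "(real^3) set" and c :: "3 \<Rightarrow> real^3" and r :: "3 \<Rightarrow> real"
  assumes "is_line l"
    and "\<forall>i. r i > 0"
    and "inj (\<lambda>i. sphere (c i) (r i))"
  defines "T \<equiv> common_tangents_meeting l c r"
  shows "(infinite T \<longleftrightarrow>
           (\<exists>p P. tangent_at c r p P \<and> (p \<in> l \<or> l \<subseteq> P)) \<or>
           (\<exists>K a. inscribed_in_cone c r K a \<and> a \<in> l) \<or>
           (\<exists>C P. meet_in_circle c r C P \<and> l \<subseteq> P) \<or>
           (\<exists>m. tangent_generator l c r m))
       \<and> (\<forall>p P. tangent_at c r p P \<and> p \<in> l \<longrightarrow>
             infinite_family {L \<in> lines_in P. p \<in> L} T)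
       \<and> (\<forall>p P. tangent_at c r p P \<and> l \<subseteq> P \<longrightarrow>
             infinite_family ({L \<in> lines_in P. p \<in> L} - proper_parallels l) T)
       \<and> (\<forall>K a. inscribed_in_cone c r K a \<and> a \<in> l \<longrightarrow>
             infinite_family (lines_in K) T)
       \<and> (\<forall>C P. meet_in_circle c r C P \<and> l \<subseteq> P \<longrightarrow>
             infinite_family ({L \<in> lines_in P. tangent_line L C} - proper_parallels l) T)
       \<and> (\<forall>m. tangent_generator l c r m \<longrightarrow>
             (\<exists>R. is_ruling R (surface_of_revolution l m) \<and>
                  infinite_family (R - proper_parallels l) T))"
proof -
  have l: "is_line l" and r: "\<And>i. 0 < r i" and inj: "inj (\<lambda>i. sphere (c i) (r i))" using assms by auto
  have pencil: "(p \<in> l \<longrightarrow> infinite_family {L \<in> lines_in P. p \<in> L} T)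
      \<and> (l \<subseteq> P \<longrightarrow> infinite_family ({L \<in> lines_in P. p \<in> L} - proper_parallels l) T)"
    if tan: "tangent_at c r p P" for p P
  proof -
    obtain u d where coax: "coaxial_spheres c r p u d 0 0" and P: "P = {y. (y - p) \<bullet> u = 0}"
      using tan r inj by (rule tangent_at_imp_coaxial)
    interpret coaxial_spheres c r p u d 0 0 by (rule coax)
    have "P = quadric" by (simp only: P quadric_plane)
    then show ?thesis using apex_family plane_family pencil_eq l by (simp add: T_def)
  qed
  have cone: "infinite_family (lines_in K) T" if K: "inscribed_in_cone c r K a" and a: "a \<in> l" for K a
  proof -
    obtain u d \<kappa> where coax: "coaxial_spheres c r a u d \<kappa> 0" and pos: "0 < \<kappa>"
      and Keq: "K = {y. \<kappa>\<^sup>2 * ((norm (y - a))\<^sup>2 - 0\<^sup>2) = ((y - a) \<bullet> u)\<^sup>2}"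
      using K r inj by (rule inscribed_imp_coaxial)
    interpret coaxial_spheres c r a u d \<kappa> 0 by (rule coax)
    have "K = quadric" by (simp only: Keq quadric_def)
    then show ?thesis using apex_family cone_ruling_eq[OF pos] a l by (simp add: T_def)
  qed
  have circle: "infinite_family ({L \<in> lines_in P. tangent_line L C} - proper_parallels l) T"
    if C: "meet_in_circle c r C P" and lP: "l \<subseteq> P" for C P
  proof -
    obtain z u d \<rho> where coax: "coaxial_spheres c r z u d 0 \<rho>" and \<rho>: "0 < \<rho>"
      and P: "P = {y. (y - z) \<bullet> u = 0}" and Ceq: "C = sphere z \<rho> \<inter> P"
      using C r inj by (rule meet_in_circle_imp_coaxial)
    interpret coaxial_spheres c r z u d 0 \<rho> by (rule coax)
    have "P = quadric" by (simp only: P quadric_plane)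
    then show ?thesis using plane_family circle_tangents_eq \<rho> lP l Ceq by (simp add: T_def)
  qed
  have ruling: "\<exists>R. is_ruling R (surface_of_revolution l m) \<and> infinite_family (R - proper_parallels l) T"
    if m: "tangent_generator l c r m" for m
  proof -
    obtain a u d \<kappa> h where coax: "coaxial_spheres c r a u d \<kappa> h" and pos: "0 < \<kappa>" "0 < h"
      and meq: "m = dline a u" and CT: "l \<in> common_tangents c r"
      using m l r inj by (rule tangent_generator_imp_coaxial)
    interpret coaxial_spheres c r a u d \<kappa> h by (rule coax)
    show ?thesis using hyperboloid_family[OF pos CT] surface_eq_quadric[OF pos CT] by (simp add: T_def meq)
  qed
  have classify: "(\<exists>p P. tangent_at c r p P \<and> (p \<in> l \<or> l \<subseteq> P)) \<or>
       (\<exists>K a. inscribed_in_cone c r K a \<and> a \<in> l) \<or>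
       (\<exists>C P. meet_in_circle c r C P \<and> l \<subseteq> P) \<or> (\<exists>m. tangent_generator l c r m)" (is ?cases)
    if inf: "infinite T"
  proof -
    obtain a u d \<kappa> h where coax: "coaxial_spheres c r a u d \<kappa> h"
      using infinite_imp_coaxial[where c=c and r=r, OF l r inj] inf unfolding T_def by blast
    interpret coaxial_spheres c r a u d \<kappa> h by (rule coax)
    have "h = 0 \<and> a \<in> l \<or> l \<subseteq> quadric" using infinite_meeting_cases[OF l] inf unfolding T_def by blast
    then consider "\<kappa> = 0" "h = 0" "a \<in> l \<or> l \<subseteq> quadric" | "\<kappa> = 0" "0 < h" "l \<subseteq> quadric"
      | "0 < \<kappa>" "h = 0" "a \<in> l" | "0 < \<kappa>" "h = 0" "l \<subseteq> quadric" | "0 < \<kappa>" "0 < h" "l \<subseteq> quadric"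
      using \<kappa> h by linarith
    then show ?cases
    proof cases
      case 1 then show ?thesis using tangent_at_centre by blast
    next
      case 2 then show ?thesis using meet_in_circle_quadric by blast
    next
      case 3 then show ?thesis using inscribed_quadric by blast
    next
      \<comment> \<open>A line on a cone is one of its generators and passes through the apex, so
        this falls under the cone case.\<close>
      case 4
      then have "l \<in> common_tangents c r" using line_in_quadric_common_tangent l by blast
      then obtain \<sigma> v where "l = gen \<sigma> v" by (rule common_tangentE)
      then have "a \<in> l" unfolding gen_apex[OF 4(2)] by simp
      then show ?thesis using inscribed_quadric 4 by blast
    next
      case 5
      then have "l \<in> common_tangents c r" using line_in_quadric_common_tangent l by blast
      then show ?thesis using tangent_generator_quadric 5 by blast
    qed
  qed
  \<comment> \<open>The descriptions of the families thereby supply the converse of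
    \<open>classify\<close>.\<close>
  have infinite: "infinite T" if "infinite_family F T" for F
    using that by (auto simp: infinite_family_def dest: finite_subset)
  show ?thesis
    using pencil cone circle ruling classify infinite by (intro conjI) meson+
qed

end
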